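(* Let $G=(V,E)$ be a connected locally finite weighted graph with measure $\mu$, and let $\Omega\subset V$ be a bounded domain with $\Omega^{\circ}\neq\emptyset$ and $\partial\Omega\neq\emptyset$. Let $p,q,r>1$, $\alpha,\beta>0$, $k\ge 0$ with $r<\min\{p,q\}\le\max\{p,q\}\le (k+1)\max\{p,q\}<\alpha+\beta$. Let $M_i(s)=a_i+b_is^k$ for $s\ge0$, $i=1,2$, with $b_1,b_2>0$, $a_1>C_{1,p}(\Omega)^p$ and $a_2>C_{1,q}(\Omega)^q$. Let $h_1,h_2,h_3:\Omega\to(0,\infty)$ and $g_1,g_2:\Omega\to\mathbb{R}$. Set $$\mathcal{M}_1=2^{1-\max\{p,q\}(k+1)}\min\left\{\frac{b_1}{p(k+1)},\frac{b_2}{q(k+1)}\right\},\qquad \mathcal{M}_2=\frac{\|h_2\|_{\infty}}{(\alpha+\beta)^2}\max\left\{\alpha C_{1,p}(\Omega)^{\alpha+\beta},\beta C_{1,q}(\Omega)^{\alpha+\beta}\right\}.$$ Suppose $\lambda_1,\lambda_2$ satisfy $0<\lambda_1<a_1C_{1,p}(\Omega)^{-p}-1$ and $0<\lambda_2<a_2C_{1,q}(\Omega)^{-q}-1$, that $\mathcal{M}_1\le\frac{\alpha+\beta}{\max\{p,q\}(k+1)}\mathcal{M}_2$, and that $$\max\left\{\frac{\lambda_1(p-r)}{pr},\frac{\lambda_2(q-r)}{qr}\right\}\left(\|h_1\|^{\frac{p}{p-r}}_{L^{\frac{p}{p-r}}(\Omega)}+\|h_3\|^{\frac{q}{q-r}}_{L^{\frac{q}{q-r}}(\Omega)}\right)+\max\left\{\frac{p-1}{p},\frac{q-1}{q}\right\}\left(\|g_1\|^{\frac{p}{p-1}}_{L^{\frac{p}{p-1}}(\Omega)}+\|g_2\|^{\frac{q}{q-1}}_{L^{\frac{q}{q-1}}(\Omega)}\right)$$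 $$<\frac{\alpha+\beta-\max\{p,q\}(k+1)}{\alpha+\beta}\,\mathcal{M}_1^{\frac{\alpha+\beta}{\alpha+\beta-\max\{p,q\}(k+1)}}\left(\frac{\max\{p,q\}(k+1)}{(\alpha+\beta)\mathcal{M}_2}\right)^{\frac{\max\{p,q\}(k+1)}{\alpha+\beta-\max\{p,q\}(k+1)}}.$$ Then the system $$\begin{cases}-M_1(\|\nabla u\|_p^p)\Delta_pu=\lambda_1 h_1(x)|u|^{r-2}u+\frac{\alpha}{\alpha+\beta}h_2(x)|u|^{\alpha-2}u|v|^{\beta}+g_1(x), & x\in\Omega,\\ -M_2(\|\nabla v\|_q^q)\Delta_qv=\lambda_2 h_3(x)|v|^{r-2}v+\frac{\beta}{\alpha+\beta}h_2(x)|u|^{\alpha}|v|^{\beta-2}v+g_2(x), & x\in\Omega,\\ u(x)=v(x)=0, & x\in\partial\Omega,\end{cases}$$ admits one nontrivial solution $(u_0,v_0)$ of positive energy, $\varphi(u_0,v_0)>0$, and one nontrivial solution $(u_0^\star,v_0^\star)$ of negative energy, $\varphi(u_0^\star,v_0^\star)<0$.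
   Context: Graph setting. $G=(V,E)$ is a connected graph in which every vertex has finitely many edges; each edge $xy\in E$ has a weight $\omega_{xy}=\omega_{yx}>0$; $y\sim x$ means $xy\in E$. $\mu:V\to(0,\infty)$ is a (finite) vertex measure with $\mu(x)\ge\mu_0>0$ for all $x$. The distance $d(x,y)$ is the minimal number of edges in a path linking $x$ to $y$. $\Omega\subset V$ is a bounded domain if $d(x,y)$ is uniformly bounded for $x,y\in\Omega$ (so $\Omega$ is finite). $\partial\Omega=\{y\in V\setminus\Omega:\exists x\in\Omega,\ xy\in E\}$ and $\Omega^\circ=\Omega\setminus\partial\Omega$. For $A\subset V$, $\int_A\psi\,d\mu=\sum_{x\in A}\mu(x)\psi(x)$. Operators. $\Gamma(\psi_1,\psi_2)(x)=\frac{1}{2\mu(x)}\sum_{y\sim x}\omega_{xy}(\psi_1(y)-\psi_1(x))(\psi_2(y)-\psi_2(x))$, $|\nabla\psi|(x)=\sqrt{\Gamma(\psi,\psi)(x)}$, and for $l>1$ $$\Delta_l\psi(x)=\frac{1}{2\mu(x)}\sum_{y\sim x}\left(|\nabla\psi|^{l-2}(y)+|\nabla\psi|^{l-2}(x)\right)\omega_{xy}(\psi(y)-\psi(x)).$$ Convention: a product of a possibly negative power of $0$ with a vanishing factor is read as $0$ (for instance $|\nabla\psi|^{l-2}(x)(\psi(y)-\psi(x))=0$ if $|\nabla\psi|(x)=0$, and $|t|^{s-2}t=0$ at $t=0$). Spaces. $C_c(\Omega)$ is the set of $\psi:V\to\mathbb{R}$ with $\psi=0$ on $V\setminus\Omega$.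 $\|u\|_{L^\gamma(\Omega)}=(\int_\Omega|u|^\gamma d\mu)^{1/\gamma}$ for $1\le\gamma<\infty$, and $\|u\|_\infty=\max_{\Omega}|u|$. $W_0^{1,l}(\Omega)$ is the completion of $C_c(\Omega)$ (hence, $\Omega$ being finite, $C_c(\Omega)$ itself) under $\|u\|_{W_0^{1,l}(\Omega)}=\left(\int_{\Omega\cup\partial\Omega}|\nabla u|^l d\mu\right)^{1/l}$. Here $\|\nabla u\|_l^l$ means $\|u\|_{W_0^{1,l}(\Omega)}^l$. $C_{1,l}(\Omega)>0$ denotes a fixed embedding constant depending only on $l$ and $\Omega$ such that $\|u\|_{L^\gamma(\Omega)}\le C_{1,l}(\Omega)\|u\|_{W_0^{1,l}(\Omega)}$ for all $1\le\gamma\le+\infty$ and all $u\in W_0^{1,l}(\Omega)$. Solutions and energy. A solution is a pair $(u,v)\in X:=W_0^{1,p}(\Omega)\times W_0^{1,q}(\Omega)$ satisfying the system pointwise; it is nontrivial if $(u,v)\ne(0,0)$. Its energy is $$\varphi(u,v)=\tfrac{a_1}{p}\|u\|_{W_0^{1,p}(\Omega)}^p+\tfrac{b_1}{p(k+1)}\|u\|_{W_0^{1,p}(\Omega)}^{p(k+1)}+\tfrac{a_2}{q}\|v\|_{W_0^{1,q}(\Omega)}^q+\tfrac{b_2}{q(k+1)}\|v\|_{W_0^{1,q}(\Omega)}^{q(k+1)}-\tfrac{\lambda_1}{r}\int_\Omega h_1|u|^rd\mu-\tfrac{\lambda_2}{r}\int_\Omega h_3|v|^rd\mu-\tfrac{1}{\alpha+\beta}\int_\Omega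 h_2|u|^\alpha|v|^\beta d\mu-\int_\Omega g_1u\,d\mu-\int_\Omega g_2v\,d\mu.$$ *)

theory Defs
  imports "HOL-Analysis.Analysis"
begin

text \<open>
  Edges are stored as a symmetric relation on the vertex set. Loops are not excluded; they
  contribute nothing to any of the operators below, nor to distances or boundaries.
\<close>

record 'v wgraph =
  vertices :: "'v set"
  edges :: "'v rel"
  weight :: "'v \<Rightarrow> 'v \<Rightarrow> real"
  vmeas :: "'v \<Rightarrow> real"

locale connected_wgraph =
  fixes G :: "'v wgraph"
  assumes edges_subset: "edges G \<subseteq> vertices G \<times> vertices G"
    and edges_sym: "sym (edges G)"
    and locally_finite: "\<And>x. x \<in> vertices G \<Longrightarrow> finite {y. (x, y) \<in> edges G}"
    and connected: "\<And>x y. x \<in> vertices G \<Longrightarrow> y \<in> vertices G \<Longrightarrow> (x, y) \<in> (edges G)\<^sup>*"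
    and weight_pos: "\<And>x y. (x, y) \<in> edges G \<Longrightarrow> weight G x y > 0"
    and weight_sym: "\<And>x y. (x, y) \<in> edges G \<Longrightarrow> weight G x y = weight G y x"
    and vmeas_bound: "\<exists>\<mu>\<^sub>0>0. \<forall>x\<in>vertices G. vmeas G x \<ge> \<mu>\<^sub>0"

definition nbrs :: "'v wgraph \<Rightarrow> 'v \<Rightarrow> 'v set" where
  "nbrs G x = {y. (x, y) \<in> edges G}"

definition gdist :: "'v wgraph \<Rightarrow> 'v \<Rightarrow> 'v \<Rightarrow> nat" where
  "gdist G x y = (LEAST n. (x, y) \<in> edges G ^^ n)"

definition bounded_domain :: "'v wgraph \<Rightarrow> 'v set \<Rightarrow> bool" where
  "bounded_domain G \<Omega> \<longleftrightarrow>
     \<Omega> \<subseteq> vertices G \<and> (\<exists>D. \<forall>x\<in>\<Omega>. \<forall>y\<in>\<Omega>. gdist G x y \<le> D)"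

definition gboundary :: "'v wgraph \<Rightarrow> 'v set \<Rightarrow> 'v set" where
  "gboundary G \<Omega> = {y \<in> vertices G - \<Omega>. \<exists>x\<in>\<Omega>. (x, y) \<in> edges G}"

definition ginterior :: "'v wgraph \<Rightarrow> 'v set \<Rightarrow> 'v set" where
  "ginterior G \<Omega> = \<Omega> - gboundary G \<Omega>"

definition gintegral :: "'v wgraph \<Rightarrow> 'v set \<Rightarrow> ('v \<Rightarrow> real) \<Rightarrow> real" where
  "gintegral G A \<psi> = (\<Sum>x\<in>A. vmeas G x * \<psi> x)"

definition grad_form :: "'v wgraph \<Rightarrow> ('v \<Rightarrow> real) \<Rightarrow> ('v \<Rightarrow> real) \<Rightarrow> 'v \<Rightarrow> real" where
  "grad_form G \<psi>\<^sub>1 \<psi>\<^sub>2 x =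
     1 / (2 * vmeas G x) *
     (\<Sum>y\<in>nbrs G x. weight G x y * (\<psi>\<^sub>1 y - \<psi>\<^sub>1 x) * (\<psi>\<^sub>2 y - \<psi>\<^sub>2 x))"

definition grad_abs :: "'v wgraph \<Rightarrow> ('v \<Rightarrow> real) \<Rightarrow> 'v \<Rightarrow> real" where
  "grad_abs G \<psi> x = sqrt (grad_form G \<psi> \<psi> x)"

text \<open>
  Here \<^prop>\<open>0 powr s = (0::real)\<close> for every \<open>s\<close>. This implements the convention that a power of \<open>0\<close>
  multiplied by a vanishing factor is \<open>0\<close>: if \<open>grad_abs G \<psi>\<close> vanishes at \<open>x\<close> or at a neighbour
  \<open>y\<close> of \<open>x\<close>, then \<open>\<psi> y - \<psi> x = 0\<close>. In particular the value of \<open>0 powr 0\<close> is irrelevant when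
  \<open>l = 2\<close>.
\<close>

definition graph_laplacian :: "'v wgraph \<Rightarrow> real \<Rightarrow> ('v \<Rightarrow> real) \<Rightarrow> 'v \<Rightarrow> real" where
  "graph_laplacian G l \<psi> x =
     1 / (2 * vmeas G x) *
     (\<Sum>y\<in>nbrs G x. (grad_abs G \<psi> y powr (l - 2) + grad_abs G \<psi> x powr (l - 2)) *
        weight G x y * (\<psi> y - \<psi> x))"

text \<open>
  Functions on the vertex set are total functions on \<^typ>\<open>'v\<close>; those vanishing off \<open>\<Omega>\<close> are
  normalised to \<open>0\<close> outside the vertex set as well. For a bounded domain \<open>\<Omega>\<close> this space is
  finite-dimensional, so it is already complete and equals \<open>W\<^sub>0\<^bsup>1,l\<^esup>(\<Omega>)\<close> for every \<open>l\<close>.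
\<close>

definition Cc_space :: "'v set \<Rightarrow> ('v \<Rightarrow> real) set" where
  "Cc_space \<Omega> = {\<psi>. \<forall>x. x \<notin> \<Omega> \<longrightarrow> \<psi> x = 0}"

definition L_norm :: "'v wgraph \<Rightarrow> 'v set \<Rightarrow> real \<Rightarrow> ('v \<Rightarrow> real) \<Rightarrow> real" where
  "L_norm G \<Omega> \<gamma> u = gintegral G \<Omega> (\<lambda>x. \<bar>u x\<bar> powr \<gamma>) powr (1 / \<gamma>)"

definition max_norm :: "'v set \<Rightarrow> ('v \<Rightarrow> real) \<Rightarrow> real" where
  "max_norm \<Omega> u = Max ((\<lambda>x. \<bar>u x\<bar>) ` \<Omega>)"

definition W_norm :: "'v wgraph \<Rightarrow> 'v set \<Rightarrow> real \<Rightarrow> ('v \<Rightarrow> real) \<Rightarrow> real" where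
  "W_norm G \<Omega> l u =
     gintegral G (\<Omega> \<union> gboundary G \<Omega>) (\<lambda>x. grad_abs G u x powr l) powr (1 / l)"

definition embedding_constant :: "'v wgraph \<Rightarrow> 'v set \<Rightarrow> real \<Rightarrow> real \<Rightarrow> bool" where
  "embedding_constant G \<Omega> l C \<longleftrightarrow> C > 0 \<and>
     (\<forall>u\<in>Cc_space \<Omega>. (\<forall>\<gamma>\<ge>1. L_norm G \<Omega> \<gamma> u \<le> C * W_norm G \<Omega> l u) \<and>
                       max_norm \<Omega> u \<le> C * W_norm G \<Omega> l u)"

text \<open>
  The case distinction gives \<open>s\<^sup>0 = 1\<close> also at \<open>s = 0\<close>, where \<open>powr\<close> would yield \<open>0\<close>.
\<close>

definition kirchhoff :: "real \<Rightarrow> real \<Rightarrow> real \<Rightarrow> real \<Rightarrow> real" where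
  "kirchhoff a b k s = a + b * (if k = 0 then 1 else s powr k)"

definition is_solution ::
  "'v wgraph \<Rightarrow> 'v set \<Rightarrow> real \<Rightarrow> real \<Rightarrow> real \<Rightarrow> real \<Rightarrow> real \<Rightarrow> real \<Rightarrow>
   real \<Rightarrow> real \<Rightarrow> real \<Rightarrow> real \<Rightarrow> real \<Rightarrow> real \<Rightarrow>
   ('v \<Rightarrow> real) \<Rightarrow> ('v \<Rightarrow> real) \<Rightarrow> ('v \<Rightarrow> real) \<Rightarrow> ('v \<Rightarrow> real) \<Rightarrow> ('v \<Rightarrow> real) \<Rightarrow>
   ('v \<Rightarrow> real) \<Rightarrow> ('v \<Rightarrow> real) \<Rightarrow> bool" where
  "is_solution G \<Omega> p q r \<alpha> \<beta> k a\<^sub>1 b\<^sub>1 a\<^sub>2 b\<^sub>2 \<Lambda>\<^sub>1 \<Lambda>\<^sub>2 h\<^sub>1 h\<^sub>2 h\<^sub>3 g\<^sub>1 g\<^sub>2 u v \<longleftrightarrow>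
     u \<in> Cc_space \<Omega> \<and> v \<in> Cc_space \<Omega> \<and>
     (\<forall>x\<in>\<Omega>.
        - kirchhoff a\<^sub>1 b\<^sub>1 k (W_norm G \<Omega> p u powr p) * graph_laplacian G p u x =
          \<Lambda>\<^sub>1 * h\<^sub>1 x * (\<bar>u x\<bar> powr (r - 2) * u x)
          + \<alpha> / (\<alpha> + \<beta>) * h\<^sub>2 x * (\<bar>u x\<bar> powr (\<alpha> - 2) * u x) * \<bar>v x\<bar> powr \<beta> + g\<^sub>1 x) \<and>
     (\<forall>x\<in>\<Omega>.
        - kirchhoff a\<^sub>2 b\<^sub>2 k (W_norm G \<Omega> q v powr q) * graph_laplacian G q v x =
          \<Lambda>\<^sub>2 * h\<^sub>3 x * (\<bar>v x\<bar> powr (r - 2) * v x)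
          + \<beta> / (\<alpha> + \<beta>) * h\<^sub>2 x * \<bar>u x\<bar> powr \<alpha> * (\<bar>v x\<bar> powr (\<beta> - 2) * v x) + g\<^sub>2 x) \<and>
     (\<forall>x\<in>gboundary G \<Omega>. u x = 0 \<and> v x = 0)"

definition energy ::
  "'v wgraph \<Rightarrow> 'v set \<Rightarrow> real \<Rightarrow> real \<Rightarrow> real \<Rightarrow> real \<Rightarrow> real \<Rightarrow> real \<Rightarrow>
   real \<Rightarrow> real \<Rightarrow> real \<Rightarrow> real \<Rightarrow> real \<Rightarrow> real \<Rightarrow>
   ('v \<Rightarrow> real) \<Rightarrow> ('v \<Rightarrow> real) \<Rightarrow> ('v \<Rightarrow> real) \<Rightarrow> ('v \<Rightarrow> real) \<Rightarrow> ('v \<Rightarrow> real) \<Rightarrow>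
   ('v \<Rightarrow> real) \<Rightarrow> ('v \<Rightarrow> real) \<Rightarrow> real" where
  "energy G \<Omega> p q r \<alpha> \<beta> k a\<^sub>1 b\<^sub>1 a\<^sub>2 b\<^sub>2 \<Lambda>\<^sub>1 \<Lambda>\<^sub>2 h\<^sub>1 h\<^sub>2 h\<^sub>3 g\<^sub>1 g\<^sub>2 u v =
     a\<^sub>1 / p * W_norm G \<Omega> p u powr p
     + b\<^sub>1 / (p * (k + 1)) * W_norm G \<Omega> p u powr (p * (k + 1))
     + a\<^sub>2 / q * W_norm G \<Omega> q v powr q
     + b\<^sub>2 / (q * (k + 1)) * W_norm G \<Omega> q v powr (q * (k + 1))
     - \<Lambda>\<^sub>1 / r * gintegral G \<Omega> (\<lambda>x. h\<^sub>1 x * \<bar>u x\<bar> powr r)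
     - \<Lambda>\<^sub>2 / r * gintegral G \<Omega> (\<lambda>x. h\<^sub>3 x * \<bar>v x\<bar> powr r)
     - 1 / (\<alpha> + \<beta>) * gintegral G \<Omega> (\<lambda>x. h\<^sub>2 x * \<bar>u x\<bar> powr \<alpha> * \<bar>v x\<bar> powr \<beta>)
     - gintegral G \<Omega> (\<lambda>x. g\<^sub>1 x * u x)
     - gintegral G \<Omega> (\<lambda>x. g\<^sub>2 x * v x)"

end

theory Submission
  imports Defs "HOL-Real_Asymp.Real_Asymp"
begin

text \<open>
  The energy \<open>\<phi>\<close> is studied on the curves \<open>t \<mapsto> (t powr (1 / p) * u, t powr (1 / q) * v)\<close>, on which
  it is a combination of powers of \<open>t\<close>: the Dirichlet terms have exponents \<open>1\<close> and \<open>k + 1\<close>, the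
  coupling has the larger exponent \<open>\<alpha> / p + \<beta> / q\<close>, and all other exponents are below \<open>1\<close>. The
  smallness condition says that \<open>\<phi>\<close>, even with the worst signs of its linear terms, is at least some
  \<open>\<delta> > 0\<close> on the sphere \<open>\<parallel>u\<parallel> + \<parallel>v\<parallel> = s0\<close>. Hence each curve on which
  the coupling does not vanish has a unique last critical point, a strict maximum with value at
  least \<open>\<delta>\<close>. Minimising
  \<open>\<phi>\<close> over these points gives the solution of positive energy; minimising \<open>\<phi>\<close> over the ball
  \<open>\<parallel>u\<parallel> + \<parallel>v\<parallel> \<le> s0\<close> gives the one of negative energy.

  If \<open>\<alpha> \<le> 1\<close> or \<open>\<beta> \<le> 1\<close>, then \<open>\<phi>\<close> has kinks and the mountain pass theorem does not apply. The kinks are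
  concave, however, so a minimum or a minimum of maxima over curves never sits on one of them.
\<close>

section \<open>Energy along a curve\<close>

text \<open>The linear terms have no sign, so along a curve the true energy need not change
  convexity only once. However, it differs from its worst case by a nondecreasing concave function
  of \<open>t\<close>. Hence the true energy is concave wherever the worst case is, and its slope is
  at least that of the worst case. Concavity is therefore always tested on the worst case, whose
  normalised second derivative is strictly decreasing.

  The other obstacle is compactness. Minimising over curve maxima needs a closed set, so the
  curvature condition has to be a weak inequality, yet following a maximum to nearby curves needs a
  strict one. Positivity of the worst case somewhere on the curve reconciles the two: it forces a
  positive slope at the inflection point, so a critical point never sits there. The bound \<delta>
  on the energy keeps limits away from the zero pair. Nearby maxima are then found by sign changes
  of the slope at two fixed times, without an implicit function theorem or Lagrange multipliers,
  neither of which would survive the kinks.\<close>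

locale fiber =
  fixes m d e1 e2 e3 e4 A B H n1 n2 n3 n4 g3 g4 :: real
  assumes m: "1 \<le> m" and d: "m < d"
    and e: "0 < e1" "e1 < 1" "0 < e2" "e2 < 1" "0 < e3" "e3 < 1" "0 < e4" "e4 < 1"
    and nonneg: "0 \<le> A" "0 \<le> B" "0 \<le> H" "0 \<le> n1" "0 \<le> n2" "0 \<le> n3" "0 \<le> n4"
    and n_pos: "0 < n1 + n2"
    and g: "\<bar>g3\<bar> \<le> n3" "\<bar>g4\<bar> \<le> n4"
begin

text \<open>\<open>up\<close> is the energy along a curve; \<open>low\<close> has the terms of unknown sign replaced by the worst case.\<close>

definition low :: "real \<Rightarrow> real" where
  "low t = A * t + B * t powr m - n1 * t powr e1 - n2 * t powr e2 - n3 * t powr e3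
     - n4 * t powr e4 - H * t powr d"

definition up :: "real \<Rightarrow> real" where
  "up t = A * t + B * t powr m - n1 * t powr e1 - n2 * t powr e2 - g3 * t powr e3
     - g4 * t powr e4 - H * t powr d"

definition low' :: "real \<Rightarrow> real" where
  "low' t = A + B * (m * t powr (m - 1)) - n1 * (e1 * t powr (e1 - 1)) - n2 * (e2 * t powr (e2 - 1))
     - n3 * (e3 * t powr (e3 - 1)) - n4 * (e4 * t powr (e4 - 1)) - H * (d * t powr (d - 1))"

definition up' :: "real \<Rightarrow> real" where
  "up' t = A + B * (m * t powr (m - 1)) - n1 * (e1 * t powr (e1 - 1)) - n2 * (e2 * t powr (e2 - 1))
     - g3 * (e3 * t powr (e3 - 1)) - g4 * (e4 * t powr (e4 - 1)) - H * (d * t powr (d - 1))"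

text \<open>Up to the factor \<open>t powr (d - 2)\<close> this is the second derivative of \<open>low\<close>. The normalisation
  makes it strictly decreasing, so \<open>low\<close> is first convex, then concave.\<close>

definition curv :: "real \<Rightarrow> real" where
  "curv t = m * (m - 1) * B * t powr (m - d) + e1 * (1 - e1) * n1 * t powr (e1 - d)
     + e2 * (1 - e2) * n2 * t powr (e2 - d) + e3 * (1 - e3) * n3 * t powr (e3 - d)
     + e4 * (1 - e4) * n4 * t powr (e4 - d) - d * (d - 1) * H"

lemma low_deriv: "t > 0 \<Longrightarrow> (low has_real_derivative low' t) (at t)"
proof -
  assume t: "t > 0"
  have "(low has_real_derivative
     (A * 1 + B * (m * t powr (m - 1)) - n1 * (e1 * t powr (e1 - 1)) - n2 * (e2 * t powr (e2 - 1))
     - n3 * (e3 * t powr (e3 - 1)) - n4 * (e4 * t powr (e4 - 1)) - H * (d * t powr (d - 1)))) (at t)"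
    unfolding low_def
    by (intro DERIV_add DERIV_diff DERIV_cmult DERIV_ident has_real_derivative_powr t)
  then show ?thesis by (simp add: low'_def)
qed

lemma up_deriv: "t > 0 \<Longrightarrow> (up has_real_derivative up' t) (at t)"
proof -
  assume t: "t > 0"
  have "(up has_real_derivative
     (A * 1 + B * (m * t powr (m - 1)) - n1 * (e1 * t powr (e1 - 1)) - n2 * (e2 * t powr (e2 - 1))
     - g3 * (e3 * t powr (e3 - 1)) - g4 * (e4 * t powr (e4 - 1)) - H * (d * t powr (d - 1)))) (at t)"
    unfolding up_def
    by (intro DERIV_add DERIV_diff DERIV_cmult DERIV_ident has_real_derivative_powr t)
  then show ?thesis by (simp add: up'_def)
qed

lemma powr_shift: "t powr (d - 2) * t powr (x - d) = t powr (x - 1 - 1)" for t x :: real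
  by (simp add: powr_add [symmetric])

lemma low'_deriv:
  assumes t: "t > 0"
  shows "(low' has_real_derivative t powr (d - 2) * curv t) (at t)"
proof -
  have "(low' has_real_derivative
     (0 + B * (m * ((m - 1) * t powr (m - 1 - 1))) - n1 * (e1 * ((e1 - 1) * t powr (e1 - 1 - 1)))
     - n2 * (e2 * ((e2 - 1) * t powr (e2 - 1 - 1))) - n3 * (e3 * ((e3 - 1) * t powr (e3 - 1 - 1)))
     - n4 * (e4 * ((e4 - 1) * t powr (e4 - 1 - 1))) - H * (d * ((d - 1) * t powr (d - 1 - 1))))) (at t)"
    unfolding low'_def
    by (intro DERIV_add DERIV_diff DERIV_cmult DERIV_const has_real_derivative_powr t)
  also have "0 + B * (m * ((m - 1) * t powr (m - 1 - 1))) - n1 * (e1 * ((e1 - 1) * t powr (e1 - 1 - 1)))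
     - n2 * (e2 * ((e2 - 1) * t powr (e2 - 1 - 1))) - n3 * (e3 * ((e3 - 1) * t powr (e3 - 1 - 1)))
     - n4 * (e4 * ((e4 - 1) * t powr (e4 - 1 - 1))) - H * (d * ((d - 1) * t powr (d - 1 - 1)))
     = t powr (d - 2) * curv t"
    unfolding curv_def powr_shift [symmetric]
    using t by (simp add: algebra_simps)
  finally show ?thesis .
qed

lemma up'_deriv:
  assumes t: "t > 0"
  shows "(up' has_real_derivative (t powr (d - 2) * curv t - e3 * (1 - e3) * (n3 - g3) * t powr (e3 - 1 - 1)
     - e4 * (1 - e4) * (n4 - g4) * t powr (e4 - 1 - 1))) (at t)"
proof -
  have up': "up' = (\<lambda>t. low' t + (n3 - g3) * (e3 * t powr (e3 - 1)) + (n4 - g4) * (e4 * t powr (e4 - 1)))"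
    by (auto simp: up'_def low'_def algebra_simps)
  have "(up' has_real_derivative (t powr (d - 2) * curv t + (n3 - g3) * (e3 * ((e3 - 1) * t powr (e3 - 1 - 1)))
     + (n4 - g4) * (e4 * ((e4 - 1) * t powr (e4 - 1 - 1))))) (at t)"
    unfolding up' by (intro DERIV_add DERIV_cmult low'_deriv has_real_derivative_powr t)
  then show ?thesis by (simp add: algebra_simps)
qed

text \<open>The difference \<open>up - low\<close> is a nonnegative combination of concave powers,
  so \<open>curv\<close>, although built from \<open>low\<close>, also bounds the second derivative
  of \<open>up\<close> from above.\<close>

lemma up'_deriv_le:
  assumes t: "t > 0"
  shows "\<exists>y. (up' has_real_derivative y) (at t) \<and> y \<le> t powr (d - 2) * curv t"
proof -
  have "0 \<le> e3 * (1 - e3) * (n3 - g3) * t powr (e3 - 1 - 1)"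
    and "0 \<le> e4 * (1 - e4) * (n4 - g4) * t powr (e4 - 1 - 1)"
    using e g t by (auto intro!: mult_nonneg_nonneg)
  then show ?thesis using up'_deriv [OF t] by (intro exI conjI) (assumption, linarith)
qed

lemma low_le_up: "low t \<le> up t"
proof -
  have "g3 * t powr e3 \<le> n3 * t powr e3" "g4 * t powr e4 \<le> n4 * t powr e4"
    using g by (auto intro!: mult_right_mono)
  then show ?thesis unfolding low_def up_def by linarith
qed

lemma low'_le_up': "low' t \<le> up' t"
proof -
  have "g3 * (e3 * t powr (e3 - 1)) \<le> n3 * (e3 * t powr (e3 - 1))"
    "g4 * (e4 * t powr (e4 - 1)) \<le> n4 * (e4 * t powr (e4 - 1))"
    using g e by (auto intro!: mult_right_mono)
  then show ?thesis unfolding low'_def up'_def by linarith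
qed

text \<open>All exponents lie below \<open>d\<close>, so no term increases. Strictness has to come
  from \<open>n1\<close> or \<open>n2\<close>: the \<open>B\<close> term drops out when
  \<open>m = 1\<close>, and \<open>n3\<close>, \<open>n4\<close> may vanish.\<close>

lemma curv_strict_decreasing:
  assumes "0 < s" "s < t"
  shows "curv t < curv s"
proof -
  have pw: "t powr (x - d) < s powr (x - d)" if "x < d" for x
    using powr_less_mono2_neg [of "x - d" s t] assms that by simp
  have ex: "e1 < d" "e2 < d" "e3 < d" "e4 < d" using e m d by auto
  have "m * (m - 1) * B * t powr (m - d) \<le> m * (m - 1) * B * s powr (m - d)"
    using pw [of m] m d nonneg by (intro mult_left_mono) auto
  moreover have "e3 * (1 - e3) * n3 * t powr (e3 - d) \<le> e3 * (1 - e3) * n3 * s powr (e3 - d)"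
    using pw [of e3] ex e nonneg by (intro mult_left_mono) auto
  moreover have "e4 * (1 - e4) * n4 * t powr (e4 - d) \<le> e4 * (1 - e4) * n4 * s powr (e4 - d)"
    using pw [of e4] ex e nonneg by (intro mult_left_mono) auto
  moreover have "e1 * (1 - e1) * n1 * t powr (e1 - d) + e2 * (1 - e2) * n2 * t powr (e2 - d)
      < e1 * (1 - e1) * n1 * s powr (e1 - d) + e2 * (1 - e2) * n2 * s powr (e2 - d)"
  proof (cases "n1 = 0")
    case True
    then have "n2 > 0" using n_pos by simp
    then show ?thesis using True pw [of e2] ex e by simp
  next
    case False
    then have "e1 * (1 - e1) * n1 * t powr (e1 - d) < e1 * (1 - e1) * n1 * s powr (e1 - d)"
      using pw [of e1] ex e nonneg by (intro mult_strict_left_mono) auto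
    moreover have "e2 * (1 - e2) * n2 * t powr (e2 - d) \<le> e2 * (1 - e2) * n2 * s powr (e2 - d)"
      using pw [of e2] ex e nonneg by (intro mult_left_mono) auto
    ultimately show ?thesis by simp
  qed
  ultimately show ?thesis unfolding curv_def by linarith
qed

lemma low_tendsto_0: "(low \<longlongrightarrow> 0) (at_right 0)"
proof -
  have *: "((\<lambda>t. t powr x) \<longlongrightarrow> 0) (at_right 0)" if "x > 0" for x :: real
    using that by real_asymp
  have "(low \<longlongrightarrow> A * 0 + B * 0 - n1 * 0 - n2 * 0 - n3 * 0 - n4 * 0 - H * 0) (at_right 0)"
    unfolding low_def using e m d by (intro tendsto_intros *) auto
  then show ?thesis by simp
qed

text \<open>The function decreases from its limit 0. A limit is used instead of the value at 0
  because the sublinear powers are not differentiable there.\<close>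

lemma low_nonpos_if_low'_nonpos:
  assumes t: "t > 0" and "\<And>s. 0 < s \<Longrightarrow> s \<le> t \<Longrightarrow> low' s \<le> 0"
  shows "low t \<le> 0"
proof (rule tendsto_lowerbound [OF low_tendsto_0])
  show "eventually (\<lambda>s. low t \<le> low s) (at_right 0)"
    unfolding eventually_at_right_field
  proof (intro exI conjI allI impI)
    fix s assume s: "0 < s" "s < t"
    show "low t \<le> low s"
    proof (rule DERIV_nonpos_imp_nonincreasing [of s t low])
      fix x assume x: "s \<le> x" "x \<le> t"
      then show "\<exists>y. (low has_real_derivative y) (at x) \<and> y \<le> 0"
        using assms(2) [of x] low_deriv [of x] s by (intro exI [of _ "low' x"]) auto
    qed (use s in auto)
  qed (use t in auto)
qed auto

text \<open>The slope \<open>low'\<close> rises up to the inflection point and falls afterwards, so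
  its value there is its maximum. Were it nonpositive, \<open>low\<close> could never exceed its
  limit 0.\<close>

lemma low'_pos_at_inflection:
  assumes t: "t > 0" and curv: "curv t = 0" and t0: "t0 > 0" "low t0 > 0"
  shows "low' t > 0"
proof (rule ccontr)
  assume "\<not> low' t > 0"
  then have neg: "low' t \<le> 0" by simp
  have "low' s \<le> 0" if s: "s > 0" for s
  proof (cases "s \<le> t")
    case True
    have "low' s \<le> low' t"
    proof (rule DERIV_nonneg_imp_nondecreasing [OF True])
      fix x assume x: "s \<le> x" "x \<le> t"
      then have "curv x \<ge> 0" using curv_strict_decreasing [of x t] curv s by (cases "x = t") auto
      then show "\<exists>y. (low' has_real_derivative y) (at x) \<and> 0 \<le> y"
        using low'_deriv [of x] s x by (intro exI [of _ "x powr (d - 2) * curv x"]) auto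
    qed
    then show ?thesis using neg by simp
  next
    case False
    have "low' s \<le> low' t"
    proof (rule DERIV_nonpos_imp_nonincreasing [of t s low'])
      show "t \<le> s" using False by simp
      fix x assume x: "t \<le> x" "x \<le> s"
      then have "curv x \<le> 0" using curv_strict_decreasing [of t x] curv t by (cases "x = t") auto
      then show "\<exists>y. (low' has_real_derivative y) (at x) \<and> y \<le> 0"
        using low'_deriv [of x] t x
          by (intro exI [of _ "x powr (d - 2) * curv x"]) (auto simp: mult_nonneg_nonpos)
    qed
    then show ?thesis using neg by simp
  qed
  then have "low t0 \<le> 0" using low_nonpos_if_low'_nonpos t0 by blast
  then show False using t0 by simp
qed

lemma continuous_curv: "continuous_on {0<..} curv"
  unfolding curv_def by (intro continuous_intros) auto

lemma continuous_up': "continuous_on {0<..} up'"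
  unfolding up'_def by (intro continuous_intros) auto

section \<open>A critical point in the concave range, normalised to time 1\<close>

context
  fixes t0
  assumes t0: "t0 > 0" "low t0 > 0" and crit: "up' 1 = 0" and curv1: "curv 1 \<le> 0"
begin

text \<open>Nondegeneracy: at an inflection point \<open>up'\<close> is at least
  \<open>low'\<close>, which is positive, so the critical time 1 cannot be one.\<close>

lemma curv_neg: "curv 1 < 0"
  using low'_pos_at_inflection [of 1, OF _ _ t0] low'_le_up' [of 1] crit curv1 by force

text \<open>Where \<open>curv\<close> is nonpositive it stays so at all later times, and
  \<open>up'\<close> strictly decreases through its zero at 1. Thus 1 maximises \<open>up\<close>
  over the whole concave range.\<close>

lemma up'_sign:
  assumes s: "0 < s" "curv s \<le> 0"
  shows "s < 1 \<Longrightarrow> up' s > 0" and "s > 1 \<Longrightarrow> up' s < 0" and "up s \<le> up 1"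
proof -
  have neg: "\<exists>y. (up' has_real_derivative y) (at x) \<and> y < 0" if "0 < x" "curv x < 0" for x
  proof -
    have "x powr (d - 2) * curv x < 0" using that by (intro mult_pos_neg) auto
    then show ?thesis using up'_deriv_le [OF that(1)] by force
  qed
  have pos': "up' x > 0" if "0 < x" "x < 1" "curv x \<le> 0" for x
  proof -
    have "up' x > up' 1"
    proof (rule DERIV_neg_imp_decreasing_open [OF that(2)])
      fix y assume "x < y" "y < 1"
      then show "\<exists>z. (up' has_real_derivative z) (at y) \<and> z < 0"
        using neg [of y] curv_strict_decreasing [of x y] that by auto
    qed (use that in \<open>auto intro: continuous_on_subset [OF continuous_up']\<close>)
    then show ?thesis using crit by simp
  qed
  have neg': "up' x < 0" if "1 < x" for x
  proof -
    have "up' 1 > up' x"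
    proof (rule DERIV_neg_imp_decreasing_open [OF that])
      fix y assume "1 < y" "y < x"
      then show "\<exists>z. (up' has_real_derivative z) (at y) \<and> z < 0"
        using neg [of y] curv_strict_decreasing [of 1 y] curv_neg by auto
    qed (use that in \<open>auto intro: continuous_on_subset [OF continuous_up']\<close>)
    then show ?thesis using crit by simp
  qed
  show "s < 1 \<Longrightarrow> up' s > 0" using pos' s by blast
  show "s > 1 \<Longrightarrow> up' s < 0" using neg' s by blast
  show "up s \<le> up 1"
  proof (cases "s \<le> 1")
    case True
    show ?thesis
    proof (rule DERIV_nonneg_imp_nondecreasing [OF True])
      fix x assume x: "s \<le> x" "x \<le> 1"
      have "curv x \<le> 0" using curv_strict_decreasing [of s x] s x by (cases "x = s") auto
      then have "up' x \<ge> 0" using pos' [of x] crit s x by (cases "x = 1") auto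
      then show "\<exists>y. (up has_real_derivative y) (at x) \<and> 0 \<le> y"
        using up_deriv [of x] s x by (intro exI [of _ "up' x"]) simp
    qed
  next
    case False
    show ?thesis
    proof (rule DERIV_nonpos_imp_nonincreasing [of 1 s up])
      show "1 \<le> s" using False by simp
      fix x assume x: "1 \<le> x" "x \<le> s"
      then have "up' x \<le> 0" using neg' [of x] crit by (cases "x = 1") auto
      then show "\<exists>y. (up has_real_derivative y) (at x) \<and> y \<le> 0"
        using up_deriv [of x] x by (intro exI [of _ "up' x"]) simp
    qed
  qed
qed

text \<open>This carries the height of the ridge to the critical value. If \<open>t0\<close> lies in
  the convex range, then \<open>low'\<close> is positive there and \<open>low\<close> keeps growing
  up to the inflection point, from which the maximality of 1 takes over.\<close>

lemma low_le_up_1: "low t0 \<le> up 1"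
proof (cases "curv t0 \<le> 0")
  case True
  then show ?thesis using up'_sign(3) [of t0] low_le_up [of t0] t0 by simp
next
  case False
  then have t01: "t0 < 1" using curv_strict_decreasing [of 1 t0] curv1 by (cases "t0 = 1") force+
  have "continuous_on {t0..1} curv"
    by (rule continuous_on_subset [OF continuous_curv]) (use t0 in auto)
  then obtain s where s: "t0 \<le> s" "s \<le> 1" "curv s = 0"
    using IVT2' [of curv 1 0 t0] False curv1 t01 by auto
  have low'_mono: "low' x \<le> low' y" if "0 < x" "x \<le> y" "y \<le> s" for x y
  proof (rule DERIV_nonneg_imp_nondecreasing [OF that(2)])
    fix z assume z: "x \<le> z" "z \<le> y"
    then have "curv z \<ge> 0" using curv_strict_decreasing [of z s] that s by (cases "z = s") auto
    then show "\<exists>v. (low' has_real_derivative v) (at z) \<and> 0 \<le> v"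
      using low'_deriv [of z] z that by (intro exI [of _ "z powr (d - 2) * curv z"]) auto
  qed
  have pos: "low' t0 > 0"
  proof (rule ccontr)
    assume "\<not> low' t0 > 0"
    then have "low t0 \<le> 0"
      using low'_mono [of _ t0] s by (intro low_nonpos_if_low'_nonpos t0) force
    then show False using t0 by simp
  qed
  have "low t0 \<le> low s"
  proof (rule DERIV_nonneg_imp_nondecreasing [OF s(1)])
    fix z assume z: "t0 \<le> z" "z \<le> s"
    then show "\<exists>v. (low has_real_derivative v) (at z) \<and> 0 \<le> v"
      using low_deriv [of z] low'_mono [of t0 z] pos t0 by (intro exI [of _ "low' z"]) auto
  qed
  also have "\<dots> \<le> up s" using low_le_up s t0 by simp
  also have "\<dots> \<le> up 1" using up'_sign(3) [of s] s t0 by simp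
  finally show ?thesis .
qed

end

text \<open>At the inflection point \<open>up'\<close> is positive, while for large \<open>t\<close>
  the coupling makes it negative because \<open>H > 0\<close>. A zero in between lies past the
  inflection point, hence in the concave range.\<close>

lemma ex_critical:
  assumes H: "H > 0" and t0: "t0 > 0" "low t0 > 0"
  shows "\<exists>t>0. up' t = 0 \<and> curv t \<le> 0"
proof -
  have ex: "e1 < d" "e2 < d" "e3 < d" "e4 < d" "1 < d" using e m d by auto
  have small: "\<exists>t>0. curv t > 0"
  proof -
    define c where "c = e1 * (1 - e1) * n1 + e2 * (1 - e2) * n2"
    have c: "c > 0"
    proof (cases "n1 = 0")
      case True then show ?thesis using n_pos e by (auto simp: c_def)
    next
      case False
      then have "0 < e1 * (1 - e1) * n1" "0 \<le> e2 * (1 - e2) * n2" using nonneg e by auto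
      then show ?thesis by (auto simp: c_def)
    qed
    \<comment> \<open>For \<open>t < 1\<close> the slower of the two blow-up rates bounds both terms
      from below, so it does not matter which of \<open>n1\<close>, \<open>n2\<close> is
      positive.\<close>
    define b where "b = min (d - e1) (d - e2)"
    have b: "b > 0" using ex by (auto simp: b_def)
    have "filterlim (\<lambda>t. c * t powr (- b)) at_top (at_right 0)"
      using c b by real_asymp
    then have "eventually (\<lambda>t. c * t powr (- b) > d * (d - 1) * H) (at_right 0)"
      unfolding filterlim_at_top_dense by blast
    moreover have "eventually (\<lambda>t::real. 0 < t \<and> t < 1) (at_right 0)"
      by (auto simp: eventually_at_right_field intro: exI [of _ 1])
    ultimately have "eventually (\<lambda>t. c * t powr (- b) > d * (d - 1) * H \<and> 0 < t \<and> t < 1) (at_right 0)"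
      by (rule eventually_conj)
    then have "\<exists>t. c * t powr (- b) > d * (d - 1) * H \<and> 0 < t \<and> t < 1"
      using eventually_happens' [OF trivial_limit_at_right_real] by fast
    then obtain t where t: "c * t powr (- b) > d * (d - 1) * H" "0 < t" "t < 1"
      by blast
    have pw: "t powr (- b) \<le> t powr (e1 - d)" "t powr (- b) \<le> t powr (e2 - d)"
      using t by (auto intro!: powr_mono' simp: b_def)
    have "c * t powr (- b) \<le> e1 * (1 - e1) * n1 * t powr (e1 - d) + e2 * (1 - e2) * n2 * t powr (e2 - d)"
      unfolding c_def distrib_right using pw e nonneg by (intro add_mono mult_left_mono) auto
    moreover have "0 \<le> m * (m - 1) * B * t powr (m - d)" "0 \<le> e3 * (1 - e3) * n3 * t powr (e3 - d)"
      "0 \<le> e4 * (1 - e4) * n4 * t powr (e4 - d)"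
      using e m nonneg by auto
    ultimately have "curv t > 0" using t unfolding curv_def by linarith
    then show ?thesis using t by blast
  qed
  have lim: "((\<lambda>t. t powr (x - d)) \<longlongrightarrow> 0) at_top" if "x < d" for x :: real
    using that by real_asymp
  have "(curv \<longlongrightarrow> m * (m - 1) * B * 0 + e1 * (1 - e1) * n1 * 0
     + e2 * (1 - e2) * n2 * 0 + e3 * (1 - e3) * n3 * 0
     + e4 * (1 - e4) * n4 * 0 - d * (d - 1) * H) at_top"
    unfolding curv_def using ex d by (intro tendsto_intros lim) auto
  then have ev_curv: "eventually (\<lambda>t. curv t < 0) at_top"
    using H ex by (intro order_tendstoD) auto
  \<comment> \<open>With the dominant power factored out, only the constant \<open>- H * d\<close>
    survives at infinity.\<close>
  have up'_eq: "up' t = t powr (d - 1) * (A * t powr (1 - d) + B * m * t powr (m - d)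
     - n1 * e1 * t powr (e1 - d) - n2 * e2 * t powr (e2 - d)
     - g3 * e3 * t powr (e3 - d) - g4 * e4 * t powr (e4 - d) - H * d)" if "t > 0" for t
  proof -
    have sh: "t powr (d - 1) * t powr (x - d) = t powr (x - 1)" for x
      by (simp add: powr_add [symmetric])
    have "t powr (d - 1) * t powr (1 - d) = 1" using sh [of 1] that by simp
    then show ?thesis
      unfolding up'_def sh [of m, symmetric] sh [of e1, symmetric] sh [of e2, symmetric]
        sh [of e3, symmetric] sh [of e4, symmetric]
      by (simp add: algebra_simps)
  qed
  have "((\<lambda>t. A * t powr (1 - d) + B * m * t powr (m - d)
     - n1 * e1 * t powr (e1 - d) - n2 * e2 * t powr (e2 - d)
     - g3 * e3 * t powr (e3 - d) - g4 * e4 * t powr (e4 - d) - H * d) \<longlongrightarrow>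
      A * 0 + B * m * 0 - n1 * e1 * 0 - n2 * e2 * 0 - g3 * e3 * 0 - g4 * e4 * 0 - H * d) at_top"
    using ex d by (intro tendsto_intros lim) auto
  then have "eventually (\<lambda>t. A * t powr (1 - d) + B * m * t powr (m - d)
     - n1 * e1 * t powr (e1 - d) - n2 * e2 * t powr (e2 - d)
     - g3 * e3 * t powr (e3 - d) - g4 * e4 * t powr (e4 - d) - H * d < 0) at_top"
    using H ex by (intro order_tendstoD) auto
  then have ev_up': "eventually (\<lambda>t. up' t < 0) at_top"
    using eventually_gt_at_top [of 0]
    by eventually_elim (simp only: up'_eq, simp add: mult_pos_neg)
  obtain ta where ta: "ta > 0" "curv ta > 0" using small by blast
  obtain tb where tb: "tb > ta" "curv tb < 0"
    using eventually_happens [OF eventually_conj [OF ev_curv eventually_gt_at_top [of ta]]] by auto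
  have "continuous_on {ta..tb} curv"
    by (rule continuous_on_subset [OF continuous_curv]) (use ta in auto)
  then obtain s where s: "ta \<le> s" "s \<le> tb" "curv s = 0"
    using IVT2' [of curv tb 0 ta] ta tb by auto
  have s0: "s > 0" using s ta by simp
  have "up' s > 0" using low'_pos_at_inflection [OF s0 s(3) t0] low'_le_up' [of s] by simp
  moreover obtain tc where tc: "tc > s" "up' tc < 0"
    using eventually_happens [OF eventually_conj [OF ev_up' eventually_gt_at_top [of s]]] by auto
  moreover have "continuous_on {s..tc} up'"
    by (rule continuous_on_subset [OF continuous_up']) (use s0 in auto)
  ultimately obtain t where t: "s \<le> t" "t \<le> tc" "up' t = 0"
    using IVT2' [of up' tc 0 s] by auto
  then have "curv t \<le> 0" using curv_strict_decreasing [of s t] s s0 by (cases "t = s") auto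
  then show ?thesis using t s0 by (intro exI [of _ t]) auto
qed

end

section \<open>Derivatives and compactness on finite domains\<close>

text \<open>The derivative has the shape of the nonlinearities in the system. At
  \<open>s = 0\<close> the factor \<open>s\<close> makes it 0 whatever the power is, in agreement
  with the convention there.\<close>

lemma has_real_derivative_abs_powr:
  fixes c s :: real
  assumes c: "c > 1 \<or> s \<noteq> 0"
  shows "((\<lambda>s. \<bar>s\<bar> powr c) has_real_derivative c * (\<bar>s\<bar> powr (c - 2) * s)) (at s)"
proof -
  consider "s > 0" | "s < 0" | "s = 0" by linarith
  then show ?thesis
  proof cases
    case 1
    have "((\<lambda>s. s powr c) has_real_derivative c * s powr (c - 1)) (at s)"
      using 1 by (rule has_real_derivative_powr)
    then have "((\<lambda>s. \<bar>s\<bar> powr c) has_real_derivative c * s powr (c - 1)) (at s)"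
      by (rule has_field_derivative_transform_within_open [where S = "{0<..}"]) (use 1 in auto)
    then show ?thesis
      using powr_mult_base [of s "c - 2"] 1 by (simp add: mult.commute)
  next
    case 2
    have "((\<lambda>s. (- s) powr c) has_real_derivative c * (- s) powr (c - 1) * - 1) (at s)"
      by (rule DERIV_chain2 [of "\<lambda>y. y powr c"])
        (use 2 in \<open>auto intro!: has_real_derivative_powr derivative_eq_intros\<close>)
    then have "((\<lambda>s. \<bar>s\<bar> powr c) has_real_derivative c * (- s) powr (c - 1) * - 1) (at s)"
      by (rule has_field_derivative_transform_within_open [where S = "{..<0}"]) (use 2 in auto)
    moreover have "c * (- s) powr (c - 1) * - 1 = c * (\<bar>s\<bar> powr (c - 2) * s)"
    proof -
      have "(- s) powr (c - 1) = - s * (- s) powr (c - 2)"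
        using powr_mult_base [of "- s" "c - 2"] 2 by simp
      then show ?thesis using 2 by (simp del: minus_mult_left)
    qed
    ultimately show ?thesis by simp
  next
    case 3
    have *: "\<bar>h\<bar> powr c / h = sgn h * \<bar>h\<bar> powr (c - 1)" for h :: real
      using powr_mult_base [of "\<bar>h\<bar>" "c - 1"]
      by (cases "h = 0") (auto simp: sgn_if field_simps)
    have "((\<lambda>h. \<bar>h\<bar> powr (c - 1)) \<longlongrightarrow> \<bar>0\<bar> powr (c - 1)) (at (0::real))"
      using c 3 by (intro tendsto_intros) auto
    then have "((\<lambda>h. \<bar>h\<bar> powr (c - 1)) \<longlongrightarrow> 0) (at (0::real))" using c 3 by simp
    moreover have "\<forall>\<^sub>F h in at (0::real). norm (\<bar>h\<bar> powr c / h) \<le> \<bar>h\<bar> powr (c - 1)"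
      unfolding * by (auto simp: abs_mult sgn_if)
    ultimately have "((\<lambda>h. \<bar>h\<bar> powr c / h) \<longlongrightarrow> 0) (at (0::real))"
      by (rule Lim_null_comparison [rotated])
    then show ?thesis using 3 by (simp add: DERIV_def)
  qed
qed

text \<open>The multiplier \<open>t\<close> may depend on \<open>\<epsilon>\<close>, and only its closeness to \<open>1\<close> is known; a concave
  kink \<open>- b t * \<bar>\<epsilon>\<bar>\<close> of the perturbed functional is incompatible with the sign condition.\<close>

lemma perturbation_slope:
  fixes F :: "'i \<Rightarrow> real \<Rightarrow> real" and c :: "'i \<Rightarrow> real \<Rightarrow> real" and b :: "real \<Rightarrow> real"
  assumes F: "\<And>i. i \<in> I \<Longrightarrow> (F i has_real_derivative D i) (at 0)"
    and c: "\<And>i. i \<in> I \<Longrightarrow> isCont (c i) 1" and b: "isCont b 1"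
    and ev: "\<And>\<theta>. \<theta> > 0 \<Longrightarrow>
      \<forall>\<^sub>F \<epsilon> in at 0. \<exists>t. \<bar>t - 1\<bar> < \<theta> \<and> b t * \<bar>\<epsilon>\<bar> \<le> (\<Sum>i\<in>I. c i t * (F i \<epsilon> - F i 0))"
  shows "b 1 \<le> (\<Sum>i\<in>I. c i 1 * D i)" and "(\<Sum>i\<in>I. c i 1 * D i) \<le> - b 1"
proof -
  let ?S = "\<Sum>i\<in>I. c i 1 * D i"
  define Q where "Q = (\<lambda>t \<epsilon>. \<Sum>i\<in>I. c i t * ((F i \<epsilon> - F i 0) / \<epsilon>))"
  have Q_eq: "Q t \<epsilon> * \<epsilon> = (\<Sum>i\<in>I. c i t * (F i \<epsilon> - F i 0))" if "\<epsilon> \<noteq> 0" for t \<epsilon>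
    unfolding Q_def sum_distrib_right using that by (intro sum.cong) auto
  \<comment> \<open>The product filter is needed because \<open>t\<close> is chosen after
    \<open>\<epsilon>\<close> and need not depend on it continuously.\<close>
  have lim: "((\<lambda>z. Q (fst z) (snd z)) \<longlongrightarrow> ?S) (nhds 1 \<times>\<^sub>F at 0)"
    unfolding Q_def
  proof (intro tendsto_sum tendsto_mult)
    fix i assume i: "i \<in> I"
    have "((c i) \<longlongrightarrow> c i 1) (nhds 1)"
      using c [OF i] by (simp add: isCont_def tendsto_at_iff_tendsto_nhds)
    then show "((\<lambda>z. c i (fst z)) \<longlongrightarrow> c i 1) (nhds 1 \<times>\<^sub>F at 0)"
      by (rule filterlim_compose [OF _ filterlim_fst])
    have "((\<lambda>\<epsilon>. (F i \<epsilon> - F i 0) / \<epsilon>) \<longlongrightarrow> D i) (at 0)"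
      using F [OF i] by (simp add: DERIV_def)
    then show "((\<lambda>z. (F i (snd z) - F i 0) / snd z) \<longlongrightarrow> D i) (nhds 1 \<times>\<^sub>F at 0)"
      by (rule filterlim_compose [OF _ filterlim_snd])
  qed
  have "(b \<longlongrightarrow> b 1) (nhds 1)"
    using b by (simp add: isCont_def tendsto_at_iff_tendsto_nhds)
  then have blim: "((\<lambda>z. b (fst z)) \<longlongrightarrow> b 1) (nhds 1 \<times>\<^sub>F at (0::real))"
    by (rule filterlim_compose [OF _ filterlim_fst])
  \<comment> \<open>The set \<open>R\<close> will be one side of 0: dividing by positive
    \<open>\<epsilon>\<close> yields the first inequality, by negative \<open>\<epsilon>\<close> the
    second.\<close>
  have main: False
    if evP: "\<forall>\<^sub>F z in nhds 1 \<times>\<^sub>F at 0. P (fst z) (snd z)"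
      and contra: "\<And>t \<epsilon>. P t \<epsilon> \<Longrightarrow> \<epsilon> \<in> R \<Longrightarrow> b t * \<bar>\<epsilon>\<bar> > Q t \<epsilon> * \<epsilon>"
      and R: "at 0 within R \<noteq> bot" "0 \<notin> R" for P and R :: "real set"
  proof -
    from evP obtain Pf Pg where Pf: "\<forall>\<^sub>F t in nhds 1. Pf t" and Pg: "\<forall>\<^sub>F \<epsilon> in at 0. Pg \<epsilon>"
      and P: "\<And>t \<epsilon>. Pf t \<Longrightarrow> Pg \<epsilon> \<Longrightarrow> P t \<epsilon>"
      unfolding eventually_prod_filter by auto
    obtain \<theta> where \<theta>: "\<theta> > 0" "\<And>t. \<bar>t - 1\<bar> < \<theta> \<Longrightarrow> Pf t"
      using Pf unfolding eventually_nhds_metric dist_real_def by blast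
    have "\<forall>\<^sub>F \<epsilon> in at 0. Pg \<epsilon> \<and> (\<exists>t. \<bar>t - 1\<bar> < \<theta> \<and> b t * \<bar>\<epsilon>\<bar> \<le> (\<Sum>i\<in>I. c i t * (F i \<epsilon> - F i 0)))"
      using Pg ev [OF \<theta>(1)] by eventually_elim simp
    then have "\<forall>\<^sub>F \<epsilon> in at 0 within R. Pg \<epsilon> \<and>
        (\<exists>t. \<bar>t - 1\<bar> < \<theta> \<and> b t * \<bar>\<epsilon>\<bar> \<le> (\<Sum>i\<in>I. c i t * (F i \<epsilon> - F i 0)))"
      by (rule filter_leD [OF at_le [OF subset_UNIV]])
    moreover have "\<forall>\<^sub>F \<epsilon> in at 0 within R. \<epsilon> \<in> R"
      by (simp add: eventually_at_filter)
    ultimately have "\<forall>\<^sub>F \<epsilon> in at 0 within R. False"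
    proof eventually_elim
      case (elim \<epsilon>)
      then obtain t where t: "\<bar>t - 1\<bar> < \<theta>" "b t * \<bar>\<epsilon>\<bar> \<le> (\<Sum>i\<in>I. c i t * (F i \<epsilon> - F i 0))" by blast
      have "\<epsilon> \<noteq> 0" using elim R by auto
      then show ?case using contra [OF P [OF \<theta>(2) [OF t(1)]]] elim t(2) Q_eq [of \<epsilon> t] by fastforce
    qed
    then show False using R by (simp add: eventually_False)
  qed
  show "b 1 \<le> ?S"
  proof (rule ccontr)
    assume "\<not> b 1 \<le> ?S"
    then have "?S - b 1 < 0" by simp
    then have "\<forall>\<^sub>F z in nhds 1 \<times>\<^sub>F at 0. Q (fst z) (snd z) - b (fst z) < 0"
      by (rule order_tendstoD(2) [OF tendsto_diff [OF lim blim]])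
    then show False
      by (rule main [where R = "{0<..}"]) (auto simp: mult_strict_right_mono)
  qed
  show "?S \<le> - b 1"
  proof (rule ccontr)
    assume "\<not> ?S \<le> - b 1"
    then have "?S + b 1 > 0" by simp
    then have "\<forall>\<^sub>F z in nhds 1 \<times>\<^sub>F at 0. Q (fst z) (snd z) + b (fst z) > 0"
      by (rule order_tendstoD(1) [OF tendsto_add [OF lim blim]])
    then show False
    proof (rule main [where R = "{..<0}"])
      fix t \<epsilon> :: real assume "Q t \<epsilon> + b t > 0" "\<epsilon> \<in> {..<0}"
      then have "(Q t \<epsilon> + b t) * \<epsilon> < 0" by (intro mult_pos_neg) auto
      then show "b t * \<bar>\<epsilon>\<bar> > Q t \<epsilon> * \<epsilon>" using \<open>\<epsilon> \<in> {..<0}\<close> by (simp add: distrib_right)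
    qed auto
  qed
qed

text \<open>The norm \<open>W_norm\<close> without its outer root. For \<open>p > 1\<close> it is
  differentiable in each vertex value even at the zero function, and it is homogeneous of degree
  \<open>p\<close>.\<close>

definition dirichlet :: "'v wgraph \<Rightarrow> 'v set \<Rightarrow> real \<Rightarrow> ('v \<Rightarrow> real) \<Rightarrow> real" where
  "dirichlet G \<Omega> p u = gintegral G (\<Omega> \<union> gboundary G \<Omega>) (\<lambda>x. grad_abs G u x powr p)"

text \<open>Functions on the whole vertex type carry the product topology. Tychonoff's theorem, with
  the one-point factor {0} off \<Omega>, takes the place of Heine-Borel.\<close>

lemma compact_bounded_Cc_space: "compact {u \<in> Cc_space \<Omega>. \<forall>x. \<bar>u x\<bar> \<le> (R::real)}"
proof (cases "R \<ge> 0")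
  case True
  let ?S = "\<lambda>x. if x \<in> \<Omega> then {- R..R} else {0::real}"
  have "compactin (product_topology (\<lambda>_. euclidean) UNIV) (PiE UNIV ?S)"
    unfolding compactin_PiE by auto
  then have "compact (PiE UNIV ?S)"
    by (simp add: euclidean_product_topology)
  also have "PiE UNIV ?S = {u \<in> Cc_space \<Omega>. \<forall>x. \<bar>u x\<bar> \<le> R}"
  proof (intro equalityI subsetI)
    fix u assume u: "u \<in> PiE UNIV ?S"
    have "(x \<notin> \<Omega> \<longrightarrow> u x = 0) \<and> \<bar>u x\<bar> \<le> R" for x
      using PiE_mem [OF u, of x] True by (auto simp: abs_le_iff split: if_splits)
    then show "u \<in> {u \<in> Cc_space \<Omega>. \<forall>x. \<bar>u x\<bar> \<le> R}" by (simp add: Cc_space_def)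
  next
    fix u assume u: "u \<in> {u \<in> Cc_space \<Omega>. \<forall>x. \<bar>u x\<bar> \<le> R}"
    have "u x \<in> ?S x" for x
    proof -
      have "\<bar>u x\<bar> \<le> R" "x \<notin> \<Omega> \<longrightarrow> u x = 0" using u by (auto simp: Cc_space_def)
      then show ?thesis by (auto simp: abs_le_iff)
    qed
    then show "u \<in> PiE UNIV ?S" by auto
  qed
  finally show ?thesis .
next
  case False
  then have "\<not> \<bar>u x\<bar> \<le> R" for u :: "'a \<Rightarrow> real" and x by linarith
  then show ?thesis by simp
qed

lemma continuous_on_eval [continuous_intros]: "continuous_on S (\<lambda>u :: 'v \<Rightarrow> real. u x)"
  by (rule continuous_on_product_then_coordinatewise) (rule continuous_on_id)

lemma continuous_on_fun_upd:
  fixes u :: "'v \<Rightarrow> real"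
  shows "continuous_on S (\<lambda>\<epsilon>. u(x := u x + \<epsilon>))"
proof (rule continuous_on_coordinatewise_then_product)
  fix y show "continuous_on S (\<lambda>\<epsilon>. (u(x := u x + \<epsilon>)) y)"
    by (cases "y = x") (auto intro!: continuous_on_add)
qed

lemma closed_Cc_space: "closed (Cc_space \<Omega>)"
proof -
  have "Cc_space \<Omega> = (\<Inter>x\<in>-\<Omega>. {u. u x = 0})" by (auto simp: Cc_space_def)
  also have "closed \<dots>"
    by (intro closed_INT ballI closed_Collect_eq continuous_intros)
  finally show ?thesis .
qed

lemma closed_Cc_pairs: "closed {w :: ('v \<Rightarrow> real) \<times> ('v \<Rightarrow> real). fst w \<in> Cc_space \<Omega> \<and> snd w \<in> Cc_space \<Omega>}"
proof -
  have "{w :: ('v \<Rightarrow> real) \<times> ('v \<Rightarrow> real). fst w \<in> Cc_space \<Omega> \<and> snd w \<in> Cc_space \<Omega>} = Cc_space \<Omega> \<times> Cc_space \<Omega>"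
    by auto
  then show ?thesis by (simp add: closed_Times closed_Cc_space)
qed

section \<open>Finiteness and positivity in a locally finite graph\<close>

context connected_wgraph
begin

lemma finite_nbrs: "x \<in> vertices G \<Longrightarrow> finite (nbrs G x)"
  unfolding nbrs_def by (rule locally_finite)

lemma nbrs_vertices: "y \<in> nbrs G x \<Longrightarrow> y \<in> vertices G \<and> x \<in> vertices G"
  using edges_subset by (auto simp: nbrs_def)

lemma nbrs_sym: "y \<in> nbrs G x \<longleftrightarrow> x \<in> nbrs G y"
  using edges_sym by (auto simp: nbrs_def sym_def)

lemma vmeas_pos: "x \<in> vertices G \<Longrightarrow> vmeas G x > 0"
  using vmeas_bound by force

lemma finite_reach:
  assumes x: "x \<in> vertices G"
  shows "finite {y. (x, y) \<in> edges G ^^ n} \<and> {y. (x, y) \<in> edges G ^^ n} \<subseteq> vertices G"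
proof (induction n)
  case 0
  then show ?case using x by simp
next
  case (Suc n)
  have eq: "{y. (x, y) \<in> edges G ^^ Suc n} = (\<Union>z\<in>{y. (x, y) \<in> edges G ^^ n}. nbrs G z)"
    by (auto simp: nbrs_def)
  show ?case
    unfolding eq using Suc finite_nbrs nbrs_vertices by (auto simp del: relpow.simps)
qed

text \<open>Balls of a locally finite graph are finite. Connectedness enters because it provides
  some path, without which the \<open>LEAST\<close> in \<open>gdist\<close> would carry no
  information.\<close>

lemma finite_bounded_domain:
  assumes "bounded_domain G \<Omega>"
  shows "finite \<Omega>"
proof (cases "\<Omega> = {}")
  case False
  then obtain x where x: "x \<in> \<Omega>" by blast
  obtain D where D: "\<And>y. y \<in> \<Omega> \<Longrightarrow> gdist G x y \<le> D" and sub: "\<Omega> \<subseteq> vertices G"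
    using assms x by (auto simp: bounded_domain_def)
  have "\<Omega> \<subseteq> (\<Union>n\<le>D. {y. (x, y) \<in> edges G ^^ n})"
  proof
    fix y assume y: "y \<in> \<Omega>"
    then have "(x, y) \<in> (edges G)\<^sup>*" using connected x sub by auto
    then obtain n where "(x, y) \<in> edges G ^^ n" by (auto simp: rtrancl_power)
    then have "(x, y) \<in> edges G ^^ gdist G x y" unfolding gdist_def by (rule LeastI)
    then show "y \<in> (\<Union>n\<le>D. {y. (x, y) \<in> edges G ^^ n})" using D [OF y] by auto
  qed
  moreover have "finite (\<Union>n\<le>D. {y. (x, y) \<in> edges G ^^ n})"
    using finite_reach [of x] x sub by auto
  ultimately show ?thesis by (rule finite_subset)
qed auto

lemma nbrs_subset:
  assumes "x \<in> \<Omega>"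
  shows "nbrs G x \<subseteq> \<Omega> \<union> gboundary G \<Omega>"
  using assms nbrs_vertices by (auto simp: gboundary_def nbrs_def)

lemma grad_form_nonneg: "x \<in> vertices G \<Longrightarrow> 0 \<le> grad_form G u u x"
proof -
  assume x: "x \<in> vertices G"
  have "0 \<le> weight G x y * (u y - u x) * (u y - u x)" if "y \<in> nbrs G x" for y
    using weight_pos [of x y] that by (simp add: nbrs_def mult.assoc)
  then show ?thesis
    unfolding grad_form_def using vmeas_pos [OF x]
    by (intro mult_nonneg_nonneg [of "1 / _"] sum_nonneg) auto
qed

end

section \<open>The Dirichlet energy on a finite domain\<close>

locale finite_domain = connected_wgraph G for G :: "'v wgraph" +
  fixes \<Omega> :: "'v set"
  assumes fin: "finite \<Omega>" and dom: "\<Omega> \<subseteq> vertices G"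
begin

lemma finite_closure: "finite (\<Omega> \<union> gboundary G \<Omega>)"
proof -
  have "gboundary G \<Omega> \<subseteq> (\<Union>x\<in>\<Omega>. nbrs G x)"
    by (auto simp: gboundary_def nbrs_def)
  then have "finite (gboundary G \<Omega>)"
    by (rule finite_subset) (use fin dom finite_nbrs in auto)
  then show ?thesis using fin by simp
qed

lemma closure_vertices: "\<Omega> \<union> gboundary G \<Omega> \<subseteq> vertices G"
  using dom by (auto simp: gboundary_def)

lemma gintegral_mono:
  "(\<And>x. x \<in> \<Omega> \<Longrightarrow> f x \<le> g x) \<Longrightarrow> gintegral G \<Omega> f \<le> gintegral G \<Omega> g"
  unfolding gintegral_def using dom vmeas_pos by (intro sum_mono mult_left_mono) (auto intro: less_imp_le)

lemma gintegral_nonneg: "(\<And>x. x \<in> \<Omega> \<Longrightarrow> 0 \<le> f x) \<Longrightarrow> 0 \<le> gintegral G \<Omega> f"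
  using gintegral_mono [of "\<lambda>_. 0" f] by (simp add: gintegral_def)

lemma gintegral_pos:
  assumes x: "x \<in> \<Omega>" "f x > 0" and "\<And>y. y \<in> \<Omega> \<Longrightarrow> f y \<ge> 0"
  shows "gintegral G \<Omega> f > 0"
proof -
  have mu: "vmeas G y > 0" if "y \<in> \<Omega>" for y using that dom vmeas_pos by auto
  have "0 < vmeas G x * f x" using x mu by simp
  also have "\<dots> \<le> gintegral G \<Omega> f"
    unfolding gintegral_def using fin x assms(3) mu
    by (intro member_le_sum) (auto intro!: mult_nonneg_nonneg less_imp_le [OF mu])
  finally show ?thesis .
qed

lemma W_norm_nonneg: "W_norm G \<Omega> l u \<ge> 0"
  by (simp add: W_norm_def)

lemma dirichlet_nonneg: "0 \<le> dirichlet G \<Omega> p u"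
  unfolding dirichlet_def gintegral_def
  using closure_vertices vmeas_pos by (intro sum_nonneg mult_nonneg_nonneg) (auto intro: less_imp_le)

lemma W_norm_powr: "W_norm G \<Omega> p u powr s = dirichlet G \<Omega> p u powr (s / p)"
  by (simp add: W_norm_def dirichlet_def powr_powr)

lemma W_norm_powr_self: "p \<noteq> 0 \<Longrightarrow> W_norm G \<Omega> p u powr p = dirichlet G \<Omega> p u"
  by (simp add: W_norm_powr dirichlet_nonneg)

lemma dirichlet_scale:
  assumes c: "c \<ge> 0"
  shows "dirichlet G \<Omega> p (\<lambda>x. c * u x) = c powr p * dirichlet G \<Omega> p u"
proof -
  have form: "grad_form G (\<lambda>x. c * u x) (\<lambda>x. c * u x) x = c\<^sup>2 * grad_form G u u x" for x
    by (auto simp: grad_form_def sum_distrib_left power2_eq_square algebra_simps intro!: sum.cong)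
  have "grad_abs G (\<lambda>x. c * u x) x powr p = c powr p * grad_abs G u x powr p"
    if "x \<in> \<Omega> \<union> gboundary G \<Omega>" for x
    using c grad_form_nonneg [of x u] that closure_vertices
    by (auto simp: grad_abs_def form real_sqrt_mult powr_mult)
  then show ?thesis
    by (auto simp: dirichlet_def gintegral_def sum_distrib_left intro!: sum.cong)
qed

lemma continuous_dirichlet:
  assumes p: "p > 0"
  shows "continuous_on UNIV (dirichlet G \<Omega> p)"
proof -
  have "continuous_on UNIV (\<lambda>u. grad_abs G u x)" for x
    unfolding grad_abs_def grad_form_def by (intro continuous_intros)
  then show ?thesis
    unfolding dirichlet_def gintegral_def using p grad_form_nonneg closure_vertices
    by (intro continuous_intros continuous_on_powr') (auto simp: grad_abs_def)
qed

lemma continuous_W_norm: "l > 1 \<Longrightarrow> continuous_on UNIV (W_norm G \<Omega> l)"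
  unfolding W_norm_def dirichlet_def [symmetric]
  by (intro continuous_on_powr' continuous_dirichlet continuous_on_const) (auto simp: dirichlet_nonneg)

text \<open>The chain rule works only where the gradient is nonzero. Where it vanishes, the squared
  gradient is exactly \<open>\<epsilon>\<^sup>2 * K\<close>, so the function is a multiple of
  \<open>\<bar>\<epsilon>\<bar> powr p\<close>, which is flat at 0 because \<open>p > 1\<close>;
  this covers \<open>p < 2\<close> as well.\<close>

lemma has_real_derivative_grad_abs_powr:
  assumes p: "p > 1" and z: "z \<in> vertices G"
  shows "((\<lambda>\<epsilon>. grad_abs G (u(x := u x + \<epsilon>)) z powr p) has_real_derivative
     p / 2 * grad_abs G u z powr (p - 2) *
       (1 / vmeas G z * (\<Sum>y\<in>nbrs G z. weight G z y * (u y - u z) *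
         ((if y = x then 1 else 0) - (if z = x then 1 else 0))))) (at 0)"
proof -
  define \<delta> where "\<delta> y = (if y = x then 1 else 0 :: real)" for y
  define \<Gamma> where "\<Gamma> \<epsilon> = grad_form G (u(x := u x + \<epsilon>)) (u(x := u x + \<epsilon>)) z" for \<epsilon>
  have upd: "(u(x := u x + \<epsilon>)) y = u y + \<epsilon> * \<delta> y" for y \<epsilon> by (auto simp: \<delta>_def)
  have \<Gamma>_eq: "\<Gamma> \<epsilon> = 1 / (2 * vmeas G z) *
      (\<Sum>y\<in>nbrs G z. weight G z y * ((u y - u z) + \<epsilon> * (\<delta> y - \<delta> z))\<^sup>2)" for \<epsilon>
    unfolding \<Gamma>_def grad_form_def upd
    by (auto simp: power2_eq_square algebra_simps intro!: sum.cong)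
  let ?\<Gamma>' = "1 / vmeas G z * (\<Sum>y\<in>nbrs G z. weight G z y * (u y - u z) * (\<delta> y - \<delta> z))"
  have d\<Gamma>: "(\<Gamma> has_real_derivative ?\<Gamma>') (at 0)"
  proof -
    have "((\<lambda>\<epsilon>. weight G z y * ((u y - u z) + \<epsilon> * (\<delta> y - \<delta> z))\<^sup>2) has_real_derivative
        2 * (weight G z y * (u y - u z) * (\<delta> y - \<delta> z))) (at 0)" for y
      by (auto intro!: derivative_eq_intros)
    then have "(\<Gamma> has_real_derivative 1 / (2 * vmeas G z) *
        (\<Sum>y\<in>nbrs G z. 2 * (weight G z y * (u y - u z) * (\<delta> y - \<delta> z)))) (at 0)"
      unfolding \<Gamma>_eq by (intro DERIV_cmult DERIV_sum)
    then show ?thesis by (simp add: sum_distrib_left [symmetric])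
  qed
  have \<Gamma>0: "\<Gamma> 0 = grad_form G u u z" by (simp add: \<Gamma>_def)
  have abs: "grad_abs G (u(x := u x + \<epsilon>)) z = sqrt (\<Gamma> \<epsilon>)" for \<epsilon>
    by (simp add: grad_abs_def \<Gamma>_def)
  have abs0: "grad_abs G u z = sqrt (\<Gamma> 0)" by (simp add: grad_abs_def \<Gamma>0)
  have "((\<lambda>\<epsilon>. sqrt (\<Gamma> \<epsilon>) powr p) has_real_derivative p / 2 * sqrt (\<Gamma> 0) powr (p - 2) * ?\<Gamma>') (at 0)"
  proof (cases "\<Gamma> 0 = 0")
    case False
    then have pos: "\<Gamma> 0 > 0" using grad_form_nonneg [OF z, of u] \<Gamma>0 by simp
    have "((\<lambda>\<epsilon>. \<Gamma> \<epsilon> powr (p / 2)) has_real_derivative p / 2 * \<Gamma> 0 powr (p / 2 - 1) * ?\<Gamma>') (at 0)"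
      by (rule DERIV_chain2 [of "\<lambda>y. y powr (p / 2)", OF has_real_derivative_powr [OF pos] d\<Gamma>])
    moreover have "sqrt (\<Gamma> \<epsilon>) powr p = \<Gamma> \<epsilon> powr (p / 2)" for \<epsilon>
      using grad_form_nonneg [OF z] by (simp add: powr_half_sqrt [symmetric] \<Gamma>_def powr_powr)
    moreover have "sqrt (\<Gamma> 0) powr (p - 2) = \<Gamma> 0 powr (p / 2 - 1)"
      using pos by (simp add: powr_half_sqrt [symmetric] powr_powr diff_divide_distrib)
    ultimately show ?thesis by simp
  next
    case True
    have zero: "u y - u z = 0" if y: "y \<in> nbrs G z" for y
    proof -
      have "(\<Sum>y\<in>nbrs G z. weight G z y * (u y - u z)\<^sup>2) = 0"
        using True vmeas_pos [OF z] by (simp add: \<Gamma>_eq)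
      then have "weight G z y * (u y - u z)\<^sup>2 = 0"
        using finite_nbrs [OF z] y weight_pos
        by (subst (asm) sum_nonneg_eq_0_iff) (force simp: nbrs_def)+
      then show ?thesis using weight_pos [of z y] y by (auto simp: nbrs_def)
    qed
    define K where "K = 1 / (2 * vmeas G z) * (\<Sum>y\<in>nbrs G z. weight G z y * (\<delta> y - \<delta> z)\<^sup>2)"
    have "K \<ge> 0" unfolding K_def
      by (intro mult_nonneg_nonneg sum_nonneg)
        (auto simp: nbrs_def intro!: less_imp_le [OF weight_pos] less_imp_le [OF vmeas_pos] z)
    have \<Gamma>K: "\<Gamma> \<epsilon> = \<epsilon>\<^sup>2 * K" for \<epsilon>
      unfolding \<Gamma>_eq K_def
      by (auto simp: zero sum_distrib_left power_mult_distrib intro!: sum.cong)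
    have "sqrt (\<Gamma> \<epsilon>) powr p = sqrt K powr p * \<bar>\<epsilon>\<bar> powr p" for \<epsilon>
      unfolding \<Gamma>K using \<open>K \<ge> 0\<close> by (simp add: real_sqrt_mult powr_mult)
    moreover have "((\<lambda>\<epsilon>. sqrt K powr p * \<bar>\<epsilon>\<bar> powr p) has_real_derivative
        sqrt K powr p * (p * (\<bar>0\<bar> powr (p - 2) * 0))) (at 0)"
      by (intro DERIV_cmult has_real_derivative_abs_powr disjI1 p)
    ultimately show ?thesis using True by simp
  qed
  then show ?thesis unfolding abs abs0 \<delta>_def by simp
qed

text \<open>Discrete integration by parts: a change at \<open>x\<close> is felt only in the
  gradients at \<open>x\<close> and at its neighbours. These two contributions produce the two
  powers of the gradient in the Laplacian.\<close>

lemma has_real_derivative_dirichlet: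
  assumes p: "p > 1" and x: "x \<in> \<Omega>"
  shows "((\<lambda>\<epsilon>. dirichlet G \<Omega> p (u(x := u x + \<epsilon>))) has_real_derivative
     - p * vmeas G x * graph_laplacian G p u x) (at 0)"
proof -
  let ?Z = "\<Omega> \<union> gboundary G \<Omega>"
  define a where "a z = grad_abs G u z powr (p - 2)" for z
  define \<delta> where "\<delta> y = (if y = x then 1 else 0 :: real)" for y
  have xV: "x \<in> vertices G" using x dom by auto
  have "((\<lambda>\<epsilon>. dirichlet G \<Omega> p (u(x := u x + \<epsilon>))) has_real_derivative
     (\<Sum>z\<in>?Z. vmeas G z * (p / 2 * a z * (1 / vmeas G z * (\<Sum>y\<in>nbrs G z. weight G z y * (u y - u z) *
         (\<delta> y - \<delta> z)))))) (at 0)"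
    unfolding dirichlet_def gintegral_def a_def \<delta>_def
    using closure_vertices
    by (intro DERIV_sum DERIV_cmult has_real_derivative_grad_abs_powr p) auto
  also have "(\<Sum>z\<in>?Z. vmeas G z * (p / 2 * a z * (1 / vmeas G z * (\<Sum>y\<in>nbrs G z. weight G z y * (u y - u z) *
         (\<delta> y - \<delta> z))))) = p / 2 * (\<Sum>z\<in>?Z. \<Sum>y\<in>nbrs G z. a z * weight G z y * (u y - u z) * (\<delta> y - \<delta> z))"
    unfolding sum_distrib_left
  proof (intro sum.cong refl)
    fix z y assume "z \<in> ?Z" "y \<in> nbrs G z"
    then have "vmeas G z \<noteq> 0" using closure_vertices vmeas_pos by force
    then show "vmeas G z * (p / 2 * a z * (1 / vmeas G z * (weight G z y * (u y - u z) * (\<delta> y - \<delta> z)))) =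
         p / 2 * (a z * weight G z y * (u y - u z) * (\<delta> y - \<delta> z))"
      by simp
  qed
  also have "(\<Sum>z\<in>?Z. \<Sum>y\<in>nbrs G z. a z * weight G z y * (u y - u z) * (\<delta> y - \<delta> z))
     = (\<Sum>z\<in>?Z. \<Sum>y\<in>nbrs G z. a z * weight G z y * (u y - u z) * \<delta> y)
       - (\<Sum>z\<in>?Z. \<Sum>y\<in>nbrs G z. a z * weight G z y * (u y - u z) * \<delta> z)"
    by (simp add: right_diff_distrib sum_subtractf)
  also have "(\<Sum>z\<in>?Z. \<Sum>y\<in>nbrs G z. a z * weight G z y * (u y - u z) * \<delta> z)
      = (\<Sum>y\<in>nbrs G x. a x * weight G x y * (u y - u x))"
  proof -
    have "(\<Sum>y\<in>nbrs G z. a z * weight G z y * (u y - u z) * \<delta> z)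
        = (if z = x then (\<Sum>y\<in>nbrs G x. a x * weight G x y * (u y - u x)) else 0)" for z
      by (auto simp: \<delta>_def)
    then show ?thesis using finite_closure x by (simp add: sum.delta)
  qed
  also have "(\<Sum>z\<in>?Z. \<Sum>y\<in>nbrs G z. a z * weight G z y * (u y - u z) * \<delta> y)
      = (\<Sum>z\<in>?Z. if z \<in> nbrs G x then a z * weight G z x * (u x - u z) else 0)"
  proof (intro sum.cong refl)
    fix z assume z: "z \<in> ?Z"
    have "(\<Sum>y\<in>nbrs G z. a z * weight G z y * (u y - u z) * \<delta> y)
      = (\<Sum>y\<in>nbrs G z. if y = x then a z * weight G z x * (u x - u z) else 0)"
      by (auto simp: \<delta>_def intro!: sum.cong)
    also have "\<dots> = (if x \<in> nbrs G z then a z * weight G z x * (u x - u z) else 0)"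
      using finite_nbrs z closure_vertices by (subst sum.delta) auto
    finally show "(\<Sum>y\<in>nbrs G z. a z * weight G z y * (u y - u z) * \<delta> y)
      = (if z \<in> nbrs G x then a z * weight G z x * (u x - u z) else 0)"
      using nbrs_sym by simp
  qed
  \<comment> \<open>As \<open>x\<close> lies in \<Omega>, all its neighbours lie in \<Omega> or its
    boundary, so restricting the sum loses none of them.\<close>
  also have "\<dots> = (\<Sum>z\<in>nbrs G x. a z * weight G z x * (u x - u z))"
    using finite_closure nbrs_subset [OF x]
    by (simp add: sum.inter_restrict [symmetric] Int_absorb1)
  also have "p / 2 * (\<dots> - (\<Sum>y\<in>nbrs G x. a x * weight G x y * (u y - u x)))
      = - (p / 2 * (\<Sum>y\<in>nbrs G x. (a y + a x) * weight G x y * (u y - u x)))"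
  proof -
    have "(\<Sum>z\<in>nbrs G x. a z * weight G z x * (u x - u z)) - (\<Sum>y\<in>nbrs G x. a x * weight G x y * (u y - u x))
        = (\<Sum>y\<in>nbrs G x. - ((a y + a x) * weight G x y * (u y - u x)))"
      unfolding sum_subtractf [symmetric]
      using weight_sym by (intro sum.cong) (auto simp: nbrs_def algebra_simps)
    then show ?thesis by (simp add: sum_negf)
  qed
  also have "\<dots> = - p * vmeas G x * graph_laplacian G p u x"
    using vmeas_pos [OF xV] by (simp add: graph_laplacian_def a_def)
  finally show ?thesis .
qed

end

section \<open>The Euler-Lagrange equations\<close>

text \<open>The case distinction mirrors \<open>kirchhoff\<close>. For \<open>k > 0\<close> the
  absolute value is inserted so that the zero of \<open>f\<close> is covered too, the exponent
  \<open>k + 1\<close> exceeding 1.\<close>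

lemma has_real_derivative_kirchhoff:
  fixes f :: "real \<Rightarrow> real"
  assumes f: "(f has_real_derivative f') (at s)" and nn: "\<And>x. f x \<ge> 0" and k: "k \<ge> 0"
  shows "((\<lambda>x. f x powr (k + 1)) has_real_derivative
    (k + 1) * ((if k = 0 then 1 else f s powr k) * f')) (at s)"
proof (cases "k = 0")
  case True
  then show ?thesis using f nn by simp
next
  case False
  have eq: "\<bar>f s\<bar> powr (k + 1 - 2) * f s = f s powr k"
    using nn [of s] powr_mult_base [of "f s" "k - 1"] by (simp add: mult.commute)
  have "((\<lambda>x. \<bar>f x\<bar> powr (k + 1)) has_real_derivative
      (k + 1) * (\<bar>f s\<bar> powr (k + 1 - 2) * f s) * f') (at s)"
    using k False by (intro DERIV_chain2 [OF has_real_derivative_abs_powr f]) auto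
  then show ?thesis unfolding eq using nn False by (simp add: mult.assoc)
qed

lemma (in finite_domain) gintegral_fun_upd:
  assumes x: "x \<in> \<Omega>"
  shows "gintegral G \<Omega> (\<lambda>y. f y ((u(x := w)) y))
    = gintegral G \<Omega> (\<lambda>y. f y (u y)) + vmeas G x * (f x w - f x (u x))"
proof -
  have "gintegral G \<Omega> (\<lambda>y. f y ((u(x := w)) y)) - gintegral G \<Omega> (\<lambda>y. f y (u y))
      = (\<Sum>y\<in>\<Omega>. if y = x then vmeas G x * (f x w - f x (u x)) else 0)"
    unfolding gintegral_def sum_subtractf [symmetric]
    by (intro sum.cong) (auto simp: right_diff_distrib)
  then show ?thesis using fin x by (simp add: sum.delta')
qed

locale kirchhoff_system = finite_domain G \<Omega> for G :: "'v wgraph" and \<Omega> +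
  fixes p q r \<alpha> \<beta> k a1 a2 b1 b2 \<Lambda>1 \<Lambda>2 :: real and h1 h2 h3 g1 g2 :: "'v \<Rightarrow> real"
  assumes p: "p > 1" and q: "q > 1" and r: "r > 1" and rp: "r < p" and rq: "r < q"
    and \<alpha>: "\<alpha> > 0" and \<beta>: "\<beta> > 0" and k: "k \<ge> 0"
    and super_p: "(k + 1) * p < \<alpha> + \<beta>" and super_q: "(k + 1) * q < \<alpha> + \<beta>"
    and a1: "a1 > 0" and a2: "a2 > 0" and b1: "b1 > 0" and b2: "b2 > 0"
    and \<Lambda>1: "\<Lambda>1 > 0" and \<Lambda>2: "\<Lambda>2 > 0"
    and h: "\<And>x. x \<in> \<Omega> \<Longrightarrow> h1 x > 0 \<and> h2 x > 0 \<and> h3 x > 0"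
begin

abbreviation "\<phi> \<equiv> energy G \<Omega> p q r \<alpha> \<beta> k a1 b1 a2 b2 \<Lambda>1 \<Lambda>2 h1 h2 h3 g1 g2"

definition "m = k + 1"
definition "d = \<alpha> / p + \<beta> / q"

text \<open>Along \<open>t \<mapsto> (su t u, sv t v)\<close> both Dirichlet energies are linear in \<open>t\<close>, even if \<open>p \<noteq> q\<close>.\<close>

definition su :: "real \<Rightarrow> ('v \<Rightarrow> real) \<Rightarrow> 'v \<Rightarrow> real" where
  "su t u = (\<lambda>x. t powr (1 / p) * u x)"
definition sv :: "real \<Rightarrow> ('v \<Rightarrow> real) \<Rightarrow> 'v \<Rightarrow> real" where
  "sv t v = (\<lambda>x. t powr (1 / q) * v x)"

text \<open>The coefficients to be fed into \<open>fiber\<close>. The Dirichlet terms of both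
  components merge since they share exponents along a curve; the remaining terms stay apart because
  \<open>r / p\<close> and \<open>r / q\<close>, or \<open>1 / p\<close> and \<open>1 / q\<close>,
  may differ.\<close>

definition "cA u v = a1 / p * dirichlet G \<Omega> p u + a2 / q * dirichlet G \<Omega> q v"
definition "cB u v = b1 / (p * m) * dirichlet G \<Omega> p u powr m + b2 / (q * m) * dirichlet G \<Omega> q v powr m"
definition "n1 u = \<Lambda>1 / r * gintegral G \<Omega> (\<lambda>x. h1 x * \<bar>u x\<bar> powr r)"
definition "n2 v = \<Lambda>2 / r * gintegral G \<Omega> (\<lambda>x. h3 x * \<bar>v x\<bar> powr r)"
definition "l1 u = gintegral G \<Omega> (\<lambda>x. g1 x * u x)"
definition "l2 v = gintegral G \<Omega> (\<lambda>x. g2 x * v x)"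
definition "cH u v = 1 / (\<alpha> + \<beta>) * gintegral G \<Omega> (\<lambda>x. h2 x * \<bar>u x\<bar> powr \<alpha> * \<bar>v x\<bar> powr \<beta>)"

lemma energy_eq: "\<phi> u v = cA u v + cB u v - n1 u - n2 v - cH u v - l1 u - l2 v"
  using p q by (simp add: energy_def cA_def cB_def n1_def n2_def l1_def l2_def cH_def m_def
      W_norm_powr dirichlet_nonneg)

lemma dirichlet_su: "t > 0 \<Longrightarrow> dirichlet G \<Omega> p (su t u) = t * dirichlet G \<Omega> p u"
  and dirichlet_sv: "t > 0 \<Longrightarrow> dirichlet G \<Omega> q (sv t v) = t * dirichlet G \<Omega> q v"
  using p q by (simp_all add: su_def sv_def dirichlet_scale powr_powr)

lemma scale_cA: "t > 0 \<Longrightarrow> cA (su t u) (sv t v) = t * cA u v"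
  by (simp add: cA_def dirichlet_su dirichlet_sv algebra_simps)

lemma scale_cB: "t > 0 \<Longrightarrow> cB (su t u) (sv t v) = t powr m * cB u v"
  by (simp add: cB_def dirichlet_su dirichlet_sv powr_mult dirichlet_nonneg algebra_simps)

lemma scale_n1: "t > 0 \<Longrightarrow> n1 (su t u) = t powr (r / p) * n1 u"
  by (simp add: n1_def su_def gintegral_def sum_distrib_left abs_mult powr_mult powr_powr mult_ac)

lemma scale_n2: "t > 0 \<Longrightarrow> n2 (sv t v) = t powr (r / q) * n2 v"
  by (simp add: n2_def sv_def gintegral_def sum_distrib_left abs_mult powr_mult powr_powr mult_ac)

lemma scale_l1: "t > 0 \<Longrightarrow> l1 (su t u) = t powr (1 / p) * l1 u"
  by (simp add: l1_def su_def gintegral_def sum_distrib_left mult_ac)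

lemma scale_l2: "t > 0 \<Longrightarrow> l2 (sv t v) = t powr (1 / q) * l2 v"
  by (simp add: l2_def sv_def gintegral_def sum_distrib_left mult_ac)

lemma scale_cH: "t > 0 \<Longrightarrow> cH (su t u) (sv t v) = t powr d * cH u v"
  by (simp add: cH_def su_def sv_def d_def gintegral_def sum_distrib_left abs_mult powr_mult powr_powr
      powr_add mult_ac)

lemmas scale = scale_cA scale_cB scale_n1 scale_n2 scale_l1 scale_l2 scale_cH

text \<open>The assumptions are symmetric in the two components, so estimates and equations are
  proved for the first one and transferred.\<close>

lemma swapped: "kirchhoff_system G \<Omega> q p r \<beta> \<alpha> k a2 a1 b2 b1 \<Lambda>2 \<Lambda>1 h3 h2 h1"
  by unfold_locales (use p q r rp rq \<alpha> \<beta> k super_p super_q a1 a2 b1 b2 \<Lambda>1 \<Lambda>2 h in \<open>auto simp: add.commute\<close>)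

lemma energy_swap: "energy G \<Omega> q p r \<beta> \<alpha> k a2 b2 a1 b1 \<Lambda>2 \<Lambda>1 h3 h2 h1 g2 g1 v u = \<phi> u v"
  by (simp add: energy_def add.commute mult_ac)

text \<open>Only the value at one vertex is varied, so the slope of the energy is the equation at
  that vertex times its measure. Allowing a time \<open>t\<close> near 1 that depends on
  \<open>\<epsilon>\<close> covers both kinds of minimizers.\<close>

lemma first_equation:
  assumes x: "x \<in> \<Omega>"
    and min: "\<And>\<theta>. \<theta> > 0 \<Longrightarrow> \<forall>\<^sub>F \<epsilon> in at 0. \<exists>t>0. \<bar>t - 1\<bar> < \<theta> \<and>
      \<phi> (su t u) (sv t v) \<le> \<phi> (su t (u(x := u x + \<epsilon>))) (sv t v)"
  shows "- kirchhoff a1 b1 k (W_norm G \<Omega> p u powr p) * graph_laplacian G p u x =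
          \<Lambda>1 * h1 x * (\<bar>u x\<bar> powr (r - 2) * u x)
          + \<alpha> / (\<alpha> + \<beta>) * h2 x * (\<bar>u x\<bar> powr (\<alpha> - 2) * u x) * \<bar>v x\<bar> powr \<beta> + g1 x"
proof -
  define P where "P \<epsilon> = dirichlet G \<Omega> p (u(x := u x + \<epsilon>))" for \<epsilon>
  define P' where "P' = - p * vmeas G x * graph_laplacian G p u x"
  define K where "K = (if k = 0 then 1 else dirichlet G \<Omega> p u powr k)"
  define \<kappa> where "\<kappa> = vmeas G x * h2 x * \<bar>v x\<bar> powr \<beta>"
  \<comment> \<open>The only case in which the coupling is not differentiable in \<open>u x\<close>;
    for \<open>v x = 0\<close> its coefficient \<open>\<kappa>\<close> vanishes. The bad term is
    taken out of \<open>F\<close> and replaced by the linear kink \<open>b\<close>. The entry of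
    \<open>D\<close> is then 0 since \<open>u x = 0\<close>, as in the equation.\<close>
  define kink where "kink \<longleftrightarrow> u x = 0 \<and> v x \<noteq> 0 \<and> \<alpha> \<le> 1"
  define F where "F i \<epsilon> = [P \<epsilon>, P \<epsilon> powr (k + 1), vmeas G x * h1 x * \<bar>u x + \<epsilon>\<bar> powr r,
      vmeas G x * g1 x * (u x + \<epsilon>), if kink then 0 else \<kappa> * \<bar>u x + \<epsilon>\<bar> powr \<alpha>] ! i" for i \<epsilon>
  define D where "D i = [P', (k + 1) * (K * P'), vmeas G x * h1 x * (r * (\<bar>u x\<bar> powr (r - 2) * u x)),
      vmeas G x * g1 x, \<kappa> * (\<alpha> * (\<bar>u x\<bar> powr (\<alpha> - 2) * u x))] ! i" for i
  define c where "c i t = [a1 / p * t, b1 / (p * m) * t powr m, - (\<Lambda>1 / r * t powr (r / p)),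
      - (t powr (1 / p)), - (1 / (\<alpha> + \<beta>) * t powr d)] ! i" for i t
  define b where "b t = (if kink then 1 / (\<alpha> + \<beta>) * t powr d * \<kappa> else 0)" for t
  have mu: "vmeas G x > 0" using x dom vmeas_pos by auto
  have \<kappa>: "\<kappa> \<ge> 0" unfolding \<kappa>_def using mu h [OF x] by simp
  have P: "(P has_real_derivative P') (at 0)"
    unfolding P_def P'_def by (rule has_real_derivative_dirichlet [OF p x])
  have P_nn: "P \<epsilon> \<ge> 0" for \<epsilon> by (simp add: P_def dirichlet_nonneg)
  have P0: "P 0 = dirichlet G \<Omega> p u" by (simp add: P_def)
  have power: "((\<lambda>\<epsilon>. \<bar>u x + \<epsilon>\<bar> powr c) has_real_derivative c * (\<bar>u x\<bar> powr (c - 2) * u x)) (at 0)"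
    if "c > 1 \<or> u x \<noteq> 0" for c
  proof -
    have "((\<lambda>\<epsilon>. \<bar>u x + \<epsilon>\<bar> powr c) has_real_derivative
        c * (\<bar>u x + 0\<bar> powr (c - 2) * (u x + 0)) * 1) (at 0)"
      by (rule DERIV_chain2 [OF has_real_derivative_abs_powr])
        (use that in \<open>auto intro!: derivative_eq_intros\<close>)
    then show ?thesis by simp
  qed
  have I: "{..<5::nat} = {0, 1, 2, 3, 4}" by auto
  have F': "(F i has_real_derivative D i) (at 0)" if i: "i \<in> {..<5}" for i
  proof -
    have "((\<lambda>\<epsilon>. P \<epsilon> powr (k + 1)) has_real_derivative (k + 1) * (K * P')) (at 0)"
      unfolding K_def P0 [symmetric] by (rule has_real_derivative_kirchhoff [OF P P_nn k])
    moreover have "((\<lambda>\<epsilon>. vmeas G x * h1 x * \<bar>u x + \<epsilon>\<bar> powr r) has_real_derivative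
        vmeas G x * h1 x * (r * (\<bar>u x\<bar> powr (r - 2) * u x))) (at 0)"
      using r by (intro DERIV_cmult power) simp
    moreover have "((\<lambda>\<epsilon>. vmeas G x * g1 x * (u x + \<epsilon>)) has_real_derivative vmeas G x * g1 x) (at 0)"
      by (auto intro!: derivative_eq_intros)
    moreover have "((\<lambda>\<epsilon>. if kink then 0 else \<kappa> * \<bar>u x + \<epsilon>\<bar> powr \<alpha>) has_real_derivative
        \<kappa> * (\<alpha> * (\<bar>u x\<bar> powr (\<alpha> - 2) * u x))) (at 0)"
    proof (cases "\<alpha> > 1 \<or> u x \<noteq> 0")
      case True
      then have "\<not> kink" by (auto simp: kink_def)
      then show ?thesis using DERIV_cmult [OF power [OF True]] by simp
    next
      case False
      then have "kink \<or> \<kappa> = 0" by (auto simp: kink_def \<kappa>_def)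
      then have "(\<lambda>\<epsilon>. if kink then 0 else \<kappa> * \<bar>u x + \<epsilon>\<bar> powr \<alpha>) = (\<lambda>_. 0)" by auto
      then show ?thesis using False by simp
    qed
    ultimately show ?thesis using i P unfolding I F_def D_def by (auto simp: numeral_eq_Suc)
  qed
  have c: "isCont (c i) 1" if "i \<in> {..<5}" for i
    using that p r \<alpha> \<beta> k unfolding I c_def m_def
    by (auto simp: numeral_eq_Suc intro!: continuous_intros)
  have b: "isCont b 1"
    using \<alpha> \<beta> unfolding b_def by (cases kink) (auto intro!: continuous_intros)
  have ev: "\<forall>\<^sub>F \<epsilon> in at 0. \<exists>t. \<bar>t - 1\<bar> < \<theta> \<and> b t * \<bar>\<epsilon>\<bar> \<le> (\<Sum>i<5. c i t * (F i \<epsilon> - F i 0))"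
    if \<theta>: "\<theta> > 0" for \<theta>
  proof -
    have "\<forall>\<^sub>F \<epsilon> in at (0::real). \<bar>\<epsilon>\<bar> < 1"
      by (auto simp: eventually_at intro!: exI [of _ 1])
    with min [OF \<theta>] show ?thesis
    proof eventually_elim
      case (elim \<epsilon>)
      then obtain t where t: "t > 0" "\<bar>t - 1\<bar> < \<theta>"
        and le: "\<phi> (su t u) (sv t v) \<le> \<phi> (su t (u(x := u x + \<epsilon>))) (sv t v)" by blast
      let ?u = "u(x := u x + \<epsilon>)"
      have "gintegral G \<Omega> (\<lambda>y. h1 y * \<bar>?u y\<bar> powr r) - gintegral G \<Omega> (\<lambda>y. h1 y * \<bar>u y\<bar> powr r)
          = F 2 \<epsilon> - F 2 0"
        using gintegral_fun_upd [OF x, of "\<lambda>y w. h1 y * \<bar>w\<bar> powr r" u "u x + \<epsilon>"]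
        by (simp add: F_def algebra_simps)
      then have n1: "n1 ?u - n1 u = \<Lambda>1 / r * (F 2 \<epsilon> - F 2 0)"
        by (simp only: n1_def right_diff_distrib [symmetric])
      have l1: "l1 ?u - l1 u = F 3 \<epsilon> - F 3 0"
        using gintegral_fun_upd [OF x, of "\<lambda>y w. g1 y * w" u "u x + \<epsilon>"]
        by (simp add: l1_def F_def algebra_simps)
      have "gintegral G \<Omega> (\<lambda>y. h2 y * \<bar>?u y\<bar> powr \<alpha> * \<bar>v y\<bar> powr \<beta>)
          - gintegral G \<Omega> (\<lambda>y. h2 y * \<bar>u y\<bar> powr \<alpha> * \<bar>v y\<bar> powr \<beta>)
          = \<kappa> * (\<bar>u x + \<epsilon>\<bar> powr \<alpha> - \<bar>u x\<bar> powr \<alpha>)"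
        using gintegral_fun_upd [OF x, of "\<lambda>y w. h2 y * \<bar>w\<bar> powr \<alpha> * \<bar>v y\<bar> powr \<beta>" u "u x + \<epsilon>"]
        by (simp add: \<kappa>_def algebra_simps)
      then have cH: "cH ?u v - cH u v = 1 / (\<alpha> + \<beta>) * (\<kappa> * (\<bar>u x + \<epsilon>\<bar> powr \<alpha> - \<bar>u x\<bar> powr \<alpha>))"
        by (simp only: cH_def right_diff_distrib [symmetric])
      have cA: "cA ?u v - cA u v = a1 / p * (F 0 \<epsilon> - F 0 0)"
        by (simp add: cA_def F_def P_def right_diff_distrib)
      have cB: "cB ?u v - cB u v = b1 / (p * m) * (F 1 \<epsilon> - F 1 0)"
        by (simp add: cB_def F_def P_def m_def right_diff_distrib)
      have "0 \<le> t * (cA ?u v - cA u v) + t powr m * (cB ?u v - cB u v) - t powr (r / p) * (n1 ?u - n1 u)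
          - t powr (1 / p) * (l1 ?u - l1 u) - t powr d * (cH ?u v - cH u v)"
        using le unfolding energy_eq using t(1) by (simp add: scale algebra_simps)
      also have "\<dots> = (\<Sum>i<5. c i t * (F i \<epsilon> - F i 0))
          - (if kink then 1 / (\<alpha> + \<beta>) * t powr d * \<kappa> * \<bar>\<epsilon>\<bar> powr \<alpha> else 0)"
        unfolding cA cB n1 l1 cH I
        by (cases kink) (auto simp: c_def F_def kink_def algebra_simps)
      also have "\<dots> \<le> (\<Sum>i<5. c i t * (F i \<epsilon> - F i 0)) - b t * \<bar>\<epsilon>\<bar>"
      proof (cases kink)
        case True
        \<comment> \<open>A kink of exponent at most 1 is at least as steep as a linear one for
          small \<open>\<epsilon>\<close>, so all such exponents reduce to the linear kink.\<close>
        then have "\<bar>\<epsilon>\<bar> \<le> \<bar>\<epsilon>\<bar> powr \<alpha>"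
          using powr_mono' [of \<alpha> 1 "\<bar>\<epsilon>\<bar>"] elim by (simp add: kink_def)
        then have "1 / (\<alpha> + \<beta>) * t powr d * \<kappa> * \<bar>\<epsilon>\<bar> \<le> 1 / (\<alpha> + \<beta>) * t powr d * \<kappa> * \<bar>\<epsilon>\<bar> powr \<alpha>"
          using \<kappa> \<alpha> \<beta> by (intro mult_left_mono) auto
        then show ?thesis using True by (simp add: b_def)
      qed (simp add: b_def)
      finally show ?case using t(2) by (intro exI [of _ t]) simp
    qed
  qed
  have "b 1 \<ge> 0" using \<kappa> \<alpha> \<beta> by (simp add: b_def)
  moreover have "b 1 \<le> (\<Sum>i<5. c i 1 * D i)" "(\<Sum>i<5. c i 1 * D i) \<le> - b 1"
    using perturbation_slope [of "{..<5}" F D c b, OF F' c b ev] by blast+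
  \<comment> \<open>The slope lies between \<open>b 1\<close> and \<open>- b 1\<close> with
    \<open>b 1\<close> nonnegative. This forces the slope to be 0, and it rules out a genuine kink
    without a separate case.\<close>
  ultimately have S0: "(\<Sum>i<5. c i 1 * D i) = 0" by linarith
  have S: "(\<Sum>i<5. c i 1 * D i) = a1 / p * P' + b1 / (p * m) * ((k + 1) * (K * P'))
      - \<Lambda>1 / r * (vmeas G x * h1 x * (r * (\<bar>u x\<bar> powr (r - 2) * u x))) - vmeas G x * g1 x
      - 1 / (\<alpha> + \<beta>) * (\<kappa> * (\<alpha> * (\<bar>u x\<bar> powr (\<alpha> - 2) * u x)))"
    unfolding I by (simp add: c_def D_def)
  have "a1 / p * P' = - a1 * (vmeas G x * graph_laplacian G p u x)"
    using p by (simp add: P'_def)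
  moreover have "b1 / (p * m) * ((k + 1) * (K * P')) = - b1 * K * (vmeas G x * graph_laplacian G p u x)"
  proof -
    have "m \<noteq> 0" using k by (simp add: m_def)
    then show ?thesis using p unfolding P'_def m_def [symmetric] by simp
  qed
  moreover have "\<Lambda>1 / r * (vmeas G x * h1 x * (r * (\<bar>u x\<bar> powr (r - 2) * u x)))
      = vmeas G x * (\<Lambda>1 * h1 x * (\<bar>u x\<bar> powr (r - 2) * u x))"
    using r by simp
  moreover have "1 / (\<alpha> + \<beta>) * (\<kappa> * (\<alpha> * (\<bar>u x\<bar> powr (\<alpha> - 2) * u x)))
      = vmeas G x * (\<alpha> / (\<alpha> + \<beta>) * h2 x * (\<bar>u x\<bar> powr (\<alpha> - 2) * u x) * \<bar>v x\<bar> powr \<beta>)"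
    by (simp add: \<kappa>_def)
  ultimately
  have "vmeas G x * (- (a1 + b1 * K) * graph_laplacian G p u x)
      = vmeas G x * (\<Lambda>1 * h1 x * (\<bar>u x\<bar> powr (r - 2) * u x)
          + \<alpha> / (\<alpha> + \<beta>) * h2 x * (\<bar>u x\<bar> powr (\<alpha> - 2) * u x) * \<bar>v x\<bar> powr \<beta> + g1 x)"
    using S0 unfolding S by (simp add: algebra_simps)
  then show ?thesis
    using mu p by (simp add: kirchhoff_def K_def W_norm_powr_self)
qed

lemma second_equation:
  assumes x: "x \<in> \<Omega>"
    and min: "\<And>\<theta>. \<theta> > 0 \<Longrightarrow> \<forall>\<^sub>F \<epsilon> in at 0. \<exists>t>0. \<bar>t - 1\<bar> < \<theta> \<and>
      \<phi> (su t u) (sv t v) \<le> \<phi> (su t u) (sv t (v(x := v x + \<epsilon>)))"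
  shows "- kirchhoff a2 b2 k (W_norm G \<Omega> q v powr q) * graph_laplacian G q v x =
          \<Lambda>2 * h3 x * (\<bar>v x\<bar> powr (r - 2) * v x)
          + \<beta> / (\<alpha> + \<beta>) * h2 x * \<bar>u x\<bar> powr \<alpha> * (\<bar>v x\<bar> powr (\<beta> - 2) * v x) + g2 x"
proof -
  interpret sw: kirchhoff_system G \<Omega> q p r \<beta> \<alpha> k a2 a1 b2 b1 \<Lambda>2 \<Lambda>1 h3 h2 h1 g2 g1
    by (rule swapped)
  have eq: "sw.su = sv" "sw.sv = su" by (auto simp: sw.su_def sw.sv_def su_def sv_def fun_eq_iff)
  show ?thesis
    using sw.first_equation [of x v u, OF x] min
    by (simp add: eq energy_swap add.commute mult_ac)
qed

end

section \<open>Scaling and coercivity\<close>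

lemma powr_le_linear:
  fixes c e \<epsilon> :: real
  assumes e: "0 < e" "e < 1" and c: "c \<ge> 0" and \<epsilon>: "\<epsilon> > 0"
  shows "\<exists>K. \<forall>x\<ge>0. c * x powr e \<le> \<epsilon> * x + K"
proof -
  \<comment> \<open>Beyond \<open>x0\<close> the linear term wins, below it the constant does. Using
    \<open>c + 1\<close> instead of \<open>c\<close> keeps \<open>x0\<close> positive when
    \<open>c = 0\<close>.\<close>
  define x0 where "x0 = ((c + 1) / \<epsilon>) powr (1 / (1 - e))"
  have x0: "x0 > 0" "x0 powr (1 - e) = (c + 1) / \<epsilon>"
    using e c \<epsilon> by (auto simp: x0_def powr_powr)
  have "c * x powr e \<le> \<epsilon> * x + c * x0 powr e" if x: "x \<ge> 0" for x
  proof (cases "x \<le> x0")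
    case True
    then have "c * x powr e \<le> c * x0 powr e" using e c x by (intro mult_left_mono powr_mono2) auto
    then show ?thesis using \<epsilon> x by (smt (verit) mult_nonneg_nonneg)
  next
    case False
    then have "x0 powr (1 - e) \<le> x powr (1 - e)" using e x0 by (intro powr_mono2) auto
    then have "c \<le> \<epsilon> * x powr (1 - e)" using \<epsilon> by (simp add: x0 field_simps)
    then have "c * x powr e \<le> \<epsilon> * x powr (1 - e) * x powr e" by (rule mult_right_mono) simp
    also have "\<dots> = \<epsilon> * x" using x by (simp add: mult.assoc powr_add [symmetric])
    finally show ?thesis using c by (smt (verit) mult_nonneg_nonneg powr_ge_zero)
  qed
  then show ?thesis by blast
qed

lemma (in finite_domain) abs_le_dirichlet:
  assumes "embedding_constant G \<Omega> p C" and u: "u \<in> Cc_space \<Omega>"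
  shows "\<bar>u x\<bar> \<le> C * dirichlet G \<Omega> p u powr (1 / p)"
proof -
  have C: "C > 0" and le: "max_norm \<Omega> u \<le> C * dirichlet G \<Omega> p u powr (1 / p)"
    using assms by (auto simp: embedding_constant_def W_norm_def dirichlet_def)
  show ?thesis
  proof (cases "x \<in> \<Omega>")
    case True
    then have "\<bar>u x\<bar> \<le> max_norm \<Omega> u"
      using fin by (auto simp: max_norm_def intro!: Max_ge)
    then show ?thesis using le by simp
  next
    case False
    then show ?thesis using u C by (simp add: Cc_space_def)
  qed
qed

lemma continuous_on_eval_fst: "continuous_on S (\<lambda>w :: ('v \<Rightarrow> real) \<times> 'b::topological_space. fst w x)"
  and continuous_on_eval_snd: "continuous_on T (\<lambda>w :: 'b::topological_space \<times> ('v \<Rightarrow> real). snd w x)"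
  by (rule continuous_on_product_then_coordinatewise, intro continuous_intros)+

context kirchhoff_system
begin

text \<open>\<open>crit\<close> is the derivative at \<open>t = 1\<close> of the energy along the
  curve through the pair, and \<open>conc\<close> is the value of \<open>curv\<close> there. Because
  of the absolute values, \<open>conc\<close> is only an upper bound for the second derivative of
  the energy, but its sign can change just once along a curve.\<close>

definition "crit u v = cA u v + m * cB u v - r / p * n1 u - r / q * n2 v - 1 / p * l1 u - 1 / q * l2 v
  - d * cH u v"

definition "conc u v = m * (m - 1) * cB u v + r / p * (1 - r / p) * n1 u + r / q * (1 - r / q) * n2 v
  + 1 / p * (1 - 1 / p) * \<bar>l1 u\<bar> + 1 / q * (1 - 1 / q) * \<bar>l2 v\<bar> - d * (d - 1) * cH u v"

definition "lower u v = cA u v + cB u v - n1 u - n2 v - \<bar>l1 u\<bar> - \<bar>l2 v\<bar> - cH u v"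

lemma m_ge_1: "1 \<le> m" using k by (simp add: m_def)

text \<open>Both \<open>\<alpha> / p\<close> and \<open>\<beta> / q\<close> can only shrink when
  their denominators are replaced by \<open>max p q\<close>; hence the growth assumption is stated
  with the maximum.\<close>

lemma m_less_d: "m < d"
proof -
  have "m * max p q < \<alpha> + \<beta>" using super_p super_q by (simp add: m_def max_def)
  then have "m < (\<alpha> + \<beta>) / max p q" using p by (simp add: pos_less_divide_eq less_max_iff_disj)
  also have "\<dots> \<le> d"
    unfolding d_def add_divide_distrib using p q \<alpha> \<beta> by (intro add_mono divide_left_mono) (auto simp: max_def)
  finally show ?thesis .
qed

lemma h_nonneg: "x \<in> \<Omega> \<Longrightarrow> 0 \<le> h1 x" "x \<in> \<Omega> \<Longrightarrow> 0 \<le> h2 x" "x \<in> \<Omega> \<Longrightarrow> 0 \<le> h3 x"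
  using h by (auto intro: less_imp_le)

lemma n1_nonneg: "0 \<le> n1 u" and n2_nonneg: "0 \<le> n2 v" and cA_nonneg: "0 \<le> cA u v"
  and cB_nonneg: "0 \<le> cB u v" and cH_nonneg: "0 \<le> cH u v"
proof -
  show "0 \<le> n1 u" "0 \<le> n2 v" "0 \<le> cH u v"
    using \<Lambda>1 \<Lambda>2 \<alpha> \<beta> r h_nonneg unfolding n1_def n2_def cH_def
    by (intro mult_nonneg_nonneg gintegral_nonneg; simp)+
  show "0 \<le> cA u v" "0 \<le> cB u v"
    using p q a1 a2 b1 b2 k by (auto simp: cA_def cB_def m_def dirichlet_nonneg)
qed

text \<open>The positive weights \<open>h1\<close> and \<open>h3\<close> give
  \<open>n1 + n2 > 0\<close> for a nonzero pair, which is what makes \<open>curv\<close> strictly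
  monotone.\<close>

lemma fiber:
  assumes x: "u x \<noteq> 0 \<or> v x \<noteq> 0" "x \<in> \<Omega>"
  shows "fiber m d (r / p) (r / q) (1 / p) (1 / q) (cA u v) (cB u v) (cH u v) (n1 u) (n2 v)
     \<bar>l1 u\<bar> \<bar>l2 v\<bar> (l1 u) (l2 v)"
proof
  have "n1 u > 0" if "u x \<noteq> 0"
    unfolding n1_def using that x(2) \<Lambda>1 r h h_nonneg by (intro mult_pos_pos gintegral_pos [of x]) auto
  moreover have "n2 v > 0" if "v x \<noteq> 0"
    unfolding n2_def using that x(2) \<Lambda>2 r h h_nonneg by (intro mult_pos_pos gintegral_pos [of x]) auto
  ultimately show "0 < n1 u + n2 v"
    using x n1_nonneg [of u] n2_nonneg [of v] by linarith
qed (use p q r rp rq m_ge_1 m_less_d n1_nonneg n2_nonneg cA_nonneg cB_nonneg cH_nonneg in auto)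

lemma su_1 [simp]: "su 1 u = u" and sv_1 [simp]: "sv 1 v = v"
  by (simp_all add: su_def sv_def)

lemma su_Cc: "u \<in> Cc_space \<Omega> \<Longrightarrow> su t u \<in> Cc_space \<Omega>" and sv_Cc: "v \<in> Cc_space \<Omega> \<Longrightarrow> sv t v \<in> Cc_space \<Omega>"
  by (simp_all add: su_def sv_def Cc_space_def)

lemma continuous_su: "continuous_on S (su t)" and continuous_sv: "continuous_on S (sv t)"
  unfolding su_def sv_def
  by (rule continuous_on_coordinatewise_then_product, intro continuous_intros)+

lemma continuous_coefficients:
  "continuous_on UNIV (\<lambda>w. cA (fst w) (snd w))" "continuous_on UNIV (\<lambda>w. cB (fst w) (snd w))"
  "continuous_on UNIV (\<lambda>w. n1 (fst w))" "continuous_on UNIV (\<lambda>w. n2 (snd w))"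
  "continuous_on UNIV (\<lambda>w. l1 (fst w))" "continuous_on UNIV (\<lambda>w. l2 (snd w))"
  "continuous_on UNIV (\<lambda>w. cH (fst w) (snd w))"
proof -
  have P: "continuous_on UNIV (\<lambda>w. dirichlet G \<Omega> p (fst w))" "continuous_on UNIV (\<lambda>w. dirichlet G \<Omega> q (snd w))"
    using p q by (auto intro!: continuous_on_compose2 [OF continuous_dirichlet] continuous_on_fst
        continuous_on_snd continuous_on_id)
  then show "continuous_on UNIV (\<lambda>w. cA (fst w) (snd w))" "continuous_on UNIV (\<lambda>w. cB (fst w) (snd w))"
    unfolding cA_def cB_def using m_ge_1 p q by (auto intro!: continuous_intros continuous_on_powr' simp: dirichlet_nonneg)
  have pw: "continuous_on UNIV (\<lambda>w. \<bar>fst w x\<bar> powr c)" "continuous_on UNIV (\<lambda>w. \<bar>snd w x\<bar> powr c)"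
    if "c > 0" for c :: real and x :: 'v
    using that by (auto intro!: continuous_on_powr' continuous_on_rabs continuous_on_eval_fst continuous_on_eval_snd continuous_on_const)
  show "continuous_on UNIV (\<lambda>w. n1 (fst w))" "continuous_on UNIV (\<lambda>w. n2 (snd w))"
    "continuous_on UNIV (\<lambda>w. cH (fst w) (snd w))"
    unfolding n1_def n2_def cH_def gintegral_def using r \<alpha> \<beta>
    by (intro continuous_on_sum continuous_on_mult continuous_on_const pw; simp)+
  show "continuous_on UNIV (\<lambda>w. l1 (fst w))" "continuous_on UNIV (\<lambda>w. l2 (snd w))"
    unfolding l1_def l2_def gintegral_def
    by (intro continuous_on_sum continuous_on_mult continuous_on_const continuous_on_eval_fst continuous_on_eval_snd)+
qed

lemma continuous_energy: "continuous_on UNIV (\<lambda>w. \<phi> (fst w) (snd w))"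
  and continuous_crit: "continuous_on UNIV (\<lambda>w. crit (fst w) (snd w))"
  and continuous_conc: "continuous_on UNIV (\<lambda>w. conc (fst w) (snd w))"
  unfolding energy_eq crit_def conc_def
  by (intro continuous_on_add continuous_on_diff continuous_on_mult continuous_on_const continuous_on_rabs
      continuous_coefficients)+

text \<open>By the pointwise embedding these terms grow like the powers \<open>r / p\<close> and
  \<open>1 / p\<close> of the Dirichlet energy. Both exponents are below 1, so any small multiple of
  the energy absorbs them up to a constant.\<close>

lemma sublinear_terms:
  assumes emb: "embedding_constant G \<Omega> p C" and \<epsilon>: "\<epsilon> > 0"
  shows "\<exists>K. \<forall>u\<in>Cc_space \<Omega>. n1 u + \<bar>l1 u\<bar> \<le> \<epsilon> * dirichlet G \<Omega> p u + K"
proof -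
  have C: "C > 0" using emb by (simp add: embedding_constant_def)
  define N where "N = \<Lambda>1 / r * gintegral G \<Omega> h1 * C powr r"
  define L where "L = gintegral G \<Omega> (\<lambda>x. \<bar>g1 x\<bar>) * C"
  have N: "N \<ge> 0" unfolding N_def using \<Lambda>1 r h_nonneg by (intro mult_nonneg_nonneg gintegral_nonneg) auto
  have L: "L \<ge> 0" unfolding L_def using C by (intro mult_nonneg_nonneg gintegral_nonneg) auto
  obtain K1 where K1: "\<And>x. x \<ge> 0 \<Longrightarrow> N * x powr (r / p) \<le> \<epsilon> / 2 * x + K1"
    using powr_le_linear [of "r / p" N "\<epsilon> / 2"] N \<epsilon> r p rp by auto
  obtain K2 where K2: "\<And>x. x \<ge> 0 \<Longrightarrow> L * x powr (1 / p) \<le> \<epsilon> / 2 * x + K2"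
    using powr_le_linear [of "1 / p" L "\<epsilon> / 2"] L \<epsilon> p by auto
  have "n1 u + \<bar>l1 u\<bar> \<le> \<epsilon> * dirichlet G \<Omega> p u + (K1 + K2)" if u: "u \<in> Cc_space \<Omega>" for u
  proof -
    let ?P = "dirichlet G \<Omega> p u"
    have le: "\<bar>u x\<bar> \<le> C * ?P powr (1 / p)" for x by (rule abs_le_dirichlet [OF emb u])
    have "n1 u \<le> \<Lambda>1 / r * gintegral G \<Omega> (\<lambda>x. h1 x * (C * ?P powr (1 / p)) powr r)"
      unfolding n1_def using \<Lambda>1 r h_nonneg le
      by (intro mult_left_mono gintegral_mono powr_mono2) auto
    also have "\<dots> = N * ?P powr (r / p)"
      using C by (simp add: N_def gintegral_def sum_distrib_left sum_distrib_right powr_mult powr_powr mult_ac)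
    also have "\<dots> \<le> \<epsilon> / 2 * ?P + K1" by (rule K1 [OF dirichlet_nonneg])
    finally have n1: "n1 u \<le> \<epsilon> / 2 * ?P + K1" .
    have "\<bar>l1 u\<bar> \<le> (\<Sum>x\<in>\<Omega>. \<bar>vmeas G x * (g1 x * u x)\<bar>)"
      unfolding l1_def gintegral_def by (rule sum_abs)
    also have "\<dots> = gintegral G \<Omega> (\<lambda>x. \<bar>g1 x\<bar> * \<bar>u x\<bar>)"
      unfolding gintegral_def using dom vmeas_pos by (intro sum.cong) (auto simp: abs_mult intro!: abs_of_pos)
    also have "\<dots> \<le> gintegral G \<Omega> (\<lambda>x. \<bar>g1 x\<bar> * (C * ?P powr (1 / p)))"
      by (intro gintegral_mono mult_left_mono le) auto
    also have "\<dots> = L * ?P powr (1 / p)"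
      by (simp add: L_def gintegral_def sum_distrib_left sum_distrib_right mult_ac)
    also have "\<dots> \<le> \<epsilon> / 2 * ?P + K2" by (rule K2 [OF dirichlet_nonneg])
    finally show ?thesis using n1 by simp
  qed
  then show ?thesis by blast
qed

end

text \<open>Of the smallness condition only this is retained: the worst-case energy is at least
  \<delta> on one sphere of the sum norm.\<close>

locale kirchhoff_ridge = kirchhoff_system G \<Omega> p q r \<alpha> \<beta> k a1 a2 b1 b2 \<Lambda>1 \<Lambda>2 h1 h2 h3 g1 g2
  for G :: "'v wgraph" and \<Omega> p q r \<alpha> \<beta> k a1 a2 b1 b2 \<Lambda>1 \<Lambda>2 h1 h2 h3 g1 g2 +
  fixes Cp Cq s0 \<delta> :: real
  assumes embp: "embedding_constant G \<Omega> p Cp" and embq: "embedding_constant G \<Omega> q Cq"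
    and nonempty: "\<Omega> \<noteq> {}" and s0: "s0 > 0" and \<delta>: "\<delta> > 0"
    and ridge: "\<And>u v. u \<in> Cc_space \<Omega> \<Longrightarrow> v \<in> Cc_space \<Omega> \<Longrightarrow>
      W_norm G \<Omega> p u + W_norm G \<Omega> q v = s0 \<Longrightarrow> \<delta> \<le> lower u v"
begin

lemma W_norm_pos:
  assumes "w \<in> Cc_space \<Omega>" "w x \<noteq> 0" "l = p \<or> l = q"
  shows "W_norm G \<Omega> l w > 0"
proof -
  obtain C where "embedding_constant G \<Omega> l C" using embp embq assms(3) by auto
  from abs_le_dirichlet [OF this assms(1), of x] have "dirichlet G \<Omega> l w powr (1 / l) \<noteq> 0"
    using assms(2) by auto
  then show ?thesis by (simp add: W_norm_def dirichlet_def)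
qed

lemma W_norm_su: "t \<ge> 0 \<Longrightarrow> W_norm G \<Omega> p (su t u) = t powr (1 / p) * W_norm G \<Omega> p u"
  and W_norm_sv: "t \<ge> 0 \<Longrightarrow> W_norm G \<Omega> q (sv t v) = t powr (1 / q) * W_norm G \<Omega> q v"
  using dirichlet_scale [of "t powr (1 / p)" p u] dirichlet_scale [of "t powr (1 / q)" q v] p q
  by (simp_all add: W_norm_def dirichlet_def su_def sv_def powr_mult powr_powr)

text \<open>Along a nonzero curve the sum of the norms runs continuously from 0 to arbitrarily large
  values, so it meets the sphere.\<close>

lemma ex_ridge_time:
  assumes uv: "u \<in> Cc_space \<Omega>" "v \<in> Cc_space \<Omega>" and x: "u x \<noteq> 0 \<or> v x \<noteq> 0"
  shows "\<exists>t>0. \<delta> \<le> lower (su t u) (sv t v)"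
proof -
  define f where "f t = t powr (1 / p) * W_norm G \<Omega> p u + t powr (1 / q) * W_norm G \<Omega> q v" for t
  have cont: "continuous_on {0..T} f" for T
    unfolding f_def using p q by (intro continuous_intros continuous_on_powr') auto
  have "\<exists>T\<ge>0. s0 \<le> f T"
  proof -
    have T: "\<exists>T\<ge>0. s0 \<le> T powr (1 / l) * w" if "w > 0" "l > 1" for l w :: real
      using that s0 by (intro exI [of _ "(s0 / w) powr l"]) (simp add: powr_powr)
    show ?thesis
    proof (cases "u x \<noteq> 0")
      case True
      then obtain T where "T \<ge> 0" "s0 \<le> T powr (1 / p) * W_norm G \<Omega> p u"
        using T [OF W_norm_pos [OF uv(1)]] p by blast
      then show ?thesis using W_norm_nonneg [of q v] unfolding f_def
        by (metis add_increasing2 mult_nonneg_nonneg powr_ge_zero)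
    next
      case False
      then obtain T where "T \<ge> 0" "s0 \<le> T powr (1 / q) * W_norm G \<Omega> q v"
        using T [OF W_norm_pos [OF uv(2)]] q x by blast
      then show ?thesis using W_norm_nonneg [of p u] unfolding f_def
        by (metis add_increasing mult_nonneg_nonneg powr_ge_zero)
    qed
  qed
  then obtain T where T: "T \<ge> 0" "s0 \<le> f T" by blast
  obtain t where t: "0 \<le> t" "f t = s0"
    using IVT' [of f 0 s0 T] T s0 cont by (auto simp: f_def)
  have "t \<noteq> 0" using t s0 by (auto simp: f_def)
  moreover have "\<delta> \<le> lower (su t u) (sv t v)"
    using ridge [OF su_Cc [OF uv(1)] sv_Cc [OF uv(2)]] t by (simp add: W_norm_su W_norm_sv f_def)
  ultimately show ?thesis using t by (intro exI [of _ t]) auto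
qed

section \<open>The curve through a fixed nonzero pair\<close>

context
  fixes u v x
  assumes uv: "u \<in> Cc_space \<Omega>" "v \<in> Cc_space \<Omega>" and x: "u x \<noteq> 0 \<or> v x \<noteq> 0"
begin

lemma x_in: "x \<in> \<Omega>" using uv x by (auto simp: Cc_space_def)

interpretation F: fiber m d "r / p" "r / q" "1 / p" "1 / q" "cA u v" "cB u v" "cH u v" "n1 u" "n2 v"
     "\<bar>l1 u\<bar>" "\<bar>l2 v\<bar>" "l1 u" "l2 v"
  using x x_in by (rule fiber)

lemma F_up: "t > 0 \<Longrightarrow> F.up t = \<phi> (su t u) (sv t v)"
  by (simp add: F.up_def energy_eq scale mult_ac)

lemma F_low: "t > 0 \<Longrightarrow> F.low t = lower (su t u) (sv t v)"
  by (simp add: F.low_def lower_def scale abs_mult mult_ac)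

lemma F_up': 
  assumes t: "t > 0"
  shows "t * F.up' t = crit (su t u) (sv t v)"
proof -
  have s: "t * t powr (c - 1) = t powr c" for c using powr_mult_base [of t "c - 1"] t by simp
  have "t * F.up' t = t * cA u v + m * cB u v * (t * t powr (m - 1)) - r / p * n1 u * (t * t powr (r / p - 1))
     - r / q * n2 v * (t * t powr (r / q - 1)) - 1 / p * l1 u * (t * t powr (1 / p - 1))
     - 1 / q * l2 v * (t * t powr (1 / q - 1)) - d * cH u v * (t * t powr (d - 1))"
    unfolding F.up'_def by (simp add: algebra_simps)
  also have "\<dots> = crit (su t u) (sv t v)"
    unfolding s crit_def scale [OF t] by (simp add: algebra_simps)
  finally show ?thesis .
qed

lemma F_curv: 
  assumes t: "t > 0"
  shows "t powr d * F.curv t = conc (su t u) (sv t v)"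
proof -
  have s: "t powr d * t powr (c - d) = t powr c" for c by (simp add: powr_add [symmetric])
  have "t powr d * F.curv t = m * (m - 1) * cB u v * (t powr d * t powr (m - d))
     + r / p * (1 - r / p) * n1 u * (t powr d * t powr (r / p - d))
     + r / q * (1 - r / q) * n2 v * (t powr d * t powr (r / q - d))
     + 1 / p * (1 - 1 / p) * \<bar>l1 u\<bar> * (t powr d * t powr (1 / p - d))
     + 1 / q * (1 - 1 / q) * \<bar>l2 v\<bar> * (t powr d * t powr (1 / q - d)) - d * (d - 1) * cH u v * t powr d"
    unfolding F.curv_def by (simp add: algebra_simps)
  also have "\<dots> = conc (su t u) (sv t v)"
    unfolding s conc_def scale [OF t] abs_mult by (simp add: algebra_simps)
  finally show ?thesis .
qed

lemma sign_F_up': "t > 0 \<Longrightarrow> F.up' t > 0 \<longleftrightarrow> crit (su t u) (sv t v) > 0"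
  "t > 0 \<Longrightarrow> F.up' t < 0 \<longleftrightarrow> crit (su t u) (sv t v) < 0"
  "t > 0 \<Longrightarrow> F.up' t = 0 \<longleftrightarrow> crit (su t u) (sv t v) = 0"
  by (simp_all add: F_up' [symmetric] zero_less_mult_iff mult_less_0_iff)

lemma sign_F_curv: "t > 0 \<Longrightarrow> F.curv t < 0 \<longleftrightarrow> conc (su t u) (sv t v) < 0"
  "t > 0 \<Longrightarrow> F.curv t \<le> 0 \<longleftrightarrow> conc (su t u) (sv t v) \<le> 0"
  by (simp_all add: F_curv [symmetric] mult_less_0_iff mult_le_0_iff)

lemma conc_mono:
  assumes "0 < s" "s \<le> t" "conc (su s u) (sv s v) < 0"
  shows "conc (su t u) (sv t v) < 0"
  using F.curv_strict_decreasing [of s t] sign_F_curv(1) [of s] sign_F_curv(1) [of t] assms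
  by (cases "s = t") auto

text \<open>Strict concavity is an open condition, so it already holds slightly before time 1. By
  \<open>conc_mono\<close> it then persists, which yields a two-sided window around 1.\<close>

lemma conc_neg_before_1:
  assumes "conc u v < 0" "\<theta> > 0"
  shows "\<exists>\<eta>>0. \<eta> < \<theta> \<and> \<eta> < 1 \<and> conc (su (1 - \<eta>) u) (sv (1 - \<eta>) v) < 0"
proof -
  have "F.curv 1 < 0" using sign_F_curv(1) [of 1] assms by simp
  moreover have "(F.curv \<longlongrightarrow> F.curv 1) (at 1)"
    using F.continuous_curv by (simp add: continuous_on_eq_continuous_at isCont_def)
  ultimately have "\<forall>\<^sub>F t in at 1. F.curv t < 0" by (auto dest: order_tendstoD)
  then obtain e where e: "e > 0" "\<And>t. t \<noteq> 1 \<Longrightarrow> dist t 1 < e \<Longrightarrow> F.curv t < 0"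
    unfolding eventually_at by auto
  define \<eta> where "\<eta> = min (min \<theta> 1) e / 2"
  have \<eta>: "0 < \<eta>" "\<eta> < \<theta>" "\<eta> < 1" "\<eta> < e" using assms e by (auto simp: \<eta>_def)
  then have "F.curv (1 - \<eta>) < 0" by (intro e) (auto simp: dist_real_def)
  then show ?thesis using \<eta> sign_F_curv(1) [of "1 - \<eta>"] by (intro exI [of _ \<eta>]) auto
qed

lemma ex_crit_between:
  assumes "0 < s" "s < t" "crit (su s u) (sv s v) > 0" "crit (su t u) (sv t v) < 0"
  shows "\<exists>z. s \<le> z \<and> z \<le> t \<and> crit (su z u) (sv z v) = 0"
proof -
  have "continuous_on {s..t} F.up'"
    by (rule continuous_on_subset [OF F.continuous_up']) (use assms in auto)
  then have "\<exists>z\<ge>s. z \<le> t \<and> F.up' z = 0"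
    using assms sign_F_up'(1) [of s] sign_F_up'(2) [of t] by (intro IVT2') auto
  then obtain z where "z \<ge> s" "z \<le> t" "F.up' z = 0" by blast
  then show ?thesis using sign_F_up'(3) [of z] assms by auto
qed

lemma ex_crit:
  assumes "cH u v > 0"
  shows "\<exists>t>0. crit (su t u) (sv t v) = 0 \<and> conc (su t u) (sv t v) \<le> 0"
proof -
  obtain t0 where "t0 > 0" "\<delta> \<le> lower (su t0 u) (sv t0 v)" using ex_ridge_time [OF uv x] by blast
  then obtain t where "t > 0" "F.up' t = 0" "F.curv t \<le> 0"
    using F.ex_critical [OF assms, of t0] F_low [of t0] \<delta> by auto
  then show ?thesis using sign_F_up'(3) [of t] sign_F_curv(2) [of t] by auto
qed

text \<open>The crossing of the ridge supplies the time with positive \<open>low\<close> on which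
  the analysis of \<open>fiber\<close> rests. Nondegeneracy and the energy bound are therefore
  automatic for nonzero pairs.\<close>

lemma crit_point:
  assumes "crit u v = 0" "conc u v \<le> 0"
  shows "conc u v < 0" "\<delta> \<le> \<phi> u v"
    "\<And>t. t > 0 \<Longrightarrow> conc (su t u) (sv t v) \<le> 0 \<Longrightarrow> \<phi> (su t u) (sv t v) \<le> \<phi> u v"
    "\<And>t. 0 < t \<Longrightarrow> t < 1 \<Longrightarrow> conc (su t u) (sv t v) \<le> 0 \<Longrightarrow> crit (su t u) (sv t v) > 0"
    "\<And>t. 1 < t \<Longrightarrow> conc (su t u) (sv t v) \<le> 0 \<Longrightarrow> crit (su t u) (sv t v) < 0"
proof -
  obtain t0 where t0: "t0 > 0" "\<delta> \<le> lower (su t0 u) (sv t0 v)" using ex_ridge_time [OF uv x] by blast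
  then have low: "F.low t0 > 0" using F_low [of t0] \<delta> by simp
  have c: "F.up' 1 = 0" "F.curv 1 \<le> 0"
    using sign_F_up'(3) [of 1] sign_F_curv(2) [of 1] assms by auto
  show "conc u v < 0" using F.curv_neg [OF t0(1) low c] sign_F_curv(1) [of 1] by simp
  show "\<delta> \<le> \<phi> u v" using F.low_le_up_1 [OF t0(1) low c] t0 F_low [of t0] F_up [of 1] by simp
  note sgn = F.up'_sign [OF t0(1) low c]
  show "\<And>t. t > 0 \<Longrightarrow> conc (su t u) (sv t v) \<le> 0 \<Longrightarrow> \<phi> (su t u) (sv t v) \<le> \<phi> u v"
    using sgn(3) sign_F_curv(2) F_up F_up [of 1] by force
  show "\<And>t. 0 < t \<Longrightarrow> t < 1 \<Longrightarrow> conc (su t u) (sv t v) \<le> 0 \<Longrightarrow> crit (su t u) (sv t v) > 0"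
    using sgn(1) sign_F_curv(2) sign_F_up'(1) by blast
  show "\<And>t. 1 < t \<Longrightarrow> conc (su t u) (sv t v) \<le> 0 \<Longrightarrow> crit (su t u) (sv t v) < 0"
    using sgn(2) sign_F_curv(2) sign_F_up'(2) by (meson less_trans zero_less_one)
qed

end

end

section \<open>Existence of minimizers\<close>

context kirchhoff_ridge
begin

text \<open>The concave part of a Nehari manifold adapted to these curves. The weak inequalities
  make it closed. The zero pair satisfies all conditions but the energy bound, which is there to
  exclude it; nonzero pairs meet that bound anyway.\<close>

definition nehari :: "(('v \<Rightarrow> real) \<times> ('v \<Rightarrow> real)) set" where
  "nehari = {w. fst w \<in> Cc_space \<Omega> \<and> snd w \<in> Cc_space \<Omega> \<and>
     crit (fst w) (snd w) = 0 \<and> conc (fst w) (snd w) \<le> 0 \<and> \<delta> \<le> \<phi> (fst w) (snd w)}"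

lemma energy_zero: "\<phi> (\<lambda>_. 0) (\<lambda>_. 0) = 0"
  by (simp add: energy_eq n1_def n2_def l1_def l2_def cH_def cA_def cB_def gintegral_def dirichlet_def
      grad_abs_def grad_form_def)

lemma nonzero_if_energy:
  assumes "\<phi> u v \<noteq> 0"
  shows "\<exists>x. u x \<noteq> 0 \<or> v x \<noteq> 0"
proof (rule ccontr)
  assume "\<nexists>x. u x \<noteq> 0 \<or> v x \<noteq> 0"
  then have "u = (\<lambda>_. 0)" "v = (\<lambda>_. 0)" by auto
  then show False using assms energy_zero by simp
qed

lemma nehariI:
  assumes "u \<in> Cc_space \<Omega>" "v \<in> Cc_space \<Omega>" "u x \<noteq> 0 \<or> v x \<noteq> 0" "crit u v = 0" "conc u v \<le> 0"
  shows "(u, v) \<in> nehari"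
  using crit_point(2) [OF assms] assms by (simp add: nehari_def)

lemma nehariE:
  assumes "(u, v) \<in> nehari"
  obtains x where "u \<in> Cc_space \<Omega>" "v \<in> Cc_space \<Omega>" "u x \<noteq> 0 \<or> v x \<noteq> 0" "crit u v = 0" "conc u v \<le> 0"
    "\<delta> \<le> \<phi> u v"
  using assms nonzero_if_energy [of u v] \<delta> by (auto simp: nehari_def)

lemma nehari_nonempty: "nehari \<noteq> {}"
proof -
  obtain x where x: "x \<in> \<Omega>" using nonempty by blast
  \<comment> \<open>The same bump serves for both components, so that their supports overlap and the
    coupling is positive.\<close>
  define u :: "'v \<Rightarrow> real" where "u = (\<lambda>y. if y = x then 1 else 0)"
  have u: "u \<in> Cc_space \<Omega>" "u x \<noteq> 0 \<or> u x \<noteq> 0" using x by (auto simp: u_def Cc_space_def)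
  have "gintegral G \<Omega> (\<lambda>y. h2 y * \<bar>u y\<bar> powr \<alpha> * \<bar>u y\<bar> powr \<beta>) > 0"
    using x h h_nonneg by (intro gintegral_pos [of x]) (auto simp: u_def)
  then have "cH u u > 0" using \<alpha> \<beta> by (simp add: cH_def)
  then obtain t where t: "t > 0" "crit (su t u) (sv t u) = 0" "conc (su t u) (sv t u) \<le> 0"
    using ex_crit [OF u(1) u(1) u(2)] by blast
  have "su t u x \<noteq> 0 \<or> sv t u x \<noteq> 0" using t u by (simp add: su_def)
  then have "(su t u, sv t u) \<in> nehari" using t u su_Cc sv_Cc by (intro nehariI) auto
  then show ?thesis by blast
qed

text \<open>On \<open>nehari\<close> one may subtract \<open>crit / d\<close> from the energy. This
  cancels the coupling and leaves a positive multiple of the Dirichlet terms, as in the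
  Ambrosetti-Rabinowitz argument.\<close>

lemma bounded_sublevel:
  "\<exists>R. \<forall>w\<in>nehari. \<phi> (fst w) (snd w) \<le> c \<longrightarrow>
     dirichlet G \<Omega> p (fst w) \<le> R \<and> dirichlet G \<Omega> q (snd w) \<le> R"
proof -
  interpret sw: kirchhoff_system G \<Omega> q p r \<beta> \<alpha> k a2 a1 b2 b1 \<Lambda>2 \<Lambda>1 h3 h2 h1 g2 g1
    by (rule swapped)
  have sw: "sw.n1 = n2" "sw.l1 = l2"
    by (auto simp: fun_eq_iff sw.n1_def n2_def sw.l1_def l2_def)
  have d1: "d > 1" using m_less_d m_ge_1 by simp
  \<comment> \<open>Half of the coefficient left on the Dirichlet energy, so that the other half
    survives the absorption.\<close>
  define \<epsilon>1 where "\<epsilon>1 = (1 - 1 / d) * a1 / (2 * p)"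
  define \<epsilon>2 where "\<epsilon>2 = (1 - 1 / d) * a2 / (2 * q)"
  have \<epsilon>: "\<epsilon>1 > 0" "\<epsilon>2 > 0" using d1 a1 a2 p q by (auto simp: \<epsilon>1_def \<epsilon>2_def)
  obtain K1 where K1: "\<And>u. u \<in> Cc_space \<Omega> \<Longrightarrow> n1 u + \<bar>l1 u\<bar> \<le> \<epsilon>1 * dirichlet G \<Omega> p u + K1"
    using sublinear_terms [OF embp \<epsilon>(1)] by blast
  obtain K2 where K2: "\<And>v. v \<in> Cc_space \<Omega> \<Longrightarrow> n2 v + \<bar>l2 v\<bar> \<le> \<epsilon>2 * dirichlet G \<Omega> q v + K2"
    using sw.sublinear_terms [OF embq \<epsilon>(2)] unfolding sw by blast
  have key: "\<epsilon>1 * dirichlet G \<Omega> p u + \<epsilon>2 * dirichlet G \<Omega> q v \<le> c + K1 + K2"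
    if uv: "(u, v) \<in> nehari" "\<phi> u v \<le> c" for u v
  proof -
    obtain x where u: "u \<in> Cc_space \<Omega>" and v: "v \<in> Cc_space \<Omega>" and crit: "crit u v = 0"
      using uv(1) by (rule nehariE)
    have "\<phi> u v = \<phi> u v - crit u v / d" using crit by simp
    also have "\<dots> = (1 - 1 / d) * cA u v + (1 - m / d) * cB u v - (1 - r / p / d) * n1 u
        - (1 - r / q / d) * n2 v - (1 - 1 / p / d) * l1 u - (1 - 1 / q / d) * l2 v"
      using d1 by (simp add: energy_eq crit_def field_simps)
    finally have eq: "\<phi> u v = \<dots>" .
    have n: "(1 - s / d) * n \<le> n" if "s \<ge> 0" "n \<ge> 0" for s n
      using that d1 by (simp add: algebra_simps)
    have l: "(1 - s / d) * n \<le> \<bar>n\<bar>" if "s \<ge> 0" "s \<le> 1" for s n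
    proof -
      have "(1 - s / d) * n \<le> \<bar>(1 - s / d) * n\<bar>" by (rule abs_ge_self)
      also have "\<dots> = (1 - s / d) * \<bar>n\<bar>" using that d1 by (simp add: abs_mult)
      also have "\<dots> \<le> \<bar>n\<bar>" by (rule n) (use that in auto)
      finally show ?thesis .
    qed
    have "(1 - r / p / d) * n1 u \<le> n1 u" "(1 - r / q / d) * n2 v \<le> n2 v"
      "(1 - 1 / p / d) * l1 u \<le> \<bar>l1 u\<bar>" "(1 - 1 / q / d) * l2 v \<le> \<bar>l2 v\<bar>"
      using p q r n1_nonneg n2_nonneg by (intro n l; simp)+
    moreover have "0 \<le> (1 - m / d) * cB u v" using m_less_d d1 cB_nonneg by simp
    ultimately have "(1 - 1 / d) * cA u v \<le> \<phi> u v + (n1 u + \<bar>l1 u\<bar>) + (n2 v + \<bar>l2 v\<bar>)"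
      unfolding eq by linarith
    also have "\<dots> \<le> c + (\<epsilon>1 * dirichlet G \<Omega> p u + K1) + (\<epsilon>2 * dirichlet G \<Omega> q v + K2)"
      using uv(2) K1 [OF u] K2 [OF v] by linarith
    finally have "(1 - 1 / d) * cA u v \<le> c + (\<epsilon>1 * dirichlet G \<Omega> p u + K1) + (\<epsilon>2 * dirichlet G \<Omega> q v + K2)" .
    moreover have "(1 - 1 / d) * cA u v = 2 * \<epsilon>1 * dirichlet G \<Omega> p u + 2 * \<epsilon>2 * dirichlet G \<Omega> q v"
      using p q by (simp add: cA_def \<epsilon>1_def \<epsilon>2_def distrib_left)
    ultimately show ?thesis by linarith
  qed
  define R where "R = max ((c + K1 + K2) / \<epsilon>1) ((c + K1 + K2) / \<epsilon>2)"
  have "dirichlet G \<Omega> p u \<le> R \<and> dirichlet G \<Omega> q v \<le> R" if "(u, v) \<in> nehari" "\<phi> u v \<le> c" for u v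
  proof -
    have "0 \<le> \<epsilon>1 * dirichlet G \<Omega> p u" "0 \<le> \<epsilon>2 * dirichlet G \<Omega> q v"
      using \<epsilon> dirichlet_nonneg by auto
    then have "\<epsilon>1 * dirichlet G \<Omega> p u \<le> c + K1 + K2" "\<epsilon>2 * dirichlet G \<Omega> q v \<le> c + K1 + K2"
      using key [OF that] by linarith+
    then have "dirichlet G \<Omega> p u \<le> (c + K1 + K2) / \<epsilon>1" "dirichlet G \<Omega> q v \<le> (c + K1 + K2) / \<epsilon>2"
      using \<epsilon> by (simp_all add: pos_le_divide_eq mult.commute)
    then show ?thesis by (simp add: R_def le_max_iff_disj)
  qed
  then show ?thesis by (intro exI [of _ R]) auto
qed

lemma attains_energy_inf:
  fixes S :: "(('v \<Rightarrow> real) \<times> ('v \<Rightarrow> real)) set"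
  assumes "closed S" "S \<noteq> {}"
    and R: "\<And>w. w \<in> S \<Longrightarrow> fst w \<in> Cc_space \<Omega> \<and> snd w \<in> Cc_space \<Omega> \<and>
      dirichlet G \<Omega> p (fst w) \<le> R \<and> dirichlet G \<Omega> q (snd w) \<le> R"
  shows "\<exists>w\<in>S. \<forall>z\<in>S. \<phi> (fst w) (snd w) \<le> \<phi> (fst z) (snd z)"
proof -
  have C: "Cp > 0" "Cq > 0" using embp embq by (auto simp: embedding_constant_def)
  let ?B = "{u \<in> Cc_space \<Omega>. \<forall>x. \<bar>u x\<bar> \<le> Cp * R powr (1 / p)} \<times>
    {v \<in> Cc_space \<Omega>. \<forall>x. \<bar>v x\<bar> \<le> Cq * R powr (1 / q)}"
  have "S \<subseteq> ?B"
  proof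
    fix w assume w: "w \<in> S"
    have "\<bar>fst w x\<bar> \<le> Cp * R powr (1 / p)" for x
      by (rule order_trans [OF abs_le_dirichlet [OF embp]])
        (use R [OF w] C p dirichlet_nonneg in \<open>auto intro!: mult_left_mono powr_mono2\<close>)
    moreover have "\<bar>snd w x\<bar> \<le> Cq * R powr (1 / q)" for x
      by (rule order_trans [OF abs_le_dirichlet [OF embq]])
        (use R [OF w] C q dirichlet_nonneg in \<open>auto intro!: mult_left_mono powr_mono2\<close>)
    ultimately show "w \<in> ?B" using R [OF w] by (auto simp: mem_Times_iff)
  qed
  moreover have "compact (S \<inter> ?B)"
    by (intro closed_Int_compact assms compact_Times compact_bounded_Cc_space)
  ultimately have "compact S" by (simp add: Int_absorb2)
  then show ?thesis
    using continuous_attains_inf [of S "\<lambda>w. \<phi> (fst w) (snd w)"] assms(2)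
      continuous_on_subset [OF continuous_energy] by auto
qed

lemma closed_nehari: "closed nehari"
proof -
  have "nehari = {w. fst w \<in> Cc_space \<Omega> \<and> snd w \<in> Cc_space \<Omega>} \<inter> {w. crit (fst w) (snd w) = 0}
      \<inter> {w. conc (fst w) (snd w) \<le> 0} \<inter> {w. \<delta> \<le> \<phi> (fst w) (snd w)}"
    by (auto simp: nehari_def)
  then show ?thesis
    by (simp only:) (intro closed_Int closed_Cc_pairs closed_Collect_eq closed_Collect_le
        continuous_on_const continuous_energy continuous_crit continuous_conc)
qed

lemma ex_nehari_minimizer: "\<exists>u v. (u, v) \<in> nehari \<and> (\<forall>u' v'. (u', v') \<in> nehari \<longrightarrow> \<phi> u v \<le> \<phi> u' v')"
proof -
  obtain w0 where w0: "w0 \<in> nehari" using nehari_nonempty by blast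
  define S where "S = nehari \<inter> {w. \<phi> (fst w) (snd w) \<le> \<phi> (fst w0) (snd w0)}"
  obtain R where R: "\<And>w. w \<in> S \<Longrightarrow> dirichlet G \<Omega> p (fst w) \<le> R \<and> dirichlet G \<Omega> q (snd w) \<le> R"
    using bounded_sublevel [of "\<phi> (fst w0) (snd w0)"] by (auto simp: S_def)
  have "\<exists>w\<in>S. \<forall>z\<in>S. \<phi> (fst w) (snd w) \<le> \<phi> (fst z) (snd z)"
  proof (rule attains_energy_inf [of _ R])
    show "closed S"
      unfolding S_def by (intro closed_Int closed_nehari closed_Collect_le continuous_energy continuous_on_const)
    show "S \<noteq> {}" using w0 by (auto simp: S_def)
  qed (use R in \<open>auto simp: S_def nehari_def\<close>)
  then obtain w where w: "w \<in> S" "\<And>z. z \<in> S \<Longrightarrow> \<phi> (fst w) (snd w) \<le> \<phi> (fst z) (snd z)" by blast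
  have "\<phi> (fst w) (snd w) \<le> \<phi> (fst z) (snd z)" if "z \<in> nehari" for z
  proof (cases "\<phi> (fst z) (snd z) \<le> \<phi> (fst w0) (snd w0)")
    case True
    then show ?thesis using w(2) [of z] that by (simp add: S_def)
  next
    case False
    then show ?thesis using w(1) by (simp add: S_def)
  qed
  then show ?thesis using w(1) by (intro exI [of _ "fst w"] exI [of _ "snd w"]) (auto simp: S_def)
qed

text \<open>The minimizer is compared with the rescaling of a nearby pair that lies in \<open>nehari\<close>: the
  energy along its own fiber is maximal at the minimizer, so the same \<open>t\<close> can be used on both sides.\<close>

lemma nehari_minimizer_path:
  fixes U V :: "real \<Rightarrow> 'v \<Rightarrow> real"
  assumes uv: "(u, v) \<in> nehari" and min: "\<And>u' v'. (u', v') \<in> nehari \<Longrightarrow> \<phi> u v \<le> \<phi> u' v'"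
    and U: "continuous_on UNIV U" "\<And>\<epsilon>. U \<epsilon> \<in> Cc_space \<Omega>" "U 0 = u"
    and V: "continuous_on UNIV V" "\<And>\<epsilon>. V \<epsilon> \<in> Cc_space \<Omega>" "V 0 = v"
    and \<theta>: "\<theta> > 0"
  shows "\<forall>\<^sub>F \<epsilon> in at 0. \<exists>t>0. \<bar>t - 1\<bar> < \<theta> \<and> \<phi> (su t u) (sv t v) \<le> \<phi> (su t (U \<epsilon>)) (sv t (V \<epsilon>))"
proof -
  obtain x where Cc: "u \<in> Cc_space \<Omega>" "v \<in> Cc_space \<Omega>" and x: "u x \<noteq> 0 \<or> v x \<noteq> 0"
    and crit: "crit u v = 0" and conc: "conc u v \<le> 0"
    using uv by (rule nehariE)
  note cp = crit_point [OF Cc x crit conc]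
  \<comment> \<open>The time \<open>t\<close> will be found between \<open>1 - \<eta>\<close> and
    \<open>1 + \<eta>\<close>: \<open>\<eta> < \<theta>\<close> keeps it close to 1, and
    \<open>\<eta> < 1\<close> keeps it positive.\<close>
  obtain \<eta> where \<eta>: "\<eta> > 0" "\<eta> < \<theta>" "\<eta> < 1" and conc1: "conc (su (1 - \<eta>) u) (sv (1 - \<eta>) v) < 0"
    using conc_neg_before_1 [OF Cc x cp(1) \<theta>] by blast
  have conc_t: "conc (su t u) (sv t v) < 0" if "t \<ge> 1 - \<eta>" for t
    using conc_mono [OF Cc x _ that conc1] \<eta> by simp
  have crit1: "crit (su (1 - \<eta>) u) (sv (1 - \<eta>) v) > 0"
    using cp(4) [of "1 - \<eta>"] conc1 \<eta> by simp
  have crit2: "crit (su (1 + \<eta>) u) (sv (1 + \<eta>) v) < 0"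
    using cp(5) [of "1 + \<eta>"] conc_t [of "1 + \<eta>"] \<eta> by simp
  have lim: "((\<lambda>\<epsilon>. f (su t (U \<epsilon>)) (sv t (V \<epsilon>))) \<longlongrightarrow> f (su t u) (sv t v)) (at 0)"
    if f: "continuous_on UNIV (\<lambda>w. f (fst w) (snd w))" for f :: "('v \<Rightarrow> real) \<Rightarrow> ('v \<Rightarrow> real) \<Rightarrow> real" and t
  proof -
    have "continuous_on UNIV (\<lambda>\<epsilon>. (su t (U \<epsilon>), sv t (V \<epsilon>)))"
      by (intro continuous_on_Pair continuous_on_compose2 [OF continuous_su [of UNIV] U(1)]
          continuous_on_compose2 [OF continuous_sv [of UNIV] V(1)] subset_UNIV)
    from continuous_on_compose2 [OF f this]
    have "continuous_on UNIV (\<lambda>\<epsilon>. f (su t (U \<epsilon>)) (sv t (V \<epsilon>)))" by simp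
    then show ?thesis
      using U(3) V(3) by (auto simp: continuous_on_eq_continuous_at isCont_def)
  qed
  \<comment> \<open>Only three strict signs at two fixed times are needed, and these persist under
    small perturbations.\<close>
  have "\<forall>\<^sub>F \<epsilon> in at 0. conc (su (1 - \<eta>) (U \<epsilon>)) (sv (1 - \<eta>) (V \<epsilon>)) < 0"
    using order_tendstoD(2) [OF lim [OF continuous_conc] conc1] .
  moreover have "\<forall>\<^sub>F \<epsilon> in at 0. crit (su (1 - \<eta>) (U \<epsilon>)) (sv (1 - \<eta>) (V \<epsilon>)) > 0"
    using order_tendstoD(1) [OF lim [OF continuous_crit] crit1] .
  moreover have "\<forall>\<^sub>F \<epsilon> in at 0. crit (su (1 + \<eta>) (U \<epsilon>)) (sv (1 + \<eta>) (V \<epsilon>)) < 0"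
    using order_tendstoD(2) [OF lim [OF continuous_crit] crit2] .
  ultimately show ?thesis
  proof eventually_elim
    case (elim \<epsilon>)
    have "\<exists>y. U \<epsilon> y \<noteq> 0 \<or> V \<epsilon> y \<noteq> 0"
    proof (rule ccontr)
      \<comment> \<open>On the zero pair \<open>crit\<close> is constant along the curve, which
        contradicts its opposite signs at the two times.\<close>
      assume "\<nexists>y. U \<epsilon> y \<noteq> 0 \<or> V \<epsilon> y \<noteq> 0"
      then have "crit (su (1 - \<eta>) (U \<epsilon>)) (sv (1 - \<eta>) (V \<epsilon>)) = crit (su (1 + \<eta>) (U \<epsilon>)) (sv (1 + \<eta>) (V \<epsilon>))"
        by (simp add: su_def sv_def)
      then show False using elim by simp
    qed
    then obtain y where y: "U \<epsilon> y \<noteq> 0 \<or> V \<epsilon> y \<noteq> 0" by blast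
    obtain t where t: "1 - \<eta> \<le> t" "t \<le> 1 + \<eta>" "crit (su t (U \<epsilon>)) (sv t (V \<epsilon>)) = 0"
      using ex_crit_between [OF U(2) V(2) y, of "1 - \<eta>" "1 + \<eta>"] elim \<eta> by auto
    have t0: "t > 0" using t \<eta> by simp
    have "conc (su t (U \<epsilon>)) (sv t (V \<epsilon>)) < 0"
      using conc_mono [OF U(2) V(2) y, of "1 - \<eta>" t] elim \<eta> t by simp
    moreover have "su t (U \<epsilon>) y \<noteq> 0 \<or> sv t (V \<epsilon>) y \<noteq> 0" using y t0 by (simp add: su_def sv_def)
    ultimately have "(su t (U \<epsilon>), sv t (V \<epsilon>)) \<in> nehari"
      using t U(2) V(2) su_Cc sv_Cc by (intro nehariI) auto
    then have "\<phi> u v \<le> \<phi> (su t (U \<epsilon>)) (sv t (V \<epsilon>))" by (rule min)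
    moreover have "\<phi> (su t u) (sv t v) \<le> \<phi> u v"
      using cp(3) [OF t0] conc_t [OF t(1)] by simp
    ultimately show ?case using t t0 \<eta> by (intro exI [of _ t]) auto
  qed
qed

abbreviation "solution \<equiv> is_solution G \<Omega> p q r \<alpha> \<beta> k a1 b1 a2 b2 \<Lambda>1 \<Lambda>2 h1 h2 h3 g1 g2"

text \<open>A common interface for both minimizers: on \<open>nehari\<close> the time
  \<open>t\<close> is a critical time of the perturbed curve, inside the ball \<open>t = 1\<close>
  will do.\<close>

lemma solutionI:
  assumes Cc: "u \<in> Cc_space \<Omega>" "v \<in> Cc_space \<Omega>"
    and path: "\<And>U V \<theta>. continuous_on UNIV U \<Longrightarrow> (\<And>\<epsilon>::real. U \<epsilon> \<in> Cc_space \<Omega>) \<Longrightarrow> U 0 = u \<Longrightarrow>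
      continuous_on UNIV V \<Longrightarrow> (\<And>\<epsilon>. V \<epsilon> \<in> Cc_space \<Omega>) \<Longrightarrow> V 0 = v \<Longrightarrow> \<theta> > 0 \<Longrightarrow>
      \<forall>\<^sub>F \<epsilon> in at 0. \<exists>t>0. \<bar>t - 1\<bar> < \<theta> \<and> \<phi> (su t u) (sv t v) \<le> \<phi> (su t (U \<epsilon>)) (sv t (V \<epsilon>))"
  shows "solution u v"
proof -
  have upd: "w(x := w x + \<epsilon>) \<in> Cc_space \<Omega>" if "w \<in> Cc_space \<Omega>" "x \<in> \<Omega>" for w :: "'v \<Rightarrow> real" and x \<epsilon>
    using that by (auto simp: Cc_space_def)
  show ?thesis
    unfolding is_solution_def
  proof (intro conjI ballI)
    fix x assume x: "x \<in> \<Omega>"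
    show "- kirchhoff a1 b1 k (W_norm G \<Omega> p u powr p) * graph_laplacian G p u x =
          \<Lambda>1 * h1 x * (\<bar>u x\<bar> powr (r - 2) * u x)
          + \<alpha> / (\<alpha> + \<beta>) * h2 x * (\<bar>u x\<bar> powr (\<alpha> - 2) * u x) * \<bar>v x\<bar> powr \<beta> + g1 x"
      by (rule first_equation [OF x])
        (rule path, use Cc x in \<open>auto intro!: continuous_on_fun_upd upd simp del: fun_upd_apply\<close>)
    show "- kirchhoff a2 b2 k (W_norm G \<Omega> q v powr q) * graph_laplacian G q v x =
          \<Lambda>2 * h3 x * (\<bar>v x\<bar> powr (r - 2) * v x)
          + \<beta> / (\<alpha> + \<beta>) * h2 x * \<bar>u x\<bar> powr \<alpha> * (\<bar>v x\<bar> powr (\<beta> - 2) * v x) + g2 x"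
      by (rule second_equation [OF x])
        (rule path, use Cc x in \<open>auto intro!: continuous_on_fun_upd upd simp del: fun_upd_apply\<close>)
  next
    fix x assume "x \<in> gboundary G \<Omega>"
    then show "u x = 0" "v x = 0" using Cc by (auto simp: gboundary_def Cc_space_def)
  qed (rule Cc)+
qed

lemma ex_positive_solution: "\<exists>u v. solution u v \<and> (u, v) \<noteq> (\<lambda>_. 0, \<lambda>_. 0) \<and> \<phi> u v > 0"
proof -
  obtain u v where uv: "(u, v) \<in> nehari" and min: "\<And>u' v'. (u', v') \<in> nehari \<Longrightarrow> \<phi> u v \<le> \<phi> u' v'"
    using ex_nehari_minimizer by blast
  obtain x where Cc: "u \<in> Cc_space \<Omega>" "v \<in> Cc_space \<Omega>" and pos: "\<delta> \<le> \<phi> u v"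
    using uv by (rule nehariE)
  have "solution u v"
    by (rule solutionI [OF Cc]) (rule nehari_minimizer_path [OF uv min])
  moreover have "(u, v) \<noteq> (\<lambda>_. 0, \<lambda>_. 0)" using energy_zero pos \<delta> by auto
  ultimately show ?thesis using pos \<delta> by (intro exI [of _ u] exI [of _ v]) auto
qed

section \<open>The minimizer in the ball\<close>

lemma lower_le_energy: "lower u v \<le> \<phi> u v"
  unfolding lower_def energy_eq by linarith

lemma continuous_W_norm_sum: "continuous_on UNIV (\<lambda>w. W_norm G \<Omega> p (fst w) + W_norm G \<Omega> q (snd w))"
  using p q by (intro continuous_on_add continuous_on_compose2 [OF continuous_W_norm] continuous_on_fst
      continuous_on_snd continuous_on_id) auto

text \<open>Near \<open>t = 0\<close> the term with exponent \<open>r / p < 1\<close> dominates the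
  Dirichlet terms and is negative. Taking the second component zero removes the coupling.\<close>

lemma ex_negative_in_ball:
  "\<exists>u v. u \<in> Cc_space \<Omega> \<and> v \<in> Cc_space \<Omega> \<and> W_norm G \<Omega> p u + W_norm G \<Omega> q v \<le> s0 \<and> \<phi> u v < 0"
proof -
  obtain x where x: "x \<in> \<Omega>" using nonempty by blast
  \<comment> \<open>The sign of the bump follows \<open>g1 x\<close>, so the linear term cannot
    raise the energy.\<close>
  define e where "e = (\<lambda>y. if y = x then (if g1 x \<ge> 0 then 1 else -1) else 0 :: real)"
  have e: "e \<in> Cc_space \<Omega>" using x by (auto simp: e_def Cc_space_def)
  define z where "z = (\<lambda>_ :: 'v. 0 :: real)"
  have z: "z \<in> Cc_space \<Omega>" by (simp add: z_def Cc_space_def)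
  have n1: "n1 e > 0"
    unfolding n1_def using \<Lambda>1 r x h h_nonneg by (intro mult_pos_pos gintegral_pos [of x]) (auto simp: e_def)
  have l1: "l1 e \<ge> 0"
  proof -
    have "l1 e = (\<Sum>y\<in>\<Omega>. if y = x then vmeas G x * \<bar>g1 x\<bar> else 0)"
      unfolding l1_def gintegral_def by (intro sum.cong) (auto simp: e_def)
    then show ?thesis using x fin dom vmeas_pos [of x] by (auto simp: sum.delta' less_imp_le)
  qed
  have zz: "n2 z = 0" "l2 z = 0" "cH e z = 0" "sv t z = z" "W_norm G \<Omega> q z = 0" for t
    by (simp_all add: n2_def l2_def cH_def gintegral_def z_def sv_def W_norm_def grad_abs_def grad_form_def)
  have \<phi>: "\<phi> (su t e) z \<le> t * cA e z + t powr m * cB e z - t powr (r / p) * n1 e" if "t > 0" for t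
    using scale_cA [OF that, of e z] scale_cB [OF that, of e z] scale_cH [OF that, of e z] zz l1 that
    by (simp add: energy_eq scale_n1 scale_l1)
  have lim: "((\<lambda>t. t powr c) \<longlongrightarrow> 0) (at_right 0)" if "c > 0" for c :: real
    using that by real_asymp
  have rp1: "r / p < 1" using p rp by simp
  have "((\<lambda>t. t powr (1 - r / p) * cA e z + t powr (m - r / p) * cB e z - n1 e) \<longlongrightarrow>
      0 * cA e z + 0 * cB e z - n1 e) (at_right 0)"
    using rp1 m_ge_1 by (intro tendsto_intros lim) auto
  then have "\<forall>\<^sub>F t in at_right 0. t powr (1 - r / p) * cA e z + t powr (m - r / p) * cB e z - n1 e < 0"
    using n1 by (intro order_tendstoD(2)) auto
  moreover have "((\<lambda>t. t powr (1 / p) * W_norm G \<Omega> p e) \<longlongrightarrow> 0 * W_norm G \<Omega> p e) (at_right 0)"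
    using p by (intro tendsto_intros lim) auto
  then have "\<forall>\<^sub>F t in at_right 0. t powr (1 / p) * W_norm G \<Omega> p e < s0"
    using s0 by (intro order_tendstoD(2)) auto
  moreover have "\<forall>\<^sub>F t in at_right (0::real). t > 0" by (rule eventually_at_right_less)
  ultimately have "\<forall>\<^sub>F t in at_right 0. t powr (1 - r / p) * cA e z + t powr (m - r / p) * cB e z - n1 e < 0
      \<and> t powr (1 / p) * W_norm G \<Omega> p e < s0 \<and> t > 0"
    by eventually_elim simp
  then obtain t where t: "t powr (1 - r / p) * cA e z + t powr (m - r / p) * cB e z - n1 e < 0"
      "t powr (1 / p) * W_norm G \<Omega> p e < s0" "t > 0"
    using eventually_happens' [OF trivial_limit_at_right_real] by fast
  have "t powr (r / p) * (t powr (1 - r / p) * cA e z + t powr (m - r / p) * cB e z - n1 e) < 0"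
    using t by (intro mult_pos_neg) auto
  moreover have "t powr (r / p) * t powr (1 - r / p) = t" "t powr (r / p) * t powr (m - r / p) = t powr m"
    using t by (simp_all add: powr_add [symmetric])
  ultimately have "t * cA e z + t powr m * cB e z - t powr (r / p) * n1 e < 0"
    by (simp add: distrib_left right_diff_distrib mult.assoc [symmetric])
  then have "\<phi> (su t e) z < 0" using \<phi> [OF t(3)] by simp
  then show ?thesis
    using t su_Cc [OF e] z zz W_norm_su by (intro exI [of _ "su t e"] exI [of _ z]) auto
qed

text \<open>The minimum over the ball is negative, whereas on the sphere the energy is at least
  \<delta>. The minimizer is therefore interior and can be compared with every small
  perturbation.\<close>

lemma ex_negative_solution: "\<exists>u v. solution u v \<and> (u, v) \<noteq> (\<lambda>_. 0, \<lambda>_. 0) \<and> \<phi> u v < 0"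
proof -
  let ?W = "\<lambda>w. W_norm G \<Omega> p (fst w) + W_norm G \<Omega> q (snd w)"
  define S where "S = {w :: ('v \<Rightarrow> real) \<times> ('v \<Rightarrow> real). fst w \<in> Cc_space \<Omega> \<and> snd w \<in> Cc_space \<Omega>} \<inter> {w. ?W w \<le> s0}"
  have R: "dirichlet G \<Omega> l w \<le> max (s0 powr p) (s0 powr q)"
    if "W_norm G \<Omega> l w \<le> s0" "l = p \<or> l = q" for l w
  proof -
    have l: "l > 1" using that p q by auto
    then have "dirichlet G \<Omega> l w = W_norm G \<Omega> l w powr l" by (simp add: W_norm_powr_self)
    also have "\<dots> \<le> s0 powr l" using that l W_norm_nonneg by (intro powr_mono2) auto
    finally show ?thesis using that by auto
  qed
  obtain u0 v0 where w0: "(u0, v0) \<in> S" "\<phi> u0 v0 < 0"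
    using ex_negative_in_ball by (auto simp: S_def)
  have "\<exists>w\<in>S. \<forall>z\<in>S. \<phi> (fst w) (snd w) \<le> \<phi> (fst z) (snd z)"
  proof (rule attains_energy_inf [of _ "max (s0 powr p) (s0 powr q)"])
    show "closed S"
      unfolding S_def by (intro closed_Int closed_Cc_pairs closed_Collect_le continuous_W_norm_sum continuous_on_const)
    show "S \<noteq> {}" using w0 by blast
    fix w assume w: "w \<in> S"
    then have "W_norm G \<Omega> p (fst w) \<le> s0" "W_norm G \<Omega> q (snd w) \<le> s0"
      using W_norm_nonneg [of p "fst w"] W_norm_nonneg [of q "snd w"] by (auto simp: S_def)
    then show "fst w \<in> Cc_space \<Omega> \<and> snd w \<in> Cc_space \<Omega> \<and> dirichlet G \<Omega> p (fst w) \<le> max (s0 powr p) (s0 powr q)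
        \<and> dirichlet G \<Omega> q (snd w) \<le> max (s0 powr p) (s0 powr q)"
      using w R by (auto simp: S_def)
  qed
  then obtain u v where uv: "(u, v) \<in> S" and min: "\<And>u' v'. (u', v') \<in> S \<Longrightarrow> \<phi> u v \<le> \<phi> u' v'"
    by fastforce
  have neg: "\<phi> u v < 0" using min [OF w0(1)] w0(2) by simp
  have Cc: "u \<in> Cc_space \<Omega>" "v \<in> Cc_space \<Omega>" using uv by (auto simp: S_def)
  have "?W (u, v) \<noteq> s0"
    using ridge [OF Cc] lower_le_energy [of u v] neg \<delta> by auto
  then have int: "?W (u, v) < s0" using uv by (simp add: S_def)
  have "solution u v"
  proof (rule solutionI [OF Cc])
    fix U V :: "real \<Rightarrow> 'v \<Rightarrow> real" and \<theta> :: real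
    assume U: "continuous_on UNIV U" "\<And>\<epsilon>. U \<epsilon> \<in> Cc_space \<Omega>" "U 0 = u"
      and V: "continuous_on UNIV V" "\<And>\<epsilon>. V \<epsilon> \<in> Cc_space \<Omega>" "V 0 = v" and \<theta>: "\<theta> > 0"
    have "continuous_on UNIV (\<lambda>\<epsilon>. ?W (U \<epsilon>, V \<epsilon>))"
      by (rule continuous_on_compose2 [OF continuous_W_norm_sum continuous_on_Pair [OF U(1) V(1)]]) auto
    then have "((\<lambda>\<epsilon>. ?W (U \<epsilon>, V \<epsilon>)) \<longlongrightarrow> ?W (U 0, V 0)) (at 0)"
      by (simp only: continuous_on_eq_continuous_at [OF open_UNIV] isCont_def ball_UNIV)
    then have "\<forall>\<^sub>F \<epsilon> in at 0. ?W (U \<epsilon>, V \<epsilon>) < s0"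
      using int U(3) V(3) by (intro order_tendstoD(2)) auto
    then show "\<forall>\<^sub>F \<epsilon> in at 0. \<exists>t>0. \<bar>t - 1\<bar> < \<theta> \<and> \<phi> (su t u) (sv t v) \<le> \<phi> (su t (U \<epsilon>)) (sv t (V \<epsilon>))"
    proof eventually_elim
      case (elim \<epsilon>)
      then have "(U \<epsilon>, V \<epsilon>) \<in> S" using U V by (simp add: S_def)
      then show ?case using min [of "U \<epsilon>" "V \<epsilon>"] \<theta> by (intro exI [of _ 1]) auto
    qed
  qed
  moreover have "(u, v) \<noteq> (\<lambda>_. 0, \<lambda>_. 0)" using energy_zero neg by auto
  ultimately show ?thesis using neg by (intro exI [of _ u] exI [of _ v]) auto
qed

end

section \<open>The ridge\<close>

lemma weighted_Young:
  fixes a b \<alpha> \<beta> :: real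
  assumes "\<alpha> > 0" "\<beta> > 0" "a \<ge> 0" "b \<ge> 0"
  shows "a powr \<alpha> * b powr \<beta> \<le> (\<alpha> * a powr (\<alpha> + \<beta>) + \<beta> * b powr (\<alpha> + \<beta>)) / (\<alpha> + \<beta>)"
proof -
  have "a powr \<alpha> * b powr \<beta> \<le> (a powr \<alpha>) powr ((\<alpha> + \<beta>) / \<alpha>) / ((\<alpha> + \<beta>) / \<alpha>)
      + (b powr \<beta>) powr ((\<alpha> + \<beta>) / \<beta>) / ((\<alpha> + \<beta>) / \<beta>)"
    using assms by (intro Youngs_inequality) (auto simp: add_divide_distrib [symmetric])
  also have "\<dots> = (\<alpha> * a powr (\<alpha> + \<beta>) + \<beta> * b powr (\<alpha> + \<beta>)) / (\<alpha> + \<beta>)"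
    using assms by (simp add: powr_powr mult.commute add_divide_distrib [symmetric])
  finally show ?thesis .
qed

text \<open>Midpoint convexity of the power; this is the origin of the factor
  \<open>2 powr (1 - max p q * (k + 1))\<close> in the first constant. Zero arguments are treated
  apart, convexity being applied to positive ones only.\<close>

lemma powr_sum_ge:
  fixes x y c :: real
  assumes "x \<ge> 0" "y \<ge> 0" "c \<ge> 1"
  shows "2 powr (1 - c) * (x + y) powr c \<le> x powr c + y powr c"
proof (cases "x = 0 \<or> y = 0")
  case True
  have "2 powr (1 - c) \<le> (1::real)" using assms powr_mono [of "1 - c" 0 "2::real"] by simp
  then show ?thesis using True assms mult_right_mono [of "2 powr (1 - c)" 1 "(x + y) powr c"] by auto
next
  case False
  have "((1 / 2) * x + (1 / 2) * y) powr c \<le> 1 / 2 * x powr c + 1 / 2 * y powr c"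
    using convex_onD [OF powr_convex [OF assms(3)], of "1 / 2" x y] False assms by simp
  moreover have "((1 / 2) * x + (1 / 2) * y) powr c = (1 / 2) powr c * (x + y) powr c"
    using assms by (simp add: powr_mult [symmetric] distrib_left)
  moreover have "2 powr (1 - c) = 2 * (1 / 2 :: real) powr c"
    by (simp add: powr_diff powr_divide)
  ultimately show ?thesis by simp
qed

lemma powr_sum_le:
  fixes x y c :: real
  assumes "x \<ge> 0" "y \<ge> 0" "c \<ge> 1"
  shows "x powr c + y powr c \<le> (x + y) powr c"
proof -
  have split: "w powr c = w * w powr (c - 1)" if "w \<ge> 0" for w :: real
    using powr_mult_base [of w "c - 1"] that by simp
  have "x * x powr (c - 1) + y * y powr (c - 1) \<le> x * (x + y) powr (c - 1) + y * (x + y) powr (c - 1)"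
    using assms by (intro add_mono mult_left_mono powr_mono2) auto
  also have "\<dots> = (x + y) * (x + y) powr (c - 1)" by (simp add: distrib_right)
  finally show ?thesis using assms split [of x] split [of y] split [of "x + y"] by simp
qed

text \<open>The maximum over \<open>s > 0\<close> of \<open>M1 * s powr \<mu> - M2 * s powr \<sigma>\<close>.\<close>

lemma ridge_height:
  fixes M1 M2 \<mu> \<sigma> :: real
  assumes M: "M1 > 0" "M2 > 0" and \<mu>: "0 < \<mu>" "\<mu> < \<sigma>"
  defines "s \<equiv> (\<mu> * M1 / (\<sigma> * M2)) powr (1 / (\<sigma> - \<mu>))"
  shows "M1 * s powr \<mu> - M2 * s powr \<sigma>
    = (\<sigma> - \<mu>) / \<sigma> * M1 powr (\<sigma> / (\<sigma> - \<mu>)) * (\<mu> / (\<sigma> * M2)) powr (\<mu> / (\<sigma> - \<mu>))"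
proof -
  \<comment> \<open>The point \<open>s\<close> is the zero of the derivative, where
    \<open>M2 * s powr \<sigma>\<close> equals the fraction \<open>\<mu> / \<sigma>\<close> of
    \<open>M1 * s powr \<mu>\<close>.\<close>
  have s: "s powr (\<sigma> - \<mu>) = \<mu> * M1 / (\<sigma> * M2)" using M \<mu> by (simp add: s_def powr_powr)
  have "s powr \<sigma> = s powr \<mu> * s powr (\<sigma> - \<mu>)" by (simp add: powr_add [symmetric])
  then have "M1 * s powr \<mu> - M2 * s powr \<sigma> = (\<sigma> - \<mu>) / \<sigma> * (M1 * s powr \<mu>)"
    unfolding s using M \<mu> by (simp add: field_simps)
  moreover have "s powr \<mu> = M1 powr (\<mu> / (\<sigma> - \<mu>)) * (\<mu> / (\<sigma> * M2)) powr (\<mu> / (\<sigma> - \<mu>))"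
    using M \<mu> by (simp add: s_def powr_powr powr_mult [symmetric] mult.commute)
  moreover have "M1 * (M1 powr (\<mu> / (\<sigma> - \<mu>)) * (\<mu> / (\<sigma> * M2)) powr (\<mu> / (\<sigma> - \<mu>)))
      = M1 powr (\<sigma> / (\<sigma> - \<mu>)) * (\<mu> / (\<sigma> * M2)) powr (\<mu> / (\<sigma> - \<mu>))"
  proof -
    have "1 + \<mu> / (\<sigma> - \<mu>) = \<sigma> / (\<sigma> - \<mu>)" using \<mu> by (simp add: field_simps)
    then show ?thesis using M powr_mult_base [of M1 "\<mu> / (\<sigma> - \<mu>)"] by (simp add: mult.assoc [symmetric])
  qed
  ultimately show ?thesis by (simp only: mult.assoc)
qed

section \<open>Estimates behind the constants of the smallness condition\<close>

context finite_domain
begin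

lemma L_norm_powr: "\<gamma> > 0 \<Longrightarrow> L_norm G \<Omega> \<gamma> u powr \<gamma> = gintegral G \<Omega> (\<lambda>x. \<bar>u x\<bar> powr \<gamma>)"
  by (simp add: L_norm_def powr_powr gintegral_nonneg)

lemma gintegral_le_W_norm:
  assumes "embedding_constant G \<Omega> l C" "u \<in> Cc_space \<Omega>" "\<gamma> \<ge> 1"
  shows "gintegral G \<Omega> (\<lambda>x. \<bar>u x\<bar> powr \<gamma>) \<le> C powr \<gamma> * W_norm G \<Omega> l u powr \<gamma>"
proof -
  have C: "C > 0" and le: "L_norm G \<Omega> \<gamma> u \<le> C * W_norm G \<Omega> l u"
    using assms by (auto simp: embedding_constant_def)
  have "L_norm G \<Omega> \<gamma> u powr \<gamma> \<le> (C * W_norm G \<Omega> l u) powr \<gamma>"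
    using le assms(3) by (intro powr_mono2) (auto simp: L_norm_def)
  then show ?thesis using assms(3) C by (simp add: L_norm_powr powr_mult W_norm_def)
qed

end

context kirchhoff_system
begin

text \<open>Young's inequality with exponents \<open>p / r\<close> and \<open>p\<close> leaves
  \<open>(\<Lambda>1 + 1) / p\<close> times the integral of \<open>\<bar>u\<bar> powr p\<close>. The
  upper bound on \<open>\<Lambda>1\<close> is precisely what lets the term
  \<open>a1 / p * dirichlet G \<Omega> p u\<close> of the energy absorb it.\<close>

lemma lower_order_terms:
  assumes emb: "embedding_constant G \<Omega> p C" and \<Lambda>: "\<Lambda>1 < a1 * C powr (- p) - 1" and u: "u \<in> Cc_space \<Omega>"
  shows "n1 u + \<bar>l1 u\<bar> \<le> \<Lambda>1 * (p - r) / (p * r) * L_norm G \<Omega> (p / (p - r)) h1 powr (p / (p - r))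
     + (p - 1) / p * L_norm G \<Omega> (p / (p - 1)) g1 powr (p / (p - 1)) + a1 / p * dirichlet G \<Omega> p u"
proof -
  have C: "C > 0" using emb by (simp add: embedding_constant_def)
  let ?I = "gintegral G \<Omega> (\<lambda>x. \<bar>u x\<bar> powr p)"
  let ?h = "gintegral G \<Omega> (\<lambda>x. \<bar>h1 x\<bar> powr (p / (p - r)))"
  let ?g = "gintegral G \<Omega> (\<lambda>x. \<bar>g1 x\<bar> powr (p / (p - 1)))"
  have "gintegral G \<Omega> (\<lambda>x. h1 x * \<bar>u x\<bar> powr r)
      \<le> gintegral G \<Omega> (\<lambda>x. (p - r) / p * \<bar>h1 x\<bar> powr (p / (p - r)) + r / p * \<bar>u x\<bar> powr p)"
  proof (rule gintegral_mono)
    fix x assume x: "x \<in> \<Omega>"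
    have "h1 x * \<bar>u x\<bar> powr r \<le> h1 x powr (p / (p - r)) / (p / (p - r)) + (\<bar>u x\<bar> powr r) powr (p / r) / (p / r)"
      using h_nonneg(1) [OF x] p r rp
      by (intro Youngs_inequality) (auto simp: diff_divide_distrib)
    then show "h1 x * \<bar>u x\<bar> powr r \<le> (p - r) / p * \<bar>h1 x\<bar> powr (p / (p - r)) + r / p * \<bar>u x\<bar> powr p"
      using h_nonneg(1) [OF x] r by (simp add: powr_powr mult.commute)
  qed
  also have "\<dots> = (p - r) / p * ?h + r / p * ?I"
    by (simp add: gintegral_def sum_distrib_left sum.distrib distrib_left mult_ac)
  finally have "n1 u \<le> \<Lambda>1 / r * ((p - r) / p * ?h + r / p * ?I)"
    unfolding n1_def using \<Lambda>1 r by (intro mult_left_mono) auto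
  also have "\<dots> = \<Lambda>1 * (p - r) / (p * r) * ?h + \<Lambda>1 / p * ?I"
    using r p by (simp add: field_simps)
  finally have n1: "n1 u \<le> \<Lambda>1 * (p - r) / (p * r) * ?h + \<Lambda>1 / p * ?I" .
  have "\<bar>l1 u\<bar> \<le> (\<Sum>x\<in>\<Omega>. \<bar>vmeas G x * (g1 x * u x)\<bar>)"
    unfolding l1_def gintegral_def by (rule sum_abs)
  also have "\<dots> = gintegral G \<Omega> (\<lambda>x. \<bar>g1 x\<bar> * \<bar>u x\<bar>)"
    unfolding gintegral_def using dom vmeas_pos by (intro sum.cong) (auto simp: abs_mult intro!: abs_of_pos)
  also have "\<dots> \<le> gintegral G \<Omega> (\<lambda>x. (p - 1) / p * \<bar>g1 x\<bar> powr (p / (p - 1)) + 1 / p * \<bar>u x\<bar> powr p)"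
  proof (rule gintegral_mono)
    fix x
    have "\<bar>g1 x\<bar> * \<bar>u x\<bar> \<le> \<bar>g1 x\<bar> powr (p / (p - 1)) / (p / (p - 1)) + \<bar>u x\<bar> powr p / p"
      using p by (intro Youngs_inequality) (auto simp: diff_divide_distrib)
    then show "\<bar>g1 x\<bar> * \<bar>u x\<bar> \<le> (p - 1) / p * \<bar>g1 x\<bar> powr (p / (p - 1)) + 1 / p * \<bar>u x\<bar> powr p"
      by (simp add: mult.commute)
  qed
  also have "\<dots> = (p - 1) / p * ?g + 1 / p * ?I"
    by (simp add: gintegral_def sum_distrib_left sum.distrib distrib_left mult_ac)
  finally have l1: "\<bar>l1 u\<bar> \<le> (p - 1) / p * ?g + 1 / p * ?I" .
  have "?I \<le> C powr p * dirichlet G \<Omega> p u"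
    using gintegral_le_W_norm [OF emb u, of p] p by (simp add: W_norm_powr_self)
  then have "(\<Lambda>1 + 1) / p * ?I \<le> (\<Lambda>1 + 1) / p * (C powr p * dirichlet G \<Omega> p u)"
    using \<Lambda>1 p by (intro mult_left_mono) auto
  also have "\<dots> = ((\<Lambda>1 + 1) * C powr p) / p * dirichlet G \<Omega> p u" by simp
  also have "\<dots> \<le> a1 / p * dirichlet G \<Omega> p u"
  proof -
    have "(\<Lambda>1 + 1) * C powr p \<le> (a1 * C powr (- p)) * C powr p"
      using \<Lambda> by (intro mult_right_mono) auto
    also have "\<dots> = a1" using C by (simp add: mult.assoc powr_add [symmetric])
    finally show ?thesis using p dirichlet_nonneg by (intro mult_right_mono divide_right_mono) auto
  qed
  finally have "\<Lambda>1 / p * ?I + 1 / p * ?I \<le> a1 / p * dirichlet G \<Omega> p u"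
    by (simp add: add_divide_distrib distrib_right)
  moreover have "L_norm G \<Omega> (p / (p - r)) h1 powr (p / (p - r)) = ?h"
    "L_norm G \<Omega> (p / (p - 1)) g1 powr (p / (p - 1)) = ?g"
    using p rp by (simp_all add: L_norm_powr)
  ultimately show ?thesis using n1 l1 by simp
qed

text \<open>The square of \<open>\<alpha> + \<beta>\<close> has two sources: one factor is the
  coefficient of the coupling in the energy, the other comes from Young's inequality.\<close>

lemma coupling_le:
  assumes embp: "embedding_constant G \<Omega> p Cp" and embq: "embedding_constant G \<Omega> q Cq"
    and u: "u \<in> Cc_space \<Omega>" and v: "v \<in> Cc_space \<Omega>"
  shows "cH u v \<le> max_norm \<Omega> h2 / (\<alpha> + \<beta>)\<^sup>2 * max (\<alpha> * Cp powr (\<alpha> + \<beta>)) (\<beta> * Cq powr (\<alpha> + \<beta>))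
     * (W_norm G \<Omega> p u + W_norm G \<Omega> q v) powr (\<alpha> + \<beta>)"
proof -
  let ?x = "W_norm G \<Omega> p u" and ?y = "W_norm G \<Omega> q v" and ?N = "max_norm \<Omega> h2"
  let ?m = "max (\<alpha> * Cp powr (\<alpha> + \<beta>)) (\<beta> * Cq powr (\<alpha> + \<beta>))"
  define \<sigma> where "\<sigma> = \<alpha> + \<beta>"
  have \<sigma>: "\<sigma> > 1"
  proof -
    have "1 * 1 < (k + 1) * p" using p k by (intro mult_le_less_imp_less) auto
    then show ?thesis using super_p by (simp add: \<sigma>_def)
  qed
  have N: "h2 x \<le> ?N" if "x \<in> \<Omega>" for x
  proof -
    have "\<bar>h2 x\<bar> \<le> ?N" unfolding max_norm_def using that fin by (intro Max_ge) auto
    then show ?thesis by simp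
  qed
  show ?thesis
  \<comment> \<open>On the empty set \<open>max_norm\<close> is a \<open>Max\<close> without
    meaning, but there both norms and the coupling are 0.\<close>
  proof (cases "\<Omega> = {}")
    case False
    then have N0: "?N \<ge> 0" using N h_nonneg(2) by force
    have "gintegral G \<Omega> (\<lambda>x. h2 x * \<bar>u x\<bar> powr \<alpha> * \<bar>v x\<bar> powr \<beta>)
        \<le> gintegral G \<Omega> (\<lambda>x. ?N * ((\<alpha> * \<bar>u x\<bar> powr \<sigma> + \<beta> * \<bar>v x\<bar> powr \<sigma>) / \<sigma>))"
    proof (rule gintegral_mono)
      fix x assume x: "x \<in> \<Omega>"
      show "h2 x * \<bar>u x\<bar> powr \<alpha> * \<bar>v x\<bar> powr \<beta> \<le> ?N * ((\<alpha> * \<bar>u x\<bar> powr \<sigma> + \<beta> * \<bar>v x\<bar> powr \<sigma>) / \<sigma>)"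
        unfolding mult.assoc \<sigma>_def using N [OF x] N0 \<alpha> \<beta>
        by (intro mult_mono weighted_Young) auto
    qed
    also have "\<dots> = ?N / \<sigma> * (\<alpha> * gintegral G \<Omega> (\<lambda>x. \<bar>u x\<bar> powr \<sigma>) + \<beta> * gintegral G \<Omega> (\<lambda>x. \<bar>v x\<bar> powr \<sigma>))"
      by (simp add: gintegral_def sum_distrib_left sum.distrib distrib_left add_divide_distrib mult_ac)
    also have "\<dots> \<le> ?N / \<sigma> * (\<alpha> * (Cp powr \<sigma> * ?x powr \<sigma>) + \<beta> * (Cq powr \<sigma> * ?y powr \<sigma>))"
      using N0 \<sigma> \<alpha> \<beta>
      by (intro mult_left_mono add_mono gintegral_le_W_norm embp embq u v) auto
    also have "\<dots> \<le> ?N / \<sigma> * (?m * ?x powr \<sigma> + ?m * ?y powr \<sigma>)"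
      unfolding mult.assoc [symmetric, of \<alpha>] mult.assoc [symmetric, of \<beta>] using N0 \<sigma>
      by (intro mult_left_mono add_mono mult_right_mono) (auto simp: \<sigma>_def)
    also have "\<dots> = ?N / \<sigma> * (?m * (?x powr \<sigma> + ?y powr \<sigma>))" by (simp add: distrib_left)
    also have "\<dots> \<le> ?N / \<sigma> * (?m * (?x + ?y) powr \<sigma>)"
      using N0 \<sigma> \<alpha> by (intro mult_left_mono powr_sum_le) (auto simp: W_norm_def le_max_iff_disj)
    finally have "1 / \<sigma> * gintegral G \<Omega> (\<lambda>x. h2 x * \<bar>u x\<bar> powr \<alpha> * \<bar>v x\<bar> powr \<beta>)
        \<le> 1 / \<sigma> * (?N / \<sigma> * (?m * (?x + ?y) powr \<sigma>))"
      using \<sigma> by (intro mult_left_mono) auto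
    then show ?thesis by (simp add: cH_def \<sigma>_def power2_eq_square mult.assoc)
  next
    case True
    then have "cH u v = 0" "?x = 0" "?y = 0"
      unfolding cH_def by (simp_all add: W_norm_def gintegral_def gboundary_def)
    then show ?thesis by simp
  qed
qed

text \<open>Norms at most 1 are required because the smaller of the exponents
  \<open>p * (k + 1)\<close> and \<open>q * (k + 1)\<close> is raised to the larger one.\<close>

lemma cB_ge:
  assumes "W_norm G \<Omega> p u \<le> 1" "W_norm G \<Omega> q v \<le> 1"
  shows "2 powr (1 - max p q * (k + 1)) * min (b1 / (p * (k + 1))) (b2 / (q * (k + 1)))
     * (W_norm G \<Omega> p u + W_norm G \<Omega> q v) powr (max p q * (k + 1)) \<le> cB u v"
proof -
  let ?x = "W_norm G \<Omega> p u" and ?y = "W_norm G \<Omega> q v"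
  let ?b = "min (b1 / (p * (k + 1))) (b2 / (q * (k + 1)))"
  define \<mu> where "\<mu> = max p q * (k + 1)"
  have \<mu>: "1 \<le> \<mu>" unfolding \<mu>_def using mult_mono [of 1 "max p q" 1 "k + 1"] p k by simp
  have xy: "0 \<le> ?x" "0 \<le> ?y" by (simp_all add: W_norm_def)
  have b: "?b \<ge> 0" using b1 b2 p q k by simp
  have "2 powr (1 - \<mu>) * ?b * (?x + ?y) powr \<mu> = ?b * (2 powr (1 - \<mu>) * (?x + ?y) powr \<mu>)" by simp
  also have "\<dots> \<le> ?b * (?x powr \<mu> + ?y powr \<mu>)"
    by (intro mult_left_mono powr_sum_ge xy \<mu> b)
  also have "\<dots> \<le> ?b * (?x powr (p * (k + 1)) + ?y powr (q * (k + 1)))"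
    using assms xy b k by (intro mult_left_mono add_mono powr_mono') (auto simp: \<mu>_def intro!: mult_right_mono)
  also have "\<dots> \<le> b1 / (p * (k + 1)) * ?x powr (p * (k + 1)) + b2 / (q * (k + 1)) * ?y powr (q * (k + 1))"
    unfolding distrib_left by (intro add_mono mult_right_mono) auto
  also have "\<dots> = cB u v" using p q by (simp add: cB_def m_def W_norm_powr)
  finally show ?thesis unfolding \<mu>_def .
qed

end

theorem theorem1p1:
  fixes G :: "'v wgraph" and \<Omega> :: "'v set"
    and p q r \<alpha> \<beta> k a\<^sub>1 a\<^sub>2 b\<^sub>1 b\<^sub>2 \<Lambda>\<^sub>1 \<Lambda>\<^sub>2 \<M>\<^sub>1 \<M>\<^sub>2 :: real
    and C :: "real \<Rightarrow> real"
    and h\<^sub>1 h\<^sub>2 h\<^sub>3 g\<^sub>1 g\<^sub>2 :: "'v \<Rightarrow> real"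
  assumes "connected_wgraph G"
    and "bounded_domain G \<Omega>" and "ginterior G \<Omega> \<noteq> {}" and "gboundary G \<Omega> \<noteq> {}"
    and "p > 1" and "q > 1" and "r > 1" and "\<alpha> > 0" and "\<beta> > 0" and "k \<ge> 0"
    and "r < min p q" and "min p q \<le> max p q" and "max p q \<le> (k + 1) * max p q"
    and "(k + 1) * max p q < \<alpha> + \<beta>"
    and "embedding_constant G \<Omega> p (C p)" and "embedding_constant G \<Omega> q (C q)"
    and "b\<^sub>1 > 0" and "b\<^sub>2 > 0" and "a\<^sub>1 > C p powr p" and "a\<^sub>2 > C q powr q"
    and "\<forall>x\<in>\<Omega>. h\<^sub>1 x > 0 \<and> h\<^sub>2 x > 0 \<and> h\<^sub>3 x > 0"
    and "\<M>\<^sub>1 = 2 powr (1 - max p q * (k + 1)) * min (b\<^sub>1 / (p * (k + 1))) (b\<^sub>2 / (q * (k + 1)))"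
    and "\<M>\<^sub>2 = max_norm \<Omega> h\<^sub>2 / (\<alpha> + \<beta>)\<^sup>2 *
                max (\<alpha> * C p powr (\<alpha> + \<beta>)) (\<beta> * C q powr (\<alpha> + \<beta>))"
    and "0 < \<Lambda>\<^sub>1" and "\<Lambda>\<^sub>1 < a\<^sub>1 * C p powr (- p) - 1"
    and "0 < \<Lambda>\<^sub>2" and "\<Lambda>\<^sub>2 < a\<^sub>2 * C q powr (- q) - 1"
    and "\<M>\<^sub>1 \<le> (\<alpha> + \<beta>) / (max p q * (k + 1)) * \<M>\<^sub>2"
    and "max (\<Lambda>\<^sub>1 * (p - r) / (p * r)) (\<Lambda>\<^sub>2 * (q - r) / (q * r)) *
           (L_norm G \<Omega> (p / (p - r)) h\<^sub>1 powr (p / (p - r))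
            + L_norm G \<Omega> (q / (q - r)) h\<^sub>3 powr (q / (q - r)))
         + max ((p - 1) / p) ((q - 1) / q) *
           (L_norm G \<Omega> (p / (p - 1)) g\<^sub>1 powr (p / (p - 1))
            + L_norm G \<Omega> (q / (q - 1)) g\<^sub>2 powr (q / (q - 1)))
         < (\<alpha> + \<beta> - max p q * (k + 1)) / (\<alpha> + \<beta>) *
           \<M>\<^sub>1 powr ((\<alpha> + \<beta>) / (\<alpha> + \<beta> - max p q * (k + 1))) *
           (max p q * (k + 1) / ((\<alpha> + \<beta>) * \<M>\<^sub>2)) powr
             (max p q * (k + 1) / (\<alpha> + \<beta> - max p q * (k + 1)))"
  shows "(\<exists>u\<^sub>0 v\<^sub>0. is_solution G \<Omega> p q r \<alpha> \<beta> k a\<^sub>1 b\<^sub>1 a\<^sub>2 b\<^sub>2 \<Lambda>\<^sub>1 \<Lambda>\<^sub>2 h\<^sub>1 h\<^sub>2 h\<^sub>3 g\<^sub>1 g\<^sub>2 u\<^sub>0 v\<^sub>0 \<and>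
            (u\<^sub>0, v\<^sub>0) \<noteq> (\<lambda>_. 0, \<lambda>_. 0) \<and>
            energy G \<Omega> p q r \<alpha> \<beta> k a\<^sub>1 b\<^sub>1 a\<^sub>2 b\<^sub>2 \<Lambda>\<^sub>1 \<Lambda>\<^sub>2 h\<^sub>1 h\<^sub>2 h\<^sub>3 g\<^sub>1 g\<^sub>2 u\<^sub>0 v\<^sub>0 > 0) \<and>
         (\<exists>u\<^sub>0' v\<^sub>0'. is_solution G \<Omega> p q r \<alpha> \<beta> k a\<^sub>1 b\<^sub>1 a\<^sub>2 b\<^sub>2 \<Lambda>\<^sub>1 \<Lambda>\<^sub>2 h\<^sub>1 h\<^sub>2 h\<^sub>3 g\<^sub>1 g\<^sub>2 u\<^sub>0' v\<^sub>0' \<and>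
            (u\<^sub>0', v\<^sub>0') \<noteq> (\<lambda>_. 0, \<lambda>_. 0) \<and>
            energy G \<Omega> p q r \<alpha> \<beta> k a\<^sub>1 b\<^sub>1 a\<^sub>2 b\<^sub>2 \<Lambda>\<^sub>1 \<Lambda>\<^sub>2 h\<^sub>1 h\<^sub>2 h\<^sub>3 g\<^sub>1 g\<^sub>2 u\<^sub>0' v\<^sub>0' < 0)"
proof -
  interpret connected_wgraph G by fact
  have fin: "finite \<Omega>" using assms(2) by (rule finite_bounded_domain)
  have dom: "\<Omega> \<subseteq> vertices G" using assms(2) by (simp add: bounded_domain_def)
  have nonempty: "\<Omega> \<noteq> {}" using assms(3) by (auto simp: ginterior_def)
  have C: "C p > 0" "C q > 0" using assms(15,16) by (auto simp: embedding_constant_def)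
  define \<mu> where "\<mu> = max p q * (k + 1)"
  define \<sigma> where "\<sigma> = \<alpha> + \<beta>"
  have \<mu>\<sigma>: "0 < \<mu>" "\<mu> < \<sigma>" using assms(5,10,14) by (auto simp: \<mu>_def \<sigma>_def mult.commute less_max_iff_disj)
  have super: "(k + 1) * p < \<alpha> + \<beta>" "(k + 1) * q < \<alpha> + \<beta>"
    using assms(10,14) by (auto intro!: le_less_trans [OF mult_left_mono assms(14)])
  interpret kirchhoff_system G \<Omega> p q r \<alpha> \<beta> k a\<^sub>1 a\<^sub>2 b\<^sub>1 b\<^sub>2 \<Lambda>\<^sub>1 \<Lambda>\<^sub>2 h\<^sub>1 h\<^sub>2 h\<^sub>3 g\<^sub>1 g\<^sub>2
    using assms(5-11,17,18,21,24,26) fin dom super le_less_trans [OF powr_ge_zero assms(19)]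
      le_less_trans [OF powr_ge_zero assms(20)]
    by unfold_locales auto
  interpret sw: kirchhoff_system G \<Omega> q p r \<beta> \<alpha> k a\<^sub>2 a\<^sub>1 b\<^sub>2 b\<^sub>1 \<Lambda>\<^sub>2 \<Lambda>\<^sub>1 h\<^sub>3 h\<^sub>2 h\<^sub>1 g\<^sub>2 g\<^sub>1
    by (rule swapped)
  have sw: "sw.n1 = n2" "sw.l1 = l2"
    by (auto simp: fun_eq_iff sw.n1_def n2_def sw.l1_def l2_def)
  have M1: "\<M>\<^sub>1 > 0" unfolding assms(22) using assms(5,6,10,17,18) by simp
  have M2: "\<M>\<^sub>2 > 0"
  proof -
    obtain x where x: "x \<in> \<Omega>" using nonempty by blast
    have "0 < \<bar>h\<^sub>2 x\<bar>" using assms(21) x by force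
    also have "\<dots> \<le> max_norm \<Omega> h\<^sub>2" using x fin by (auto simp: max_norm_def intro!: Max_ge)
    finally show ?thesis unfolding assms(23) using C assms(8,9) by (simp add: less_max_iff_disj)
  qed
  define s0 where "s0 = (\<mu> * \<M>\<^sub>1 / (\<sigma> * \<M>\<^sub>2)) powr (1 / (\<sigma> - \<mu>))"
  have s0: "0 < s0" "s0 \<le> 1"
  proof -
    \<comment> \<open>The comparison between \<open>\<M>\<^sub>1\<close> and
      \<open>\<M>\<^sub>2\<close> says exactly that the maximiser \<open>s0\<close> is at most 1, as
      \<open>cB_ge\<close> demands.\<close>
    have "\<mu> * \<M>\<^sub>1 \<le> \<sigma> * \<M>\<^sub>2"
      using assms(28) \<mu>\<sigma> unfolding \<mu>_def [symmetric] \<sigma>_def [symmetric] by (simp add: field_simps)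
    then show "s0 \<le> 1" unfolding s0_def using M1 M2 \<mu>\<sigma> by (intro powr_le1) auto
    show "0 < s0" using M1 M2 \<mu>\<sigma> by (simp add: s0_def)
  qed
  define hp where "hp = L_norm G \<Omega> (p / (p - r)) h\<^sub>1 powr (p / (p - r))"
  define hq where "hq = L_norm G \<Omega> (q / (q - r)) h\<^sub>3 powr (q / (q - r))"
  define gp where "gp = L_norm G \<Omega> (p / (p - 1)) g\<^sub>1 powr (p / (p - 1))"
  define gq where "gq = L_norm G \<Omega> (q / (q - 1)) g\<^sub>2 powr (q / (q - 1))"
  define K where "K = max (\<Lambda>\<^sub>1 * (p - r) / (p * r)) (\<Lambda>\<^sub>2 * (q - r) / (q * r)) * (hp + hq)
    + max ((p - 1) / p) ((q - 1) / q) * (gp + gq)"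
  \<comment> \<open>The gap in the smallness condition: by \<open>ridge_height\<close> its
    right-hand side is the maximal value attained at \<open>s0\<close>, and \<open>K\<close> is its
    left-hand side.\<close>
  define \<delta> where "\<delta> = \<M>\<^sub>1 * s0 powr \<mu> - \<M>\<^sub>2 * s0 powr \<sigma> - K"
  have \<delta>: "\<delta> > 0"
    using assms(29) ridge_height [OF M1 M2 \<mu>\<sigma>]
    unfolding \<delta>_def s0_def K_def hp_def hq_def gp_def gq_def \<mu>_def \<sigma>_def by simp
  have ridge: "\<delta> \<le> lower u v"
    if uv: "u \<in> Cc_space \<Omega>" "v \<in> Cc_space \<Omega>" and s: "W_norm G \<Omega> p u + W_norm G \<Omega> q v = s0" for u v
  proof -
    have "W_norm G \<Omega> p u \<ge> 0" "W_norm G \<Omega> q v \<ge> 0" by (simp_all add: W_norm_def)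
    then have "\<M>\<^sub>1 * s0 powr \<mu> \<le> cB u v"
      using cB_ge [of u v] s s0 unfolding assms(22) \<mu>_def by simp
    moreover have "cH u v \<le> \<M>\<^sub>2 * s0 powr \<sigma>"
      using coupling_le [OF assms(15,16) uv] s unfolding assms(23) \<sigma>_def by simp
    moreover have "n1 u + \<bar>l1 u\<bar> \<le> \<Lambda>\<^sub>1 * (p - r) / (p * r) * hp + (p - 1) / p * gp + a\<^sub>1 / p * dirichlet G \<Omega> p u"
      using lower_order_terms [OF assms(15,25) uv(1)] by (simp add: hp_def gp_def)
    moreover have "n2 v + \<bar>l2 v\<bar> \<le> \<Lambda>\<^sub>2 * (q - r) / (q * r) * hq + (q - 1) / q * gq + a\<^sub>2 / q * dirichlet G \<Omega> q v"
      using sw.lower_order_terms [OF assms(16,27) uv(2)] unfolding sw by (simp add: hq_def gq_def)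
    moreover have "\<Lambda>\<^sub>1 * (p - r) / (p * r) * hp + (p - 1) / p * gp
        + (\<Lambda>\<^sub>2 * (q - r) / (q * r) * hq + (q - 1) / q * gq) \<le> K"
    proof -
      have nn: "hp \<ge> 0" "hq \<ge> 0" "gp \<ge> 0" "gq \<ge> 0" by (simp_all add: hp_def hq_def gp_def gq_def)
      have "c * z + c' * z' \<le> max c c' * (z + z')" if "z \<ge> 0" "z' \<ge> 0" for c c' z z' :: real
        unfolding distrib_left using that by (intro add_mono mult_right_mono) auto
      from this [OF nn(1,2)] this [OF nn(3,4)] show ?thesis unfolding K_def by (smt (verit))
    qed
    \<comment> \<open>The Dirichlet terms in the two lower-order bounds add up to exactly
      \<open>cA u v\<close> and cancel.\<close>
    ultimately show ?thesis unfolding \<delta>_def lower_def cA_def by linarith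
  qed
  interpret kirchhoff_ridge G \<Omega> p q r \<alpha> \<beta> k a\<^sub>1 a\<^sub>2 b\<^sub>1 b\<^sub>2 \<Lambda>\<^sub>1 \<Lambda>\<^sub>2 h\<^sub>1 h\<^sub>2 h\<^sub>3 g\<^sub>1 g\<^sub>2 "C p" "C q" s0 \<delta>
    by unfold_locales (use assms(15,16) nonempty s0 \<delta> ridge in auto)
  show ?thesis using ex_positive_solution ex_negative_solution by blast
qed

end
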